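(* For $i=2,3$ there exist positive constants $C_i$, independent of $\epsilon$ (and of $h$), such that \[ M_i^h(\boldsymbol\tau,v)\le C_i\,G_i^h(\boldsymbol\tau,v;0)\qquad\text{for all }(\boldsymbol\tau,v)\in\mathcal U_i^h . \]
   Context: Let $\Omega\subset\mathbb R^2$ be a convex polygon with outward unit normal $\mathbf n$. Let $0<\epsilon\le 1$ be a (small) diffusion constant. Let $\boldsymbol\beta\in W^{1,\infty}(\Omega)^2$ and $c\in L^\infty(\Omega)$ with $\|c\|_{L^\infty}\le\gamma$. Assume there is $\alpha_0>0$ with $c-\tfrac12\nabla\cdot\boldsymbol\beta\ge\alpha_0$ a.e. in $\Omega$. The outflow and inflow boundaries are $\Gamma_\pm=\{x\in\partial\Omega:\pm\boldsymbol\beta\cdot\mathbf n(x)>0\}$. It is assumed that $\partial\Omega\setminus(\Gamma_+\cup\Gamma_-)$ has zero surface measure. Meshes and finite element spaces: - $\mathcal T_h$ is a regular, quasi-uniform triangulation of $\Omega$ into triangles $K$ of diameter $h_K\le h$. $\Gamma_+$ is a union of edges of $\mathcal T_h$. - $\mathcal E_h$ is the set of edges, and $h_e$ is the length of edge $e$. - For an integer $k\ge0$, $\Sigma_h^k=\{\boldsymbol\tau\in H(\mathrm{div};\Omega):\boldsymbol\tau|_K\in P_k(K)^2+\mathbf x P_k(K)\ \forall K\}$ is the Raviart–Thomas space. - $V_h^{k+1}=\{v\in H^1(\Omega):v|_K\in P_{k+1}(K)\ \forall K\}$. - $\mathcal U_2=\mathcal U_3=H(\mathrm{div};\Omega)\times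 H^1_{\Gamma_-}(\Omega)$, where $H^1_{\Gamma_-}(\Omega)=\{v\in H^1(\Omega):v=0\text{ on }\Gamma_-\}$. - $\mathcal U_i^h=(\Sigma_h^k\times V_h^{k+1})\cap\mathcal U_i$. Functionals, with $\|\cdot\|$ the $L^2(\Omega)$ norm and $\|\cdot\|_{0,e}$ the $L^2(e)$ norm: - $G_1(\boldsymbol\tau,v;f)=\|\boldsymbol\tau+\epsilon^{1/2}\nabla v\|^2+\|\epsilon^{1/2}\nabla\cdot\boldsymbol\tau+\boldsymbol\beta\cdot\nabla v+cv-f\|^2$. - $G_2^h(\boldsymbol\tau,v;f)=G_1(\boldsymbol\tau,v;f)+\sum_{e\in\mathcal E_h\cap\Gamma_+}h_e^{-1}\|\epsilon^{-1/2}v\|_{0,e}^2$. - $G_3^h(\boldsymbol\tau,v;f)=G_1(\boldsymbol\tau,v;f)+\sum_{e\in\mathcal E_h\cap\Gamma_+}h_e^{-1}\|v\|_{0,e}^2$. Norm functionals: - $M_1(\boldsymbol\tau,v)=\|\boldsymbol\tau\|^2+\|v\|^2+\|\epsilon^{1/2}\nabla v\|^2$. - $M_2^h(\boldsymbol\tau,v)=M_1(\boldsymbol\tau,v)+\sum_{e\in\mathcal E_h\cap\Gamma_+}h_e^{-1}\|\epsilon^{-1/2}v\|_{0,e}^2$. - $M_3^h(\boldsymbol\tau,v)=M_1(\boldsymbol\tau,v)+\sum_{e\in\mathcal E_h\cap\Gamma_+}h_e^{-1}\|v\|_{0,e}^2$. *)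

theory Defs
  imports "HOL-Analysis.Analysis"
begin

type_synonym pt = "real^2"

definition convex_polygon :: "pt set \<Rightarrow> bool" where
  "convex_polygon \<Omega> \<longleftrightarrow> (\<exists>P. finite P \<and> \<Omega> = interior (convex hull P) \<and> \<Omega> \<noteq> {})"

text \<open>u is an outward unit normal of \<Omega> at boundary point x (supporting hyperplane);
  it is unique exactly at non-corner boundary points of a convex polygon.\<close>
definition is_outward_normal :: "pt set \<Rightarrow> pt \<Rightarrow> pt \<Rightarrow> bool" where
  "is_outward_normal \<Omega> x u \<longleftrightarrow> norm u = 1 \<and> (\<forall>y\<in>closure \<Omega>. (y - x) \<bullet> u \<le> 0)"

definition outward_normal :: "pt set \<Rightarrow> pt \<Rightarrow> pt" where
  "outward_normal \<Omega> x = (THE u. is_outward_normal \<Omega> x u)"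

definition Gamma_plus :: "pt set \<Rightarrow> (pt \<Rightarrow> pt) \<Rightarrow> pt set" where
  "Gamma_plus \<Omega> \<beta> = {x \<in> frontier \<Omega>. (\<exists>!u. is_outward_normal \<Omega> x u) \<and>
                                     \<beta> x \<bullet> outward_normal \<Omega> x > 0}"

definition Gamma_minus :: "pt set \<Rightarrow> (pt \<Rightarrow> pt) \<Rightarrow> pt set" where
  "Gamma_minus \<Omega> \<beta> = {x \<in> frontier \<Omega>. (\<exists>!u. is_outward_normal \<Omega> x u) \<and>
                                     \<beta> x \<bullet> outward_normal \<Omega> x < 0}"

definition pderiv2 :: "2 \<Rightarrow> (pt \<Rightarrow> real) \<Rightarrow> pt \<Rightarrow> real" where
  "pderiv2 i f x = frechet_derivative f (at x) (axis i 1)"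

fun Ck :: "nat \<Rightarrow> (pt \<Rightarrow> real) \<Rightarrow> bool" where
  "Ck 0 f \<longleftrightarrow> continuous_on UNIV f"
| "Ck (Suc n) f \<longleftrightarrow> continuous_on UNIV f \<and> (\<forall>x. f differentiable (at x)) \<and>
                     (\<forall>i. Ck n (pderiv2 i f))"

definition test_fn :: "pt set \<Rightarrow> (pt \<Rightarrow> real) \<Rightarrow> bool" where
  "test_fn \<Omega> \<phi> \<longleftrightarrow> (\<forall>n. Ck n \<phi>) \<and> compact (closure {x. \<phi> x \<noteq> 0})
                    \<and> closure {x. \<phi> x \<noteq> 0} \<subseteq> \<Omega>"

definition L2 :: "pt set \<Rightarrow> (pt \<Rightarrow> real) \<Rightarrow> bool" where
  "L2 \<Omega> f \<longleftrightarrow> f \<in> borel_measurable (lebesgue_on \<Omega>) \<and>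
               integrable (lebesgue_on \<Omega>) (\<lambda>x. (f x)\<^sup>2)"

definition Linf :: "pt set \<Rightarrow> (pt \<Rightarrow> real) \<Rightarrow> bool" where
  "Linf \<Omega> f \<longleftrightarrow> f \<in> borel_measurable (lebesgue_on \<Omega>) \<and>
               (\<exists>B. AE x in lebesgue_on \<Omega>. \<bar>f x\<bar> \<le> B)"

definition weak_partial :: "pt set \<Rightarrow> (pt \<Rightarrow> real) \<Rightarrow> 2 \<Rightarrow> (pt \<Rightarrow> real) \<Rightarrow> bool" where
  "weak_partial \<Omega> f i g \<longleftrightarrow> (\<forall>\<phi>. test_fn \<Omega> \<phi> \<longrightarrow>
      (\<integral>x. f x * pderiv2 i \<phi> x \<partial>lebesgue_on \<Omega>) = - (\<integral>x. g x * \<phi> x \<partial>lebesgue_on \<Omega>))"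

definition grad2 :: "(pt \<Rightarrow> real) \<Rightarrow> pt \<Rightarrow> pt" where
  "grad2 \<phi> x = (\<chi> i. pderiv2 i \<phi> x)"

definition weak_div :: "pt set \<Rightarrow> (pt \<Rightarrow> pt) \<Rightarrow> (pt \<Rightarrow> real) \<Rightarrow> bool" where
  "weak_div \<Omega> \<tau> g \<longleftrightarrow> (\<forall>\<phi>. test_fn \<Omega> \<phi> \<longrightarrow>
      (\<integral>x. \<tau> x \<bullet> grad2 \<phi> x \<partial>lebesgue_on \<Omega>) = - (\<integral>x. g x * \<phi> x \<partial>lebesgue_on \<Omega>))"

definition H1 :: "pt set \<Rightarrow> (pt \<Rightarrow> real) \<Rightarrow> bool" where
  "H1 \<Omega> v \<longleftrightarrow> L2 \<Omega> v \<and> (\<forall>i. \<exists>g. L2 \<Omega> g \<and> weak_partial \<Omega> v i g)"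

definition Hdiv :: "pt set \<Rightarrow> (pt \<Rightarrow> pt) \<Rightarrow> bool" where
  "Hdiv \<Omega> \<tau> \<longleftrightarrow> (\<forall>i. L2 \<Omega> (\<lambda>x. \<tau> x $ i)) \<and> (\<exists>g. L2 \<Omega> g \<and> weak_div \<Omega> \<tau> g)"

definition W1inf_field :: "pt set \<Rightarrow> (pt \<Rightarrow> pt) \<Rightarrow> bool" where
  "W1inf_field \<Omega> \<beta> \<longleftrightarrow> (\<forall>i. Linf \<Omega> (\<lambda>x. \<beta> x $ i) \<and>
                          (\<forall>j. \<exists>g. Linf \<Omega> g \<and> weak_partial \<Omega> (\<lambda>x. \<beta> x $ i) j g))"

text \<open>The weak gradient and weak divergence (determined a.e.)\<close>
definition wgrad :: "pt set \<Rightarrow> (pt \<Rightarrow> real) \<Rightarrow> pt \<Rightarrow> pt" where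
  "wgrad \<Omega> v x = (\<chi> i. (SOME g. L2 \<Omega> g \<and> weak_partial \<Omega> v i g) x)"

definition wdiv :: "pt set \<Rightarrow> (pt \<Rightarrow> pt) \<Rightarrow> pt \<Rightarrow> real" where
  "wdiv \<Omega> \<tau> = (SOME g. L2 \<Omega> g \<and> weak_div \<Omega> \<tau> g)"

definition mesh :: "pt set \<Rightarrow> pt set set \<Rightarrow> bool" where
  "mesh \<Omega> T \<longleftrightarrow> finite T \<and> (\<forall>K\<in>T. card K = 3 \<and> \<not> collinear K) \<and>
     \<Union>((\<lambda>K. convex hull K) ` T) = closure \<Omega> \<and>
     (\<forall>K\<in>T. \<forall>K'\<in>T. convex hull K \<inter> convex hull K' = convex hull (K \<inter> K'))"

definition inradius :: "pt set \<Rightarrow> real" where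
  "inradius K = Sup {r. \<exists>x. ball x r \<subseteq> convex hull K}"

definition shape_regular :: "real \<Rightarrow> pt set set \<Rightarrow> bool" where
  "shape_regular \<sigma> T \<longleftrightarrow> (\<forall>K\<in>T. diameter K \<le> \<sigma> * inradius K)"

definition quasi_uniform :: "real \<Rightarrow> pt set set \<Rightarrow> bool" where
  "quasi_uniform \<theta> T \<longleftrightarrow> (\<forall>K\<in>T. \<forall>K'\<in>T. diameter K \<le> \<theta> * diameter K')"

definition edges :: "pt set set \<Rightarrow> pt set set" where
  "edges T = {e. \<exists>K\<in>T. e \<subseteq> K \<and> card e = 2}"

definition outflow_compatible :: "pt set \<Rightarrow> (pt \<Rightarrow> pt) \<Rightarrow> pt set set \<Rightarrow> bool" where
  "outflow_compatible \<Omega> \<beta> T \<longleftrightarrow> (\<forall>a b. {a, b} \<in> edges T \<and> closed_segment a b \<subseteq> frontier \<Omega> \<longrightarrow>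
      open_segment a b \<subseteq> Gamma_plus \<Omega> \<beta> \<or> open_segment a b \<inter> Gamma_plus \<Omega> \<beta> = {})"

definition out_edges :: "pt set \<Rightarrow> (pt \<Rightarrow> pt) \<Rightarrow> pt set set \<Rightarrow> pt set set" where
  "out_edges \<Omega> \<beta> T = {e \<in> edges T. \<exists>a b. e = {a, b} \<and> open_segment a b \<subseteq> Gamma_plus \<Omega> \<beta>}"

definition edge_int :: "pt set \<Rightarrow> (pt \<Rightarrow> real) \<Rightarrow> real" where
  "edge_int e f = (let p = (SOME p. e = {fst p, snd p}) in
     dist (fst p) (snd p) * integral {0..1} (\<lambda>t. f (fst p + t *\<^sub>R (snd p - fst p))))"

definition poly2 :: "nat \<Rightarrow> (pt \<Rightarrow> real) \<Rightarrow> bool" where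
  "poly2 k p \<longleftrightarrow> (\<exists>a :: nat \<Rightarrow> nat \<Rightarrow> real. \<forall>x.
      p x = (\<Sum>(i, j)\<in>{(i, j). i + j \<le> k}. a i j * (x $ 1) ^ i * (x $ 2) ^ j))"

definition RT_space :: "pt set \<Rightarrow> pt set set \<Rightarrow> nat \<Rightarrow> (pt \<Rightarrow> pt) set" where
  "RT_space \<Omega> T k = {\<tau>. Hdiv \<Omega> \<tau> \<and> (\<forall>K\<in>T. \<exists>p1 p2 q. poly2 k p1 \<and> poly2 k p2 \<and> poly2 k q \<and>
      (\<forall>x\<in>interior (convex hull K). \<tau> x = vector [p1 x, p2 x] + q x *\<^sub>R x))}"

definition Lagrange_space :: "pt set \<Rightarrow> pt set set \<Rightarrow> nat \<Rightarrow> (pt \<Rightarrow> real) set" where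
  "Lagrange_space \<Omega> T m = {v. H1 \<Omega> v \<and>
      (\<forall>K\<in>T. \<exists>p. poly2 m p \<and> (\<forall>x\<in>convex hull K. v x = p x))}"

text \<open>U_2^h = U_3^h = (Sigma_h^k x V_h^(k+1)) \<inter> (H(div) x H^1_{Gamma_-})\<close>
definition Uh :: "pt set \<Rightarrow> (pt \<Rightarrow> pt) \<Rightarrow> pt set set \<Rightarrow> nat \<Rightarrow> ((pt \<Rightarrow> pt) \<times> (pt \<Rightarrow> real)) set" where
  "Uh \<Omega> \<beta> T k = {(\<tau>, v). \<tau> \<in> RT_space \<Omega> T k \<and> v \<in> Lagrange_space \<Omega> T (k + 1) \<and>
      Hdiv \<Omega> \<tau> \<and> H1 \<Omega> v \<and> (\<forall>x\<in>Gamma_minus \<Omega> \<beta>. v x = 0)}"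

definition G1 :: "pt set \<Rightarrow> (pt \<Rightarrow> pt) \<Rightarrow> (pt \<Rightarrow> real) \<Rightarrow> real \<Rightarrow>
                  (pt \<Rightarrow> pt) \<Rightarrow> (pt \<Rightarrow> real) \<Rightarrow> (pt \<Rightarrow> real) \<Rightarrow> real" where
  "G1 \<Omega> \<beta> c \<epsilon> \<tau> v f =
     (\<integral>x. (norm (\<tau> x + sqrt \<epsilon> *\<^sub>R wgrad \<Omega> v x))\<^sup>2 \<partial>lebesgue_on \<Omega>) +
     (\<integral>x. (sqrt \<epsilon> * wdiv \<Omega> \<tau> x + \<beta> x \<bullet> wgrad \<Omega> v x + c x * v x - f x)\<^sup>2 \<partial>lebesgue_on \<Omega>)"

definition G2h :: "pt set \<Rightarrow> (pt \<Rightarrow> pt) \<Rightarrow> (pt \<Rightarrow> real) \<Rightarrow> real \<Rightarrow> pt set set \<Rightarrow>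
                  (pt \<Rightarrow> pt) \<Rightarrow> (pt \<Rightarrow> real) \<Rightarrow> (pt \<Rightarrow> real) \<Rightarrow> real" where
  "G2h \<Omega> \<beta> c \<epsilon> T \<tau> v f = G1 \<Omega> \<beta> c \<epsilon> \<tau> v f +
     (\<Sum>e\<in>out_edges \<Omega> \<beta> T. inverse (diameter e) * edge_int e (\<lambda>x. (inverse (sqrt \<epsilon>) * v x)\<^sup>2))"

definition G3h :: "pt set \<Rightarrow> (pt \<Rightarrow> pt) \<Rightarrow> (pt \<Rightarrow> real) \<Rightarrow> real \<Rightarrow> pt set set \<Rightarrow>
                  (pt \<Rightarrow> pt) \<Rightarrow> (pt \<Rightarrow> real) \<Rightarrow> (pt \<Rightarrow> real) \<Rightarrow> real" where
  "G3h \<Omega> \<beta> c \<epsilon> T \<tau> v f = G1 \<Omega> \<beta> c \<epsilon> \<tau> v f +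
     (\<Sum>e\<in>out_edges \<Omega> \<beta> T. inverse (diameter e) * edge_int e (\<lambda>x. (v x)\<^sup>2))"

definition M1 :: "pt set \<Rightarrow> real \<Rightarrow> (pt \<Rightarrow> pt) \<Rightarrow> (pt \<Rightarrow> real) \<Rightarrow> real" where
  "M1 \<Omega> \<epsilon> \<tau> v =
     (\<integral>x. (norm (\<tau> x))\<^sup>2 \<partial>lebesgue_on \<Omega>) + (\<integral>x. (v x)\<^sup>2 \<partial>lebesgue_on \<Omega>) +
     (\<integral>x. (norm (sqrt \<epsilon> *\<^sub>R wgrad \<Omega> v x))\<^sup>2 \<partial>lebesgue_on \<Omega>)"

definition M2h :: "pt set \<Rightarrow> (pt \<Rightarrow> pt) \<Rightarrow> real \<Rightarrow> pt set set \<Rightarrow> (pt \<Rightarrow> pt) \<Rightarrow> (pt \<Rightarrow> real) \<Rightarrow> real" where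
  "M2h \<Omega> \<beta> \<epsilon> T \<tau> v = M1 \<Omega> \<epsilon> \<tau> v +
     (\<Sum>e\<in>out_edges \<Omega> \<beta> T. inverse (diameter e) * edge_int e (\<lambda>x. (inverse (sqrt \<epsilon>) * v x)\<^sup>2))"

definition M3h :: "pt set \<Rightarrow> (pt \<Rightarrow> pt) \<Rightarrow> real \<Rightarrow> pt set set \<Rightarrow> (pt \<Rightarrow> pt) \<Rightarrow> (pt \<Rightarrow> real) \<Rightarrow> real" where
  "M3h \<Omega> \<beta> \<epsilon> T \<tau> v = M1 \<Omega> \<epsilon> \<tau> v +
     (\<Sum>e\<in>out_edges \<Omega> \<beta> T. inverse (diameter e) * edge_int e (\<lambda>x. (v x)\<^sup>2))"

end

theory Submission
  imports Defs
begin

text \<open>Write \<open>g\<close> for the gradient of \<open>v\<close>. Testing the second residual of \<open>G\<^sub>1\<close> with \<open>v\<close> gives control of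
  \<open>\<epsilon>\<parallel>g\<parallel>\<^sup>2 + \<alpha>\<^sub>0\<parallel>v\<parallel>\<^sup>2\<close> up to two boundary terms: \<open>\<integral>(\<beta> \<cdot> n) v\<^sup>2\<close>, which has the good sign because \<open>v\<close>
  vanishes on the inflow boundary, and \<open>\<integral>(\<tau> \<cdot> n) v\<close> over the outflow boundary. The latter is bounded
  by a small multiple of \<open>\<parallel>\<tau>\<parallel>\<^sup>2\<close> plus a multiple of \<open>\<Sum> h\<^sub>e\<^sup>-\<^sup>1 \<parallel>v\<parallel>\<^sup>2\<close> by a discrete trace inequality. Both boundary terms
  are obtained without traces, as limits of integrals against the gradient of a smooth cut-off that
  vanishes near the boundary; on the thin strips where that gradient lives, \<open>\<tau>\<close> and \<open>v\<close> are controlled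
  by an inverse inequality for polynomials, and the area of the strip within a triangle by
  shrinking the triangle towards an inscribed disc.\<close>

section \<open>Smooth functions and mollifiers\<close>

text \<open>The obstacle is that \<open>\<tau>\<close> and \<open>v\<close> have weak derivatives
  only, known through smooth test functions with compact support, while the energy argument
  multiplies by \<open>v\<close> and integrates by parts up to the boundary. The weak identities are
  therefore first extended, by mollification, to test functions built from \<open>v\<close> and a
  cut-off. The jumps of \<open>\<tau>\<close> across edges matter only on a null set.

  Mesh independence is a matter of scaling. In a triangle of size h, a strip of width \<delta> has
  area of order h \<delta>, the gradient of the cut-off is of order 1/\<delta>, the inverse
  inequality bounds |\<tau>|^2 by h^-2 times its integral, and h_e^-1 times an edge integral is a
  mean. Young's inequality with a weight proportional to h cancels every power of h.

  The flux enters with the factor sqrt \<epsilon> \<le> 1, so the edge sum without \<epsilon>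
  suffices, and the weight 1/\<epsilon> \<ge> 1 of the case i = 2 only enlarges it. The share 1/8 of
  the squared norm of \<open>\<tau>\<close> can be absorbed, because that norm is at most twice the
  squared first residual plus 2 \<epsilon> times the squared norm of the gradient; this uses up 1/4
  of the 3/4 that the energy inequality provides.\<close>

definition smooth :: "(pt \<Rightarrow> real) \<Rightarrow> bool" where
  "smooth f \<longleftrightarrow> (\<forall>n. Ck n f)"

lemma Ck_continuous: "Ck n f \<Longrightarrow> continuous_on UNIV f"
  by (cases n) auto

lemma Ck_Suc_imp: "Ck (Suc n) f \<Longrightarrow> Ck n f"
proof (induction n arbitrary: f)
  case (Suc n)
  then show ?case using Ck.simps(2) by blast
qed simp

lemma pderiv2_eqI:
  assumes "(f has_derivative f') (at x)"
  shows "pderiv2 i f x = f' (axis i 1)"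
  using frechet_derivative_at[OF assms] by (simp add: pderiv2_def)

lemma Ck_Suc_has_derivative:
  assumes "Ck (Suc n) f"
  shows "(f has_derivative (\<lambda>h. \<Sum>i\<in>UNIV. pderiv2 i f x * h $ i)) (at x)"
proof -
  have d: "(f has_derivative frechet_derivative f (at x)) (at x)"
    using assms frechet_derivative_works by auto
  then have lin: "linear (frechet_derivative f (at x))"
    using has_derivative_linear by blast
  have "frechet_derivative f (at x) h = (\<Sum>i\<in>UNIV. pderiv2 i f x * h $ i)" for h
  proof -
    have "h = (\<Sum>i\<in>UNIV. h $ i *\<^sub>R axis i 1)"
      by (simp add: vec_eq_iff axis_def if_distrib cong: if_cong)
    then have "frechet_derivative f (at x) h = frechet_derivative f (at x) (\<Sum>i\<in>UNIV. h $ i *\<^sub>R axis i 1)"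
      by simp
    also have "\<dots> = (\<Sum>i\<in>UNIV. h $ i *\<^sub>R frechet_derivative f (at x) (axis i 1))"
      by (simp add: linear_sum[OF lin] linear_scale[OF lin])
    finally show ?thesis by (simp add: pderiv2_def mult.commute)
  qed
  with d show ?thesis by (metis (no_types, lifting) ext)
qed

lemma Ck_SucI:
  assumes "\<And>x. (f has_derivative f' x) (at x)" and "\<And>i. Ck n (\<lambda>x. f' x (axis i 1))"
  shows "Ck (Suc n) f"
proof -
  have "pderiv2 i f = (\<lambda>x. f' x (axis i 1))" for i
    using pderiv2_eqI[OF assms(1)] by auto
  moreover have "continuous_on UNIV f"
    using assms(1) has_derivative_continuous_on has_derivative_at_withinI by blast
  moreover have "f differentiable (at x)" for x
    using assms(1) differentiableI by blast
  ultimately show ?thesis using assms(2) by simp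
qed

lemma Ck_const [simp]: "Ck n (\<lambda>x. a)"
proof (induction n arbitrary: a)
  case (Suc n)
  show ?case by (rule Ck_SucI[where f' = "\<lambda>x h. 0"]) (auto intro: Suc)
qed simp

lemma Ck_add: "Ck n f \<Longrightarrow> Ck n g \<Longrightarrow> Ck n (\<lambda>x. f x + g x)"
proof (induction n arbitrary: f g)
  case (Suc n)
  note d = Suc.prems[THEN Ck_Suc_has_derivative]
  show ?case
    by (rule Ck_SucI[OF has_derivative_add[OF d]])
      (use Suc in \<open>simp add: axis_def if_distrib cong: if_cong\<close>)
qed (auto intro: continuous_intros)

lemma Ck_mult: "Ck n f \<Longrightarrow> Ck n g \<Longrightarrow> Ck n (\<lambda>x. f x * g x)"
proof (induction n arbitrary: f g)
  case (Suc n)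
  note d = Suc.prems[THEN Ck_Suc_has_derivative]
  have "Ck n f" "Ck n g" using Suc.prems Ck_Suc_imp by auto
  then have "Ck n (\<lambda>x. f x * pderiv2 i g x + pderiv2 i f x * g x)" for i
    using Suc by (intro Ck_add Suc.IH) auto
  then show ?case
    by (intro Ck_SucI[OF has_derivative_mult[OF d]])
      (simp add: axis_def if_distrib cong: if_cong)
qed (auto intro: continuous_intros)

lemma Ck_component [simp]: "Ck n (\<lambda>x. x $ i)"
proof (cases n)
  case (Suc m)
  have "((\<lambda>x::pt. x $ i) has_derivative (\<lambda>h. h $ i)) (at x)" for x
    by (rule bounded_linear.has_derivative[OF bounded_linear_vec_nth has_derivative_ident])
  then show ?thesis unfolding Suc
    by (intro Ck_SucI) auto
qed (auto intro!: continuous_intros)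

text \<open>The outer function comes with the whole sequence of its derivatives: the chain rule
  replaces \<open>D m\<close> by \<open>D (Suc m)\<close>, so the induction has to range over all
  \<open>m\<close> at once.\<close>

lemma Ck_compose:
  assumes D: "\<And>m t. (D m has_real_derivative D (Suc m) t) (at t)"
  shows "Ck n f \<Longrightarrow> Ck n (\<lambda>x. D m (f x))"
proof (induction n arbitrary: f m)
  case 0
  have "continuous_on UNIV (D m)"
    using D DERIV_continuous_on has_field_derivative_at_within by blast
  then show ?case using 0 
    by (auto intro: continuous_on_compose2)
next
  case (Suc n)
  note d = Ck_Suc_has_derivative[OF Suc.prems]
  have "((\<lambda>x. D m (f x)) has_derivative (\<lambda>h. D (Suc m) (f x) * (\<Sum>i\<in>UNIV. pderiv2 i f x * h $ i))) (at x)" for x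
    using has_derivative_compose[OF d D[unfolded has_field_derivative_def]] by simp
  moreover have "Ck n (\<lambda>x. D (Suc m) (f x) * pderiv2 i f x)" for i
    using Suc Ck_Suc_imp by (intro Ck_mult Suc.IH) auto
  ultimately show ?case
    by (intro Ck_SucI) (auto simp: axis_def if_distrib cong: if_cong)
qed

lemma smooth_const [simp]: "smooth (\<lambda>x. a)"
  and smooth_component [simp]: "smooth (\<lambda>x. x $ i)"
  and smooth_add: "smooth f \<Longrightarrow> smooth g \<Longrightarrow> smooth (\<lambda>x. f x + g x)"
  and smooth_mult: "smooth f \<Longrightarrow> smooth g \<Longrightarrow> smooth (\<lambda>x. f x * g x)"
  by (auto simp: smooth_def Ck_add Ck_mult)

lemma smooth_sum: "(\<And>i. i \<in> I \<Longrightarrow> smooth (f i)) \<Longrightarrow> smooth (\<lambda>x. \<Sum>i\<in>I. f i x)"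
  by (induction I rule: infinite_finite_induct) (auto intro: smooth_add)

lemma smooth_prod: "(\<And>i. i \<in> I \<Longrightarrow> smooth (f i)) \<Longrightarrow> smooth (\<lambda>x. \<Prod>i\<in>I. f i x)"
  by (induction I rule: infinite_finite_induct) (auto intro: smooth_mult)

lemma smooth_inner [simp]: "smooth (\<lambda>x. a \<bullet> x)"
  unfolding inner_vec_def inner_real_def by (intro smooth_sum smooth_mult) auto

lemma smooth_minus: "smooth f \<Longrightarrow> smooth g \<Longrightarrow> smooth (\<lambda>x. f x - g x)"
  using smooth_add[of f "\<lambda>x. (-1) * g x"] smooth_mult[of "\<lambda>x. -1" g] by simp

lemma smooth_pderiv2: "smooth f \<Longrightarrow> smooth (pderiv2 i f)"
  unfolding smooth_def by (metis Ck.simps(2))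

lemma smooth_continuous: "smooth f \<Longrightarrow> continuous_on S f"
  unfolding smooth_def using Ck_continuous continuous_on_subset by blast

lemma smooth_has_derivative:
  "smooth f \<Longrightarrow> (f has_derivative (\<lambda>h. \<Sum>i\<in>UNIV. pderiv2 i f x * h $ i)) (at x)"
  unfolding smooth_def using Ck_Suc_has_derivative by blast

lemma pderiv2_mult:
  assumes "smooth f" "smooth g"
  shows "pderiv2 i (\<lambda>x. f x * g x) x = f x * pderiv2 i g x + pderiv2 i f x * g x"
  using pderiv2_eqI[OF has_derivative_mult[OF assms[THEN smooth_has_derivative]]]
  by (simp add: axis_def if_distrib cong: if_cong)

lemma Ck_reflect: "Ck n f \<Longrightarrow> Ck n (\<lambda>y. f (x - y))"
proof (induction n arbitrary: f)
  case 0
  then show ?case by (auto intro!: continuous_on_compose2[of UNIV f] continuous_intros)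
next
  case (Suc n)
  have "((\<lambda>y. f (x - y)) has_derivative (\<lambda>h. \<Sum>i\<in>UNIV. pderiv2 i f (x - y) * (- h) $ i)) (at y)" for y
    by (rule has_derivative_compose[OF _ Ck_Suc_has_derivative[OF Suc.prems], where f = "\<lambda>y. x - y" and f' = "\<lambda>h. - h"])
      (auto intro!: derivative_eq_intros)
  moreover have "Ck n (\<lambda>y. (-1) * pderiv2 i f (x - y))" for i
    by (rule Ck_mult) (use Suc in auto)
  ultimately show ?case
    by (intro Ck_SucI) (auto simp: axis_def if_distrib cong: if_cong)
qed

lemma smooth_reflect: "smooth f \<Longrightarrow> smooth (\<lambda>y. f (x - y))"
  by (simp add: smooth_def Ck_reflect)

lemma pderiv2_reflect:
  assumes "smooth f"
  shows "pderiv2 i (\<lambda>y. f (x - y)) y = - pderiv2 i f (x - y)"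
proof -
  have "((\<lambda>y. f (x - y)) has_derivative (\<lambda>h. \<Sum>i\<in>UNIV. pderiv2 i f (x - y) * (- h) $ i)) (at y)" for y
    by (rule has_derivative_compose[OF _ smooth_has_derivative[OF assms], where f = "\<lambda>y. x - y" and f' = "\<lambda>h. - h"])
      (auto intro!: derivative_eq_intros)
  from pderiv2_eqI[OF this] show ?thesis
    by (simp add: axis_def if_distrib sum_negf cong: if_cong)
qed

text \<open>The functions \<open>P (1/t) exp (-1/t)\<close>, extended by zero, are closed under differentiation.\<close>

definition flat_exp :: "real poly \<Rightarrow> real \<Rightarrow> real" where
  "flat_exp P t = (if t \<le> 0 then 0 else poly P (inverse t) * exp (- inverse t))"

text \<open>With s = 1/t the chain rule contributes the factor -s^2, so the derivative of P(s)
  exp(-s) is s^2 (P(s) - P'(s)) exp(-s).\<close>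

definition flat_step :: "real poly \<Rightarrow> real poly" where
  "flat_step P = [:0, 0, 1:] * (P - pderiv P)"

lemma poly_exp_tendsto_0: "((\<lambda>s. poly P s * exp (- s)) \<longlongrightarrow> 0) at_top" for P :: "real poly"
proof -
  have "((\<lambda>s. \<Sum>i\<le>degree P. coeff P i * (s ^ i / exp s)) \<longlongrightarrow> (\<Sum>i\<le>degree P. coeff P i * 0)) at_top"
    by (intro tendsto_intros tendsto_power_div_exp_0)
  then show ?thesis
    by (simp add: poly_altdef sum_distrib_right exp_minus divide_inverse mult.assoc)
qed

lemma flat_exp_has_derivative:
  "(flat_exp P has_real_derivative flat_exp (flat_step P) t) (at t)"
proof (cases t "0::real" rule: linorder_cases)
  case less
  have "((\<lambda>t. 0::real) has_real_derivative 0) (at t)" by simp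
  then have "(flat_exp P has_real_derivative 0) (at t)"
    by (rule has_field_derivative_transform_within_open[of _ _ _ "{..<0}"])
      (use less in \<open>auto simp: flat_exp_def\<close>)
  then show ?thesis using less by (simp add: flat_exp_def)
next
  case greater
  have "((\<lambda>t. poly P (inverse t) * exp (- inverse t)) has_real_derivative
     flat_exp (flat_step P) t) (at t)"
    using greater unfolding flat_exp_def flat_step_def
    by (auto intro!: derivative_eq_intros DERIV_chain'[where g = "poly P"] poly_DERIV
        simp: field_simps power2_eq_square)
  then show ?thesis
    by (rule has_field_derivative_transform_within_open[of _ _ _ "{0<..}"])
      (use greater in \<open>auto simp: flat_exp_def\<close>)
next
  case equal
  \<comment> \<open>\<open>pCons 0 P\<close> is s P(s). At s = 1/h this turns the expression into
    the difference quotient at 0 from the right.\<close>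
  have "((\<lambda>h. poly (pCons 0 P) (inverse h) * exp (- inverse h)) \<longlongrightarrow> 0) (at_right 0)"
    by (rule filterlim_compose[OF poly_exp_tendsto_0 filterlim_inverse_at_top_right])
  then have "((\<lambda>h. flat_exp P h / h) \<longlongrightarrow> 0) (at_right 0)"
    by (rule Lim_transform_eventually)
      (auto simp: eventually_at_filter flat_exp_def field_simps)
  moreover have "((\<lambda>h. flat_exp P h / h) \<longlongrightarrow> 0) (at_left 0)"
    by (rule Lim_transform_eventually[OF tendsto_const])
      (auto simp: eventually_at_filter flat_exp_def)
  ultimately have "((\<lambda>h. flat_exp P h / h) \<longlongrightarrow> 0) (at 0)"
    using filterlim_split_at by blast
  then show ?thesis
    by (simp add: equal has_field_derivative_iff flat_exp_def)
qed

lemma flat_exp_continuous: "continuous_on S (flat_exp P)"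
  by (meson DERIV_continuous_on flat_exp_has_derivative has_field_derivative_at_within)

lemma smooth_flat_exp:
  assumes "smooth f"
  shows "smooth (\<lambda>x. flat_exp P (f x))"
  unfolding smooth_def
proof
  fix n
  show "Ck n (\<lambda>x. flat_exp P (f x))"
    using Ck_compose[of "\<lambda>m. flat_exp ((flat_step ^^ m) P)" n f 0] assms
      flat_exp_has_derivative by (auto simp: smooth_def)
qed

lemma flat_exp_1_pos: "0 < t \<Longrightarrow> 0 < flat_exp 1 t"
  and flat_exp_1_nonneg: "0 \<le> flat_exp 1 t"
  and flat_exp_nonpos [simp]: "t \<le> 0 \<Longrightarrow> flat_exp P t = 0"
  and flat_step_nonneg: "0 \<le> flat_exp (flat_step 1) t"
  by (auto simp: flat_exp_def flat_step_def)

lemma flat_exp_1_mono: "s \<le> t \<Longrightarrow> flat_exp 1 s \<le> flat_exp 1 t"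
  by (rule DERIV_nonneg_imp_nondecreasing) (use flat_exp_has_derivative flat_step_nonneg in blast)+

text \<open>The inner function is constant for \<open>t \<ge> 1\<close> and nonpositive for \<open>t \<le> 0\<close>, so no quotient
  of smooth functions is needed.\<close>

lemma ex_smooth_step:
  obtains s s' :: "real \<Rightarrow> real" and M :: real
  where "\<And>t. (s has_real_derivative s' t) (at t)"
    "\<And>t. 0 \<le> s t" "\<And>t. s t \<le> 1" "\<And>t. t \<le> 0 \<Longrightarrow> s t = 0" "\<And>t. 1 \<le> t \<Longrightarrow> s t = 1"
    "\<And>t. 0 \<le> s' t" "\<And>t. s' t \<le> M" "\<And>t. 1 < t \<Longrightarrow> s' t = 0" "continuous_on UNIV s'"
    "\<And>f. smooth f \<Longrightarrow> smooth (\<lambda>x. s (f x))"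
proof -
  define E where "E = flat_exp 1"
  define E' where "E' = flat_exp (flat_step 1)"
  \<comment> \<open>This choice makes \<open>u\<close> vanish at 0 and reach \<open>k\<close> at 1;
    division by \<open>E k\<close> then normalises the plateau of \<open>s\<close> to 1.\<close>
  define k where "k = E 1"
  define u where "u t = k - E (1 - t)" for t
  define s where "s t = E (u t) / E k" for t
  define s' where "s' t = E' (u t) * E' (1 - t) / E k" for t
  have k: "0 < k" unfolding k_def E_def by (rule flat_exp_1_pos) simp
  then have Ek: "0 < E k" unfolding E_def by (rule flat_exp_1_pos)
  have dE: "(E has_real_derivative E' t) (at t)" for t
    unfolding E_def E'_def by (rule flat_exp_has_derivative)
  have ds: "(s has_real_derivative s' t) (at t)" for t
    unfolding s_def s'_def u_def using Ek
    by (auto intro!: derivative_eq_intros DERIV_chain'[OF _ dE])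
  have u_le: "u t \<le> k" for t using flat_exp_1_nonneg by (simp add: u_def E_def)
  have s0: "s t = 0" if "t \<le> 0" for t
    using flat_exp_1_mono[of 1 "1 - t"] that by (simp add: s_def u_def k_def E_def)
  have s1: "s t = 1" if "1 \<le> t" for t
    using that Ek by (simp add: s_def u_def E_def)
  \<comment> \<open>Continuity bounds \<open>s'\<close> on \<open>{0..1}\<close> only. Elsewhere
    \<open>s\<close> is locally constant, and uniqueness of derivatives gives
    \<open>s' t = 0\<close>.\<close>
  have s'_out: "s' t = 0" if "t < 0 \<or> 1 < t" for t
  proof -
    have "((\<lambda>_. if 1 < t then 1 else 0) has_real_derivative 0) (at t)" by simp
    then have "(s has_real_derivative 0) (at t)"
      by (rule has_field_derivative_transform_within_open[of _ _ _ "if 1 < t then {1<..} else {..<0}"])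
        (use that s0 s1 in \<open>auto split: if_splits\<close>)
    then show ?thesis using DERIV_unique ds by blast
  qed
  have s'_cont: "continuous_on S s'" for S
    unfolding s'_def u_def E_def E'_def using Ek E_def
    by (intro continuous_intros continuous_on_compose2[OF flat_exp_continuous[of UNIV]]) auto
  then obtain M where M: "\<And>t. t \<in> {0..1} \<Longrightarrow> s' t \<le> M"
    using continuous_attains_sup[of "{0..1::real}" s', OF _ _ s'_cont] by (auto intro: that)
  have sm: "smooth (\<lambda>x. s (f x))" if f: "smooth f" for f
  proof -
    have "smooth (\<lambda>x. flat_exp 1 (k - flat_exp 1 (1 - f x)) * inverse (E k))"
      by (intro smooth_mult smooth_flat_exp smooth_minus smooth_const f)
    then show ?thesis by (simp add: s_def u_def E_def divide_inverse)
  qed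
  show ?thesis
  proof (rule that[of s s' "max M 0"])
    show "s t \<le> 1" for t
      using flat_exp_1_mono[OF u_le[of t]] Ek by (simp add: s_def E_def)
    show "s' t \<le> max M 0" for t
      using M[of t] s'_out[of t] by (cases "t \<in> {0..1}") auto
  qed (use ds s0 s1 s'_out s'_cont sm Ek in \<open>auto simp: s_def s'_def E_def E'_def flat_exp_1_nonneg flat_step_nonneg\<close>)
qed

lemma pderiv2_compose_real:
  assumes "(s has_real_derivative s') (at (f x))" "smooth f"
  shows "pderiv2 i (\<lambda>x. s (f x)) x = s' * pderiv2 i f x"
  using pderiv2_eqI[OF has_derivative_compose[OF smooth_has_derivative[OF assms(2)]
        assms(1)[unfolded has_field_derivative_def]]]
  by (simp add: axis_def if_distrib cong: if_cong)

lemma pderiv2_affine: "pderiv2 i (\<lambda>x. b - a \<bullet> x) x = - (a $ i)"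
proof -
  have "((\<lambda>x. b - a \<bullet> x) has_derivative (\<lambda>h. - (a \<bullet> h))) (at x)"
    by (auto intro!: derivative_eq_intros)
  from pderiv2_eqI[OF this] show ?thesis
    by (simp add: inner_axis)
qed

section \<open>Convolution of a continuous, compactly supported function with a smooth one\<close>

definition conv :: "(pt \<Rightarrow> real) \<Rightarrow> (pt \<Rightarrow> real) \<Rightarrow> pt \<Rightarrow> real" where
  "conv w f x = (\<integral>y. w y * f (x - y) \<partial>lborel)"

text \<open>Bridge between the two integrals: differentiation under the integral sign is available
  for the gauge integral over a box, Fubini and dominated convergence for the Bochner
  integral.\<close>

lemma integral_lborel_cbox:
  fixes f :: "'a::euclidean_space \<Rightarrow> real"
  assumes "continuous_on (cbox a b) f" "\<And>x. x \<notin> cbox a b \<Longrightarrow> f x = 0"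
  shows "integrable lborel f" "integral\<^sup>L lborel f = integral (cbox a b) f"
proof -
  have *: "(\<lambda>x. indicator (cbox a b) x *\<^sub>R f x) = f"
    using assms(2) by (force simp: indicator_def fun_eq_iff)
  show i: "integrable lborel f"
    using borel_integrable_compact[OF compact_cbox assms(1)] unfolding * .
  have "integral (cbox a b) f = integral UNIV (\<lambda>x. if x \<in> cbox a b then f x else 0)"
    by (simp add: integral_restrict_UNIV)
  also have "(\<lambda>x. if x \<in> cbox a b then f x else 0) = f" using assms(2) by auto
  finally show "integral\<^sup>L lborel f = integral (cbox a b) f"
    using integral_lborel[OF i] by simp
qed

lemma conv_eq_integral:
  assumes "continuous_on UNIV w" "\<And>y. y \<notin> cbox a b \<Longrightarrow> w y = 0" "continuous_on UNIV f"
  shows "conv w f x = integral (cbox a b) (\<lambda>y. w y * f (x - y))"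
  unfolding conv_def
  by (rule integral_lborel_cbox(2))
    (use assms in \<open>auto intro!: continuous_intros continuous_on_compose2[OF assms(3)] intro: continuous_on_subset\<close>)

text \<open>Differentiation under the integral sign. Every derivative falls on \<open>f\<close>, so
  \<open>w\<close> can be the merely continuous product of a finite element function and a cut-off.
  \<open>leibniz_rule\<close> wants the derivative of the integrand as a continuous family of
  bounded linear maps, hence \<open>fx\<close>.\<close>

lemma has_derivative_conv:
  assumes w: "continuous_on UNIV w" "\<And>y. y \<notin> cbox a b \<Longrightarrow> w y = 0" and f: "Ck (Suc n) f"
  shows "(conv w f has_derivative (\<lambda>h. \<Sum>i\<in>UNIV. conv w (pderiv2 i f) x * h $ i)) (at x)"
proof -
  define B where "B i = Blinfun (\<lambda>h::pt. h $ i)" for i :: 2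
  have B: "blinfun_apply (B i) h = h $ i" for i h
    unfolding B_def by (simp add: bounded_linear_Blinfun_apply bounded_linear_vec_nth)
  define fx where "fx x t = (\<Sum>i\<in>UNIV. (w t * pderiv2 i f (x - t)) *\<^sub>R B i)" for x t
  have cf: "continuous_on UNIV f" and cp: "\<And>i. continuous_on UNIV (pderiv2 i f)"
    using f Ck_continuous by auto
  have c2: "continuous_on (UNIV \<times> cbox a b) (\<lambda>(x, t). fx x t)"
    unfolding fx_def split_beta
    by (intro continuous_intros continuous_on_compose2[OF w(1)] continuous_on_compose2[OF cp]) auto
  have D: "((\<lambda>x. integral (cbox a b) (\<lambda>y. w y * f (x - y))) has_derivative
      blinfun_apply (integral (cbox a b) (fx x))) (at x within UNIV)"
  proof (rule leibniz_rule)
    fix x t assume "t \<in> cbox a b"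
    have "((\<lambda>x. f (x - t)) has_derivative (\<lambda>h. \<Sum>i\<in>UNIV. pderiv2 i f (x - t) * h $ i)) (at x)"
      by (rule has_derivative_compose[OF _ Ck_Suc_has_derivative[OF f], where f = "\<lambda>x. x - t" and f' = "\<lambda>h. h"])
        (auto intro!: derivative_eq_intros)
    then show "((\<lambda>x. w t * f (x - t)) has_derivative blinfun_apply (fx x t)) (at x within UNIV)"
      unfolding fx_def
      by (auto simp: blinfun.sum_left blinfun.scaleR_left B mult.assoc sum_distrib_left
          intro!: derivative_eq_intros)
  next
    fix x
    show "(\<lambda>y. w y * f (x - y)) integrable_on cbox a b"
      by (intro integrable_continuous continuous_intros continuous_on_compose2[OF w(1)]
          continuous_on_compose2[OF cf]) auto
  qed (use c2 in auto)
  have "continuous_on (cbox a b) (fx x)"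
    by (rule continuous_on_compose2[OF c2, where f = "\<lambda>t. (x, t)", unfolded split]) (auto intro!: continuous_intros)
  then have "blinfun_apply (integral (cbox a b) (fx x)) h = integral (cbox a b) (\<lambda>t. fx x t h)" for h
    by (intro blinfun_apply_integral integrable_continuous)
  also have "\<dots> h = (\<Sum>i\<in>UNIV. integral (cbox a b) (\<lambda>t. w t * pderiv2 i f (x - t)) * h $ i)" for h
  proof -
    have "(\<lambda>t. w t * pderiv2 i f (x - t)) integrable_on cbox a b" for i
      by (intro integrable_continuous continuous_intros continuous_on_compose2[OF w(1)]
          continuous_on_compose2[OF cp]) auto
    then show ?thesis
      by (simp add: fx_def blinfun.sum_left blinfun.scaleR_left B integral_sum integrable_on_mult_left)
  qed
  finally have "blinfun_apply (integral (cbox a b) (fx x)) h = (\<Sum>i\<in>UNIV. conv w (pderiv2 i f) x * h $ i)" for h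
    by (simp add: conv_eq_integral[OF w cp])
  moreover have "conv w f = (\<lambda>x. integral (cbox a b) (\<lambda>y. w y * f (x - y)))"
    using conv_eq_integral[OF w cf] by auto
  ultimately show ?thesis using D by (metis (no_types, lifting) ext)
qed

lemma Ck_conv:
  assumes w: "continuous_on UNIV w" "\<And>y. y \<notin> cbox a b \<Longrightarrow> w y = 0"
  shows "(\<And>n. Ck n f) \<Longrightarrow> Ck n (conv w f)"
proof (induction n arbitrary: f)
  case 0
  have "conv w f differentiable (at x)" for x
    using has_derivative_conv[OF w 0] differentiableI by blast
  then have "continuous_on UNIV (conv w f)"
    by (simp add: continuous_at_imp_continuous_on differentiable_imp_continuous_within)
  then show ?case by simp
next
  case (Suc n)
  have "Ck m (pderiv2 i f)" for i m using Suc.prems[of "Suc m"] by simp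
  then show ?case
    by (intro Ck_SucI[OF has_derivative_conv[OF w Suc.prems]])
      (auto simp: axis_def if_distrib cong: if_cong intro: Suc.IH)
qed

lemma smooth_conv:
  assumes "continuous_on UNIV w" "\<And>y. y \<notin> cbox a b \<Longrightarrow> w y = 0" "smooth f"
  shows "smooth (conv w f)" "pderiv2 i (conv w f) x = conv w (pderiv2 i f) x"
proof -
  show "smooth (conv w f)" using Ck_conv[OF assms(1,2)] assms(3) by (simp add: smooth_def)
  have "Ck (Suc 0) f" using assms(3) by (simp only: smooth_def)
  from pderiv2_eqI[OF has_derivative_conv[OF assms(1,2) this]]
  show "pderiv2 i (conv w f) x = conv w (pderiv2 i f) x"
    by (simp add: axis_def if_distrib cong: if_cong)
qed

section \<open>Mollifiers of radius 1/(n + 1)\<close>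

locale mollifier =
  fixes \<rho> :: "nat \<Rightarrow> pt \<Rightarrow> real"
  assumes smooth: "smooth (\<rho> n)" and nonneg: "0 \<le> \<rho> n z" and even: "\<rho> n (- z) = \<rho> n z"
    and support: "inverse (real (Suc n)) \<le> norm z \<Longrightarrow> \<rho> n z = 0"
    and integrable: "integrable lborel (\<rho> n)" and integral: "integral\<^sup>L lborel (\<rho> n) = 1"

lemma ex_mollifier: obtains \<rho> where "mollifier \<rho>"
proof -
  define e where "e n = inverse (real (Suc n))" for n
  \<comment> \<open>Using the squared norm instead of the norm keeps the bump smooth at the origin
    and makes it even.\<close>
  define b where "b n z = flat_exp 1 ((e n)\<^sup>2 - z \<bullet> z)" for n and z :: pt
  define I where "I n = integral\<^sup>L lborel (b n)" for n
  have e: "0 < e n" for n by (simp add: e_def)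
  have sb: "smooth (b n)" for n
    unfolding b_def inner_vec_def inner_real_def
    by (intro smooth_flat_exp smooth_minus smooth_const smooth_sum smooth_mult smooth_component)
  have b0: "b n z = 0" if "e n \<le> norm z" for n z
    using that e[of n] power_mono[of "e n" "norm z" 2] by (simp add: b_def power2_norm_eq_inner)
  have b_nonneg: "0 \<le> b n z" for n z by (simp add: b_def flat_exp_1_nonneg)
  obtain u v :: "nat \<Rightarrow> pt" where uv: "\<And>n. cball 0 (e n) \<subseteq> cbox (u n) (v n)"
  proof -
    have "\<exists>a. cball 0 (e n) \<subseteq> cbox (- a) (a::pt)" for n
      using bounded_subset_cbox_symmetric[OF bounded_cball] by metis
    then obtain a :: "nat \<Rightarrow> pt" where "\<And>n. cball 0 (e n) \<subseteq> cbox (- a n) (a n)" by metis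
    then show ?thesis by (rule that)
  qed
  have int: "integrable lborel (b n)" for n
    by (rule integral_lborel_cbox(1)[of "u n" "v n"])
      (use uv[of n] b0[of n] smooth_continuous[OF sb] in \<open>force simp: subset_iff\<close>)+
  have I: "0 < I n" for n
  proof -
    have pos: "0 < b n z" if "z \<in> ball 0 (e n)" for z
      using that power_strict_mono[of "norm z" "e n" 2] e[of n]
      by (auto simp: b_def power2_norm_eq_inner intro!: flat_exp_1_pos)
    \<comment> \<open>A nonnegative function with zero integral vanishes almost everywhere, but the
      bump is positive on an open ball, which is not negligible.\<close>
    have "\<not> (AE z in lborel. b n z = 0)"
    proof
      assume "AE z in lborel. b n z = 0"
      then have "AE z in lborel. z \<notin> ball (0::pt) (e n)"
        by (rule eventually_mono) (use pos in force)
      then have "ball 0 (e n) \<in> null_sets (lborel::pt measure)"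
        using AE_iff_null_sets[of "ball 0 (e n)" "lborel :: pt measure"] by simp
      then have "negligible (ball (0::pt) (e n))"
        using negligible_iff_null_sets null_sets_completionI by blast
      then show False using e[of n] open_not_negligible[of "ball (0::pt) (e n)"] by auto
    qed
    then have "I n \<noteq> 0"
      unfolding I_def using integral_nonneg_eq_0_iff_AE[OF int] b_nonneg by simp
    then show ?thesis
      using Bochner_Integration.integral_nonneg[of lborel "b n", OF b_nonneg]
      by (simp add: I_def less_le)
  qed
  show ?thesis
  proof (rule that[of "\<lambda>n z. b n z * inverse (I n)"], unfold_locales)
    show "smooth (\<lambda>z. b n z * inverse (I n))" for n
      by (intro smooth_mult sb smooth_const)
    show "inverse (real (Suc n)) \<le> norm z \<Longrightarrow> b n z * inverse (I n) = 0" for n z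
      using b0 by (simp add: e_def)
    show "b n (- z) * inverse (I n) = b n z * inverse (I n)" for n z by (simp add: b_def)
    show "integral\<^sup>L lborel (\<lambda>z. b n z * inverse (I n)) = 1" for n
      using I[of n] by (simp flip: I_def)
  qed (use b_nonneg I int in \<open>auto simp: less_imp_le\<close>)
qed

section \<open>Weak derivatives of compactly supported functions\<close>

lemma lborel_translate:
  fixes f :: "'a::euclidean_space \<Rightarrow> real"
  assumes "integrable lborel f"
  shows "integrable lborel (\<lambda>x. f (c + x))" "(\<integral>x. f (c + x) \<partial>lborel) = integral\<^sup>L lborel f"
proof -
  have f: "f \<in> borel_measurable borel" using assms by simp
  have i: "integrable (distr lborel borel ((+) c)) f" using assms by (simp add: lborel_distr_plus)
  show "integrable lborel (\<lambda>x. f (c + x))"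
    using i by (subst (asm) integrable_distr_eq) (use f in auto)
  have "integral\<^sup>L (distr lborel borel ((+) c)) f = (\<integral>x. f (c + x) \<partial>lborel)"
    by (rule integral_distr) (use f in auto)
  then show "(\<integral>x. f (c + x) \<partial>lborel) = integral\<^sup>L lborel f" by (simp add: lborel_distr_plus)
qed

lemma smooth_borel [measurable]: "smooth f \<Longrightarrow> f \<in> borel_measurable borel"
  using borel_measurable_continuous_onI smooth_continuous by blast

lemma bounded_on_cbox_obtain:
  fixes f :: "'a::euclidean_space \<Rightarrow> real"
  assumes "continuous_on UNIV f"
  obtains B where "0 \<le> B" "\<And>x. x \<in> cbox a b \<Longrightarrow> \<bar>f x\<bar> \<le> B"
proof -
  have "bounded (f ` cbox a b)"
    by (intro compact_imp_bounded compact_continuous_image compact_cbox) (use assms continuous_on_subset in blast)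
  then show ?thesis
    unfolding bounded_pos using that by (auto intro: less_imp_le)
qed

lemma bounded_cpt_obtain:
  fixes f :: "'a::euclidean_space \<Rightarrow> real"
  assumes "continuous_on UNIV f" "\<And>x. x \<notin> cbox a b \<Longrightarrow> f x = 0"
  obtains B where "0 \<le> B" "\<And>x. \<bar>f x\<bar> \<le> B"
proof -
  obtain B where "0 \<le> B" "\<And>x. x \<in> cbox a b \<Longrightarrow> \<bar>f x\<bar> \<le> B"
    using bounded_on_cbox_obtain[OF assms(1)] by metis
  then show ?thesis using that assms(2) by (metis abs_zero)
qed

text \<open>The bound on \<open>g\<close> is required only where \<open>f\<close> is nonzero. A
  smooth factor without compact support is bounded just on the support of the other factor.\<close>

lemma integrable_mult_bounded:
  fixes f g :: "'a \<Rightarrow> real"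
  assumes "integrable M f" "g \<in> borel_measurable M" "AE x in M. f x \<noteq> 0 \<longrightarrow> \<bar>g x\<bar> \<le> B"
  shows "integrable M (\<lambda>x. f x * g x)"
proof (rule Bochner_Integration.integrable_bound)
  show "integrable M (\<lambda>x. B * f x)" using assms(1) by simp
  show "AE x in M. norm (f x * g x) \<le> norm (B * f x)"
    using assms(3)
  proof eventually_elim
    case (elim x)
    show ?case
    proof (cases "f x = 0")
      case False
      then have "\<bar>g x\<bar> \<le> \<bar>B\<bar>" using elim by linarith
      then show ?thesis by (simp add: abs_mult mult_right_mono mult.commute[of "\<bar>f x\<bar>"])
    qed simp
  qed
qed (use assms in measurable)

text \<open>Moves the kernel from \<open>G\<close> to \<open>f\<close>. Since f(x) G(y) is
  integrable on the product space, boundedness of \<open>k\<close> gives the joint integrability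
  that Fubini needs.\<close>

lemma Fubini_conv:
  fixes f G k :: "pt \<Rightarrow> real"
  assumes f: "integrable lborel f" and G: "integrable lborel G"
    and k[measurable]: "k \<in> borel_measurable borel" and B: "\<And>x. \<bar>k x\<bar> \<le> B"
  shows "(\<integral>x. f x * (\<integral>y. G y * k (x - y) \<partial>lborel) \<partial>lborel) = (\<integral>y. G y * (\<integral>x. f x * k (x - y) \<partial>lborel) \<partial>lborel)"
proof -
  have [measurable]: "f \<in> borel_measurable borel" "G \<in> borel_measurable borel"
    using f G by auto
  have "integrable (lborel \<Otimes>\<^sub>M lborel) (\<lambda>(x, y). f x * G y)"
  proof (rule lborel_pair.Fubini_integrable)
    show "integrable lborel (\<lambda>x. \<integral>y. norm (case (x, y) of (x, y) \<Rightarrow> f x * G y) \<partial>lborel)"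
      using f by (simp add: abs_mult)
    show "AE x in lborel. integrable lborel (\<lambda>y. case (x, y) of (x, y) \<Rightarrow> f x * G y)"
      using G by simp
  qed measurable
  then have "integrable (lborel \<Otimes>\<^sub>M lborel) (\<lambda>z. (case z of (x, y) \<Rightarrow> f x * G y) * (case z of (x, y) \<Rightarrow> k (x - y)))"
    by (rule integrable_mult_bounded[where B = B]) (use B in \<open>auto simp: split_beta\<close>)
  then have i: "integrable (lborel \<Otimes>\<^sub>M lborel) (\<lambda>(x, y). f x * G y * k (x - y))"
    by (simp add: case_prod_beta')
  have "(\<integral>x. f x * (\<integral>y. G y * k (x - y) \<partial>lborel) \<partial>lborel) = (\<integral>x. (\<integral>y. f x * G y * k (x - y) \<partial>lborel) \<partial>lborel)"
    by (simp add: mult.assoc)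
  also have "\<dots> = (\<integral>y. (\<integral>x. f x * G y * k (x - y) \<partial>lborel) \<partial>lborel)"
    by (rule lborel_pair.Fubini_integral[OF i, symmetric])
  also have "\<dots> = (\<integral>y. (\<integral>x. G y * (f x * k (x - y)) \<partial>lborel) \<partial>lborel)"
    by (simp add: ac_simps)
  finally show ?thesis by simp
qed

text \<open>A substitute for continuity at \<open>y\<close> that only depends on \<open>f\<close> up to null sets.\<close>

definition ess_cont :: "(pt \<Rightarrow> real) \<Rightarrow> pt \<Rightarrow> bool" where
  "ess_cont f y \<longleftrightarrow> (\<forall>e>0. \<exists>d>0. AE x in lborel. norm (x - y) < d \<longrightarrow> \<bar>f x - f y\<bar> \<le> e)"

lemma isCont_imp_ess_cont: "isCont f y \<Longrightarrow> ess_cont f y"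
  unfolding ess_cont_def isCont_def LIM_def
  by (metis (mono_tags, lifting) AE_I2 dist_norm dist_self less_eq_real_def real_norm_def)

context mollifier
begin

text \<open>The adjoint of convolution with \<open>\<rho> n\<close>, which appears once Fubini has
  moved the kernel. As \<open>\<rho> n\<close> is even, the two operators coincide
  (\<open>conv_eq_moll\<close>).\<close>

definition moll :: "(pt \<Rightarrow> real) \<Rightarrow> nat \<Rightarrow> pt \<Rightarrow> real" where
  "moll f n y = (\<integral>x. f x * \<rho> n (x - y) \<partial>lborel)"

lemma conv_eq_moll: "conv f (\<rho> n) = moll f n"
proof
  fix x
  have "\<rho> n (x - y) = \<rho> n (y - x)" for y using even[of n "y - x"] by simp
  then show "conv f (\<rho> n) x = moll f n x" by (simp add: conv_def moll_def)
qed

lemma shift: "integrable lborel (\<lambda>x. \<rho> n (x - y))" "(\<integral>x. \<rho> n (x - y) \<partial>lborel) = 1"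
  using lborel_translate[OF integrable, of n "- y"] integral by simp_all

lemma borel [measurable]: "\<rho> n \<in> borel_measurable borel"
  using smooth smooth_borel by blast

lemma bounded: obtains B where "\<And>z. \<bar>\<rho> n z\<bar> \<le> B"
proof -
  obtain a where a: "cball 0 (inverse (real (Suc n))) \<subseteq> cbox (- a) (a::pt)"
    using bounded_subset_cbox_symmetric[OF bounded_cball] by metis
  have "\<rho> n z = 0" if "z \<notin> cbox (-a) a" for z
    using support[of n z] a that by force
  with bounded_cpt_obtain[of "\<rho> n" "-a" a] smooth_continuous[OF smooth] that show ?thesis by metis
qed

lemma integrable_moll:
  assumes "f \<in> borel_measurable borel" "\<And>x. \<bar>f x\<bar> \<le> B"
  shows "integrable lborel (\<lambda>x. f x * \<rho> n (x - y))"
proof -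
  have "integrable lborel (\<lambda>x. \<rho> n (x - y) * f x)"
    by (rule integrable_mult_bounded[OF shift(1), where B = B]) (use assms in auto)
  then show ?thesis by (simp add: mult.commute)
qed

lemma moll_borel [measurable]:
  assumes [measurable]: "f \<in> borel_measurable borel"
  shows "moll f n \<in> borel_measurable borel"
proof -
  have "(\<lambda>y. \<integral>x. f x * \<rho> n (x - y) \<partial>lborel) \<in> borel_measurable lborel"
    by measurable
  then show ?thesis by (simp add: moll_def[abs_def])
qed

text \<open>The difference is an average of \<open>f x - c\<close> against a kernel of mass 1 that
  lives in the ball of radius 1/(n + 1) around \<open>y\<close>, so an almost everywhere bound on
  that ball is enough.\<close>

lemma moll_close:
  assumes f: "f \<in> borel_measurable borel" "\<And>x. \<bar>f x\<bar> \<le> B"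
    and AE: "AE x in lborel. norm (x - y) < inverse (real (Suc n)) \<longrightarrow> \<bar>f x - c\<bar> \<le> e"
  shows "\<bar>moll f n y - c\<bar> \<le> e"
proof -
  have i: "integrable lborel (\<lambda>x. (f x - c) * \<rho> n (x - y))"
    using integrable_moll[OF f] shift(1) by (simp add: left_diff_distrib)
  have "moll f n y - c = (\<integral>x. (f x - c) * \<rho> n (x - y) \<partial>lborel)"
    using integrable_moll[OF f] shift by (simp add: left_diff_distrib moll_def)
  also have "\<bar>\<dots>\<bar> \<le> (\<integral>x. \<bar>(f x - c) * \<rho> n (x - y)\<bar> \<partial>lborel)"
    using integral_abs_bound by blast
  also have "\<dots> \<le> (\<integral>x. e * \<rho> n (x - y) \<partial>lborel)"
  proof (rule integral_mono_AE)
    show "AE x in lborel. \<bar>(f x - c) * \<rho> n (x - y)\<bar> \<le> e * \<rho> n (x - y)"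
      using AE
    proof eventually_elim
      case (elim x)
      then show ?case
        by (cases "norm (x - y) < inverse (real (Suc n))")
          (use nonneg support[of n "x - y"] in \<open>auto simp: abs_mult mult_right_mono\<close>)
    qed
  qed (use i shift in auto)
  finally show ?thesis using shift by simp
qed

lemma moll_bound:
  assumes "f \<in> borel_measurable borel" "\<And>x. \<bar>f x\<bar> \<le> B"
  shows "\<bar>moll f n y\<bar> \<le> B"
  using moll_close[OF assms, where c = 0 and e = B] assms(2) by simp

lemma moll_tendsto:
  assumes f: "f \<in> borel_measurable borel" "\<And>x. \<bar>f x\<bar> \<le> B" and "ess_cont f y"
  shows "(\<lambda>n. moll f n y) \<longlonglongrightarrow> f y"
proof (rule LIMSEQ_I)
  fix r :: real assume "0 < r"
  then obtain d where d: "d > 0" "AE x in lborel. norm (x - y) < d \<longrightarrow> \<bar>f x - f y\<bar> \<le> r / 2"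
    using assms(3) unfolding ess_cont_def by (meson half_gt_zero)
  obtain N where N: "inverse (real (Suc N)) < d"
    using d(1) reals_Archimedean by blast
  have "norm (moll f n y - f y) < r" if "N \<le> n" for n
  proof -
    have "inverse (real (Suc n)) \<le> inverse (real (Suc N))" using that by simp
    then have "AE x in lborel. norm (x - y) < inverse (real (Suc n)) \<longrightarrow> \<bar>f x - f y\<bar> \<le> r / 2"
      by (intro eventually_mono[OF d(2)]) (use N in linarith)
    from moll_close[OF f this] \<open>0 < r\<close> show ?thesis by simp
  qed
  then show "\<exists>N. \<forall>n\<ge>N. norm (moll f n y - f y) < r" by blast
qed

text \<open>Dominated convergence with the majorant B |H|. Pointwise convergence is needed only
  where \<open>H\<close> is nonzero and only almost everywhere, so jumps of \<open>f\<close> on a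
  null set or off the support of \<open>H\<close> do no harm.\<close>

lemma integral_moll_tendsto:
  assumes f: "f \<in> borel_measurable borel" "\<And>x. \<bar>f x\<bar> \<le> B"
    and H: "integrable lborel H" and AE: "AE y in lborel. H y \<noteq> 0 \<longrightarrow> ess_cont f y"
  shows "(\<lambda>n. \<integral>y. H y * moll f n y \<partial>lborel) \<longlonglongrightarrow> (\<integral>y. H y * f y \<partial>lborel)"
proof (rule integral_dominated_convergence)
  have [measurable]: "H \<in> borel_measurable borel" "f \<in> borel_measurable borel" using H f by auto
  show "(\<lambda>y. H y * f y) \<in> borel_measurable lborel" "(\<lambda>y. H y * moll f n y) \<in> borel_measurable lborel" for n
    by measurable
  show "integrable lborel (\<lambda>y. B * \<bar>H y\<bar>)" using H by simp
  show "AE y in lborel. (\<lambda>n. H y * moll f n y) \<longlonglongrightarrow> H y * f y"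
    using AE
  proof eventually_elim
    case (elim y)
    then show ?case using moll_tendsto[OF f] by (cases "H y = 0") (auto intro: tendsto_intros)
  qed
  show "AE y in lborel. norm (H y * moll f n y) \<le> B * \<bar>H y\<bar>" for n
    using moll_bound[OF f] by (auto simp: abs_mult intro!: AE_I2 mult_right_mono simp: mult.commute[of "\<bar>H _\<bar>"])
qed

end

text \<open>Test functions are not required to have compact support, since \<open>w\<close> will have it.\<close>

definition weak_pd :: "(pt \<Rightarrow> real) \<Rightarrow> 2 \<Rightarrow> (pt \<Rightarrow> real) \<Rightarrow> bool" where
  "weak_pd w i G \<longleftrightarrow> integrable lborel G \<and>
     (\<forall>\<phi>. smooth \<phi> \<longrightarrow> (\<integral>x. w x * pderiv2 i \<phi> x \<partial>lborel) = - (\<integral>x. G x * \<phi> x \<partial>lborel))"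

text \<open>The weak derivative is tested with the reflected kernel; the sign from the reflection
  cancels the sign from the integration by parts.\<close>

lemma (in mollifier) pderiv2_conv:
  assumes w: "continuous_on UNIV w" "\<And>y. y \<notin> cbox a b \<Longrightarrow> w y = 0" and G: "weak_pd w i G"
  shows "pderiv2 i (conv w (\<rho> n)) x = conv G (\<rho> n) x"
proof -
  have "pderiv2 i (conv w (\<rho> n)) x = (\<integral>y. w y * pderiv2 i (\<rho> n) (x - y) \<partial>lborel)"
    by (simp add: smooth_conv(2)[OF w smooth] conv_def)
  also have "\<dots> = - (\<integral>y. w y * pderiv2 i (\<lambda>y. \<rho> n (x - y)) y \<partial>lborel)"
    by (simp add: pderiv2_reflect[OF smooth])
  also have "\<dots> = conv G (\<rho> n) x"
    using G smooth_reflect[OF smooth] by (simp add: weak_pd_def conv_def)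
  finally show ?thesis .
qed

text \<open>Testing with the product of \<open>\<phi>\<close> and the mollified function turns one half of the product rule
  into the weak derivative itself.\<close>

lemma weak_pd_power2:
  assumes w: "continuous_on UNIV w" "\<And>y. y \<notin> cbox a b \<Longrightarrow> w y = 0"
    and G: "weak_pd w i G" "\<And>y. y \<notin> cbox a b \<Longrightarrow> G y = 0"
  shows "weak_pd (\<lambda>x. (w x)\<^sup>2) i (\<lambda>x. 2 * w x * G x)"
  unfolding weak_pd_def
proof (intro conjI allI impI)
  have iG: "integrable lborel G" using G by (simp add: weak_pd_def)
  have [measurable]: "w \<in> borel_measurable borel" "G \<in> borel_measurable borel"
    using w borel_measurable_continuous_onI iG by auto
  obtain B where B: "0 \<le> B" "\<And>x. \<bar>w x\<bar> \<le> B" using bounded_cpt_obtain[OF w] by metis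
  have iGw: "integrable lborel (\<lambda>x. G x * w x)"
    by (rule integrable_mult_bounded[OF iG, where B = B]) (use B in auto)
  then have "integrable lborel (\<lambda>x. 2 * (G x * w x))" by simp
  then show "integrable lborel (\<lambda>x. 2 * w x * G x)" by (simp add: ac_simps)
  fix \<phi> assume \<phi>: "smooth \<phi>"
  have [measurable]: "\<phi> \<in> borel_measurable borel" "pderiv2 i \<phi> \<in> borel_measurable borel"
    using \<phi> smooth_borel smooth_pderiv2 by auto
  have c\<phi>: "continuous_on UNIV \<phi>" "continuous_on UNIV (pderiv2 i \<phi>)"
    using \<phi> smooth_continuous smooth_pderiv2 by auto
  obtain \<rho> where "mollifier \<rho>" by (rule ex_mollifier)
  then interpret mollifier \<rho> .
  define u where "u n = conv w (\<rho> n)" for n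
  have u: "smooth (u n)" for n
    unfolding u_def by (rule smooth_conv(1)[OF w smooth])
  have ew: "ess_cont w y" for y
    using w(1) by (intro isCont_imp_ess_cont) (simp add: continuous_on_eq_continuous_at)
  have iw: "integrable lborel (\<lambda>x. w x * h x)" if "continuous_on UNIV h" for h
    by (rule integral_lborel_cbox(1)[of a b]) (use w that in \<open>auto intro!: continuous_intros intro: continuous_on_subset\<close>)
  have cu: "continuous_on UNIV (u n)" for n using smooth_continuous[OF u] .
  have eq: "(\<integral>x. (w x * \<phi> x) * conv G (\<rho> n) x \<partial>lborel) + (\<integral>x. (w x * pderiv2 i \<phi> x) * u n x \<partial>lborel)
      = - (\<integral>x. (G x * \<phi> x) * u n x \<partial>lborel)" for n
  proof -
    have "(\<integral>x. w x * pderiv2 i (\<lambda>x. \<phi> x * u n x) x \<partial>lborel) = - (\<integral>x. G x * (\<phi> x * u n x) \<partial>lborel)"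
      using G(1) smooth_mult[OF \<phi> u] by (simp add: weak_pd_def)
    moreover have "w x * pderiv2 i (\<lambda>x. \<phi> x * u n x) x = w x * (\<phi> x * pderiv2 i (u n) x) + w x * (pderiv2 i \<phi> x * u n x)" for x
      by (simp add: pderiv2_mult[OF \<phi> u] algebra_simps)
    moreover have "integrable lborel (\<lambda>x. w x * (\<phi> x * pderiv2 i (u n) x))"
      "integrable lborel (\<lambda>x. w x * (pderiv2 i \<phi> x * u n x))"
      by (intro iw continuous_intros c\<phi> cu smooth_continuous[OF smooth_pderiv2[OF u]])+
    ultimately show ?thesis
      using pderiv2_conv[OF w G(1)] by (simp add: u_def mult.assoc)
  qed
  obtain P where P: "0 \<le> P" "\<And>x. x \<in> cbox a b \<Longrightarrow> \<bar>\<phi> x\<bar> \<le> P"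
    using bounded_on_cbox_obtain[OF c\<phi>(1)] by metis
  have cw\<phi>: "continuous_on UNIV (\<lambda>x. w x * \<phi> x)" by (intro continuous_intros w c\<phi>)
  obtain Q where Q: "\<And>x. \<bar>w x * \<phi> x\<bar> \<le> Q"
    using bounded_cpt_obtain[OF cw\<phi>, of a b] w by (metis mult_zero_left)
  \<comment> \<open>\<open>G\<close> is only integrable, so its mollification need not converge at a
    given point. The kernel is moved to the continuous factor \<open>w x * \<phi> x\<close>, whose
    mollifications do converge.\<close>
  have "(\<integral>x. (w x * \<phi> x) * conv G (\<rho> n) x \<partial>lborel) = (\<integral>y. G y * moll (\<lambda>x. w x * \<phi> x) n y \<partial>lborel)" for n
  proof -
    obtain R where "\<And>z. \<bar>\<rho> n z\<bar> \<le> R" using bounded[of n] by metis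
    from Fubini_conv[OF iw[OF c\<phi>(1)] iG borel this] show ?thesis by (simp add: conv_def moll_def)
  qed
  then have l1: "(\<lambda>n. \<integral>x. (w x * \<phi> x) * conv G (\<rho> n) x \<partial>lborel) \<longlonglongrightarrow> (\<integral>y. G y * (w y * \<phi> y) \<partial>lborel)"
    using integral_moll_tendsto[OF _ Q iG] isCont_imp_ess_cont cw\<phi>
    by (simp add: continuous_on_eq_continuous_at)
  have l2: "(\<lambda>n. \<integral>x. (w x * pderiv2 i \<phi> x) * u n x \<partial>lborel) \<longlonglongrightarrow> (\<integral>x. (w x * pderiv2 i \<phi> x) * w x \<partial>lborel)"
    unfolding u_def conv_eq_moll using ew
    by (intro integral_moll_tendsto[OF _ B(2)] iw c\<phi>) auto
  have "integrable lborel (\<lambda>x. G x * \<phi> x)"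
    by (rule integrable_mult_bounded[OF iG, where B = P]) (use P G in auto)
  then have l3: "(\<lambda>n. - (\<integral>x. (G x * \<phi> x) * u n x \<partial>lborel)) \<longlonglongrightarrow> - (\<integral>x. (G x * \<phi> x) * w x \<partial>lborel)"
    unfolding u_def conv_eq_moll using ew
    by (intro tendsto_minus integral_moll_tendsto[OF _ B(2)]) auto
  have "(\<integral>y. G y * (w y * \<phi> y) \<partial>lborel) + (\<integral>x. (w x * pderiv2 i \<phi> x) * w x \<partial>lborel) = - (\<integral>x. (G x * \<phi> x) * w x \<partial>lborel)"
    by (rule LIMSEQ_unique[OF tendsto_add[OF l1 l2]]) (use l3 eq in simp)
  moreover have "(\<lambda>x. 2 * w x * G x * \<phi> x) = (\<lambda>x. 2 * (G x * (w x * \<phi> x)))" by auto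
  moreover have "(\<lambda>x. (w x)\<^sup>2 * pderiv2 i \<phi> x) = (\<lambda>x. (w x * pderiv2 i \<phi> x) * w x)"
    "(\<lambda>x. (G x * \<phi> x) * w x) = (\<lambda>x. G x * (w x * \<phi> x))"
    by (auto simp: power2_eq_square)
  ultimately show "(\<integral>x. (w x)\<^sup>2 * pderiv2 i \<phi> x \<partial>lborel) = - (\<integral>x. 2 * w x * G x * \<phi> x \<partial>lborel)"
    by (simp only: integral_mult_right_zero)
qed

text \<open>The support of the convolution lies in the sum of \<open>S\<close> and a ball of radius
  1/(n + 1), hence in \<Omega> once this radius is below the distance from \<open>S\<close> to the
  complement.\<close>

lemma (in mollifier) test_fn_conv:
  assumes w: "continuous_on UNIV w" "compact S" "\<And>y. y \<notin> S \<Longrightarrow> w y = 0" and S: "open \<Omega>" "S \<subseteq> \<Omega>"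
  shows "eventually (\<lambda>n. test_fn \<Omega> (conv w (\<rho> n))) sequentially"
proof -
  obtain a b where ab: "S \<subseteq> cbox a b"
    using compact_imp_bounded[OF w(2)] bounded_subset_cbox_symmetric by metis
  have sm: "smooth (conv w (\<rho> n))" for n
    by (rule smooth_conv(1)[OF w(1) _ smooth, of a b]) (use ab w in auto)
  obtain e where e: "e > 0" "(\<Union>x\<in>S. ball x e) \<subseteq> \<Omega>"
    using compact_subset_open_imp_ball_epsilon_subset[OF w(2) S] by metis
  obtain N where N: "inverse (real (Suc N)) < e" using e reals_Archimedean by blast
  have "test_fn \<Omega> (conv w (\<rho> n))" if "N \<le> n" for n
  proof -
    define r where "r = inverse (real (Suc n))"
    have "r \<le> inverse (real (Suc N))" using that by (simp add: r_def)
    then have r: "r < e" using N by simp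
    define C where "C = {x + y |x y. x \<in> S \<and> y \<in> cball 0 r}"
    have C: "compact C" unfolding C_def by (intro compact_sums w compact_cball)
    have "C \<subseteq> \<Omega>"
    proof
      fix z assume "z \<in> C"
      then obtain x y where "z = x + y" "x \<in> S" "norm y \<le> r" by (auto simp: C_def)
      then have "z \<in> ball x e" using r by (simp add: dist_norm)
      then show "z \<in> \<Omega>" using e \<open>x \<in> S\<close> by blast
    qed
    have "x \<in> C" if "conv w (\<rho> n) x \<noteq> 0" for x
    proof -
      have "\<exists>y. w y * \<rho> n (x - y) \<noteq> 0"
      proof (rule ccontr)
        assume "\<nexists>y. w y * \<rho> n (x - y) \<noteq> 0"
        then have "(\<lambda>y. w y * \<rho> n (x - y)) = (\<lambda>y. 0)" by auto
        then show False using that by (simp add: conv_def)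
      qed
      then obtain y where y: "w y \<noteq> 0" "\<rho> n (x - y) \<noteq> 0" by auto
      then have "y \<in> S" "norm (x - y) < r" using w support[of n "x - y"] by (force simp: r_def)+
      then show ?thesis unfolding C_def by (intro CollectI exI[of _ y] exI[of _ "x - y"]) auto
    qed
    then have "closure {x. conv w (\<rho> n) x \<noteq> 0} \<subseteq> C"
      by (intro closure_minimal compact_imp_closed C) auto
    moreover from this have "compact (closure {x. conv w (\<rho> n) x \<noteq> 0})"
      using C by (meson closed_closure bounded_subset compact_eq_bounded_closed)
    ultimately show ?thesis
      using \<open>C \<subseteq> \<Omega>\<close> sm by (auto simp: test_fn_def smooth_def)
  qed
  then show ?thesis unfolding eventually_sequentially by blast
qed

text \<open>Extends a weak divergence identity from smooth test functions to a continuous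
  \<open>w\<close> with integrable weak derivatives \<open>G i\<close>: mollify \<open>w\<close>,
  then shift the kernel from \<open>G i\<close> to the field \<open>F i\<close>. The limit is taken
  on the side of \<open>F i\<close>, which is bounded and essentially continuous, because nothing
  more than integrability is known of \<open>G i\<close>.\<close>

lemma weak_div_test_continuous:
  fixes F :: "2 \<Rightarrow> pt \<Rightarrow> real"
  assumes w: "continuous_on UNIV w" "compact S" "\<And>y. y \<notin> S \<Longrightarrow> w y = 0" and S: "open \<Omega>" "S \<subseteq> \<Omega>"
    and G: "\<And>i. weak_pd w i (G i)" "\<And>i y. y \<notin> S \<Longrightarrow> G i y = 0"
    and F: "\<And>i. integrable lborel (F i)" "\<And>i x. \<bar>F i x\<bar> \<le> B"
      "\<And>i. AE y in lborel. y \<in> \<Omega> \<longrightarrow> ess_cont (F i) y"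
    and D: "integrable lborel D"
    and weak: "\<And>\<phi>. test_fn \<Omega> \<phi> \<Longrightarrow> (\<Sum>i\<in>UNIV. \<integral>x. F i x * pderiv2 i \<phi> x \<partial>lborel) = - (\<integral>x. D x * \<phi> x \<partial>lborel)"
  shows "(\<Sum>i\<in>UNIV. \<integral>x. G i x * F i x \<partial>lborel) = - (\<integral>x. D x * w x \<partial>lborel)"
proof -
  obtain \<rho> where "mollifier \<rho>" by (rule ex_mollifier)
  then interpret mollifier \<rho> .
  obtain a b where ab: "S \<subseteq> cbox a b"
    using compact_imp_bounded[OF w(2)] bounded_subset_cbox_symmetric by metis
  then have w0: "w y = 0" if "y \<notin> cbox a b" for y using w that by blast
  obtain C where C: "0 \<le> C" "\<And>x. \<bar>w x\<bar> \<le> C" using bounded_cpt_obtain[OF w(1) w0] by metis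
  have ew: "ess_cont w y" for y
    using w(1) by (intro isCont_imp_ess_cont) (simp add: continuous_on_eq_continuous_at)
  have wm: "w \<in> borel_measurable borel" using w(1) borel_measurable_continuous_onI by auto
  have Fm: "F i \<in> borel_measurable borel" for i using F(1)[of i] by auto
  have iG: "integrable lborel (G i)" for i using G(1) by (simp add: weak_pd_def)
  have "(\<integral>x. F i x * pderiv2 i (conv w (\<rho> n)) x \<partial>lborel) = (\<integral>y. G i y * moll (F i) n y \<partial>lborel)" for i n
  proof -
    obtain R where "\<And>z. \<bar>\<rho> n z\<bar> \<le> R" using bounded[of n] by metis
    from Fubini_conv[OF F(1) iG borel this] show ?thesis
      using pderiv2_conv[OF w(1) w0 G(1)] by (simp add: conv_def moll_def)
  qed
  then have "eventually (\<lambda>n. (\<Sum>i\<in>UNIV. \<integral>y. G i y * moll (F i) n y \<partial>lborel) = - (\<integral>x. D x * moll w n x \<partial>lborel)) sequentially"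
  proof -
    assume eq: "\<And>i n. (\<integral>x. F i x * pderiv2 i (conv w (\<rho> n)) x \<partial>lborel) = (\<integral>y. G i y * moll (F i) n y \<partial>lborel)"
    have "eventually (\<lambda>n. test_fn \<Omega> (conv w (\<rho> n))) sequentially"
      by (rule test_fn_conv[OF w S])
    then show ?thesis
    proof (rule eventually_mono)
      fix n assume "test_fn \<Omega> (conv w (\<rho> n))"
      from weak[OF this] show "(\<Sum>i\<in>UNIV. \<integral>y. G i y * moll (F i) n y \<partial>lborel) = - (\<integral>x. D x * moll w n x \<partial>lborel)"
        by (simp only: eq) (simp only: conv_eq_moll)
    qed
  qed
  moreover have "(\<lambda>n. \<Sum>i\<in>UNIV. \<integral>y. G i y * moll (F i) n y \<partial>lborel) \<longlonglongrightarrow> (\<Sum>i\<in>UNIV. \<integral>x. G i x * F i x \<partial>lborel)"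
  proof (intro tendsto_sum integral_moll_tendsto[OF Fm F(2) iG])
    show "AE y in lborel. G i y \<noteq> 0 \<longrightarrow> ess_cont (F i) y" for i
      using F(3)[of i] by eventually_elim (use G(2) S in blast)
  qed
  moreover have "(\<lambda>n. - (\<integral>x. D x * moll w n x \<partial>lborel)) \<longlonglongrightarrow> - (\<integral>x. D x * w x \<partial>lborel)"
    using ew by (intro tendsto_minus integral_moll_tendsto[OF wm C(2) D]) auto
  ultimately show ?thesis
    by (intro LIMSEQ_unique[OF Lim_transform_eventually]) auto
qed

section \<open>Cut-offs and weak derivatives on a domain\<close>

lemma AE_lebesgue_on_iff:
  "S \<in> sets lebesgue \<Longrightarrow> (AE x in lebesgue_on S. P x) \<longleftrightarrow> (AE x in lborel. x \<in> S \<longrightarrow> P x)"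
  by (simp add: AE_restrict_space_iff AE_completion_iff)

lemma borel_measurable_lebesgue_onI: "f \<in> borel_measurable borel \<Longrightarrow> f \<in> borel_measurable (lebesgue_on S)"
  by (simp add: measurable_completion measurable_restrict_space1)

text \<open>\<open>f'\<close> is a Borel version of \<open>f\<close> on \<open>S\<close>, extended by zero. Fubini is available for such functions.\<close>

definition borel_version :: "pt set \<Rightarrow> (pt \<Rightarrow> real) \<Rightarrow> (pt \<Rightarrow> real) \<Rightarrow> bool" where
  "borel_version S f' f \<longleftrightarrow> f' \<in> borel_measurable borel \<and> f \<in> borel_measurable (lebesgue_on S) \<and>
     (\<forall>x. x \<notin> S \<longrightarrow> f' x = 0) \<and> (AE x in lborel. x \<in> S \<longrightarrow> f' x = f x)"

lemma borel_version_integral: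
  assumes S: "S \<in> sets lebesgue" and r: "borel_version S f' f"
  shows "integrable (lebesgue_on S) f \<longleftrightarrow> integrable lborel f'"
    and "integral\<^sup>L (lebesgue_on S) f = integral\<^sup>L lborel f'"
proof -
  have f': "f' \<in> borel_measurable lborel" using r by (simp add: borel_version_def)
  have m: "(\<lambda>x. indicator S x *\<^sub>R f x) \<in> borel_measurable lebesgue" 
    using r S borel_measurable_restrict_space_iff[of S lebesgue f] by (simp add: borel_version_def)
  have m': "f' \<in> borel_measurable lebesgue" using f' by (rule measurable_completion)
  have "AE x in lborel. x \<in> S \<longrightarrow> f' x = f x" using r by (simp add: borel_version_def)
  then have ae: "AE x in lebesgue. indicator S x *\<^sub>R f x = f' x"
    unfolding AE_completion_iff
    by (rule eventually_mono) (use r in \<open>auto simp: borel_version_def indicator_def\<close>)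
  show "integrable (lebesgue_on S) f \<longleftrightarrow> integrable lborel f'"
    using S integrable_cong_AE[OF m m' ae] integrable_completion[OF f']
    by (simp add: integrable_restrict_space)
  show "integral\<^sup>L (lebesgue_on S) f = integral\<^sup>L lborel f'"
    using S integral_cong_AE[OF m m' ae] integral_completion[OF f']
    by (simp add: integral_restrict_space)
qed

lemma borel_version_mult:
  assumes "borel_version S f' f" "borel_version S h' h"
  shows "borel_version S (\<lambda>x. f' x * h' x) (\<lambda>x. f x * h x)"
proof -
  have "AE x in lborel. x \<in> S \<longrightarrow> f' x = f x" "AE x in lborel. x \<in> S \<longrightarrow> h' x = h x"
    using assms by (auto simp: borel_version_def)
  then have "AE x in lborel. x \<in> S \<longrightarrow> f' x * h' x = f x * h x"
    by eventually_elim simp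
  then show ?thesis using assms by (auto simp: borel_version_def)
qed

lemma borel_version_add:
  assumes "borel_version S f' f" "borel_version S h' h"
  shows "borel_version S (\<lambda>x. f' x + h' x) (\<lambda>x. f x + h x)"
proof -
  have "AE x in lborel. x \<in> S \<longrightarrow> f' x = f x" "AE x in lborel. x \<in> S \<longrightarrow> h' x = h x"
    using assms by (auto simp: borel_version_def)
  then have "AE x in lborel. x \<in> S \<longrightarrow> f' x + h' x = f x + h x"
    by eventually_elim simp
  then show ?thesis using assms by (auto simp: borel_version_def)
qed

lemma borel_version_cong:
  assumes "borel_version S f' f" "\<And>x. x \<in> S \<Longrightarrow> f x = h x"
  shows "borel_version S f' h"
proof -
  have "h \<in> borel_measurable (lebesgue_on S) \<longleftrightarrow> f \<in> borel_measurable (lebesgue_on S)"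
    by (rule measurable_cong) (use assms in auto)
  with assms show ?thesis by (simp add: borel_version_def)
qed

lemma borel_version_borel:
  assumes "S \<in> sets borel" "h \<in> borel_measurable borel"
  shows "borel_version S (\<lambda>x. indicator S x * h x) h"
  using assms by (auto simp: borel_version_def borel_measurable_lebesgue_onI)

lemma borel_version_mult_borel:
  assumes S: "S \<in> sets borel" and f: "borel_version S f' f" and h: "h \<in> borel_measurable borel"
  shows "borel_version S (\<lambda>x. f' x * h x) (\<lambda>x. f x * h x)"
proof -
  have "borel_version S (\<lambda>x. f' x * (indicator S x * h x)) (\<lambda>x. f x * h x)"
    by (intro borel_version_mult f borel_version_borel S h)
  moreover have "(\<lambda>x. f' x * (indicator S x * h x)) = (\<lambda>x. f' x * h x)"
    using f by (force simp: borel_version_def indicator_def)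
  ultimately show ?thesis by simp
qed

lemma ex_borel_version:
  assumes S: "S \<in> sets borel" and f: "f \<in> borel_measurable (lebesgue_on S)"
  obtains f' where "borel_version S f' f"
proof -
  have "(\<lambda>x. indicator S x *\<^sub>R f x) \<in> borel_measurable lebesgue"
    using f S borel_measurable_restrict_space_iff[of S lebesgue f] by simp
  then obtain g where g: "g \<in> borel_measurable lborel" "AE x in lborel. indicator S x *\<^sub>R f x = g x"
    using completion_ex_borel_measurable_real by blast
  have "AE x in lborel. x \<in> S \<longrightarrow> indicator S x * g x = f x"
    using g(2) by eventually_elim auto
  then have "borel_version S (\<lambda>x. indicator S x * g x) f"
    using g S f by (auto simp: borel_version_def)
  then show ?thesis by (rule that)
qed

text \<open>Truncation to \<open>[-B, B]\<close> alters a Borel version only on a null set and turns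
  the almost everywhere bound into the everywhere bound that mollification asks for.\<close>

lemma ex_borel_version_bounded:
  assumes S: "S \<in> sets borel" and f: "f \<in> borel_measurable (lebesgue_on S)"
    and B: "0 \<le> B" "AE x in lebesgue_on S. \<bar>f x\<bar> \<le> B"
  obtains f' where "borel_version S f' f" "\<And>x. \<bar>f' x\<bar> \<le> B"
proof -
  obtain g where g: "borel_version S g f" using ex_borel_version[OF S f] .
  define f' where "f' x = max (- B) (min B (g x))" for x
  have "AE x in lborel. x \<in> S \<longrightarrow> \<bar>f x\<bar> \<le> B"
    using B S AE_lebesgue_on_iff[of S] by simp
  moreover have "AE x in lborel. x \<in> S \<longrightarrow> g x = f x" using g by (simp add: borel_version_def)
  ultimately have "AE x in lborel. x \<in> S \<longrightarrow> f' x = f x"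
    by eventually_elim (auto simp: f'_def)
  then have "borel_version S f' f"
    using g B f unfolding borel_version_def f'_def by auto
  moreover have "\<bar>f' x\<bar> \<le> B" for x using B(1) by (auto simp: f'_def)
  ultimately show ?thesis by (rule that)
qed

lemma pderiv2_outside_support:
  assumes "x \<notin> closure {x. \<phi> x \<noteq> 0}"
  shows "pderiv2 i \<phi> x = 0"
proof -
  have "((\<lambda>x. 0::real) has_derivative (\<lambda>h. 0)) (at x)" by simp
  then have "(\<phi> has_derivative (\<lambda>h. 0)) (at x)"
    by (rule has_derivative_transform_within_open[of _ _ _ _ "- closure {x. \<phi> x \<noteq> 0}"])
      (use assms closure_subset[of "{x. \<phi> x \<noteq> 0}"] in auto)
  from pderiv2_eqI[OF this] show ?thesis by simp
qed

lemma continuous_zero_extension: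
  fixes f h :: "pt \<Rightarrow> real"
  assumes "open \<Omega>" "compact S" "S \<subseteq> \<Omega>" "continuous_on \<Omega> f" "continuous_on UNIV h" "\<And>x. x \<notin> S \<Longrightarrow> h x = 0"
  shows "continuous_on UNIV (\<lambda>x. if x \<in> \<Omega> then f x * h x else 0)"
proof -
  let ?u = "\<lambda>x. if x \<in> \<Omega> then f x * h x else 0"
  have "continuous_on \<Omega> (\<lambda>x. f x * h x)"
    using assms continuous_on_subset by (intro continuous_intros) blast+
  then have "continuous_on \<Omega> ?u" by (rule continuous_on_eq) simp
  moreover have "continuous_on (- S) ?u"
    by (rule continuous_on_eq[where f = "\<lambda>_. 0"]) (use assms in auto)
  ultimately have "continuous_on (\<Omega> \<union> - S) ?u"
    using assms by (intro continuous_on_open_Un) (auto intro: compact_imp_closed)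
  moreover have "\<Omega> \<union> - S = UNIV" using assms by auto
  ultimately show ?thesis by simp
qed

lemma test_fn_smooth: "test_fn \<Omega> \<phi> \<Longrightarrow> smooth \<phi>"
  by (simp add: test_fn_def smooth_def)

lemma borel_version_zero_extension:
  assumes "open \<Omega>" "compact S" "S \<subseteq> \<Omega>" "continuous_on \<Omega> f" "continuous_on UNIV h" "\<And>x. x \<notin> S \<Longrightarrow> h x = 0"
  shows "borel_version \<Omega> (\<lambda>x. if x \<in> \<Omega> then f x * h x else 0) (\<lambda>x. f x * h x)"
    "integrable lborel (\<lambda>x. if x \<in> \<Omega> then f x * h x else 0)"
proof -
  let ?u = "\<lambda>x. if x \<in> \<Omega> then f x * h x else 0"
  have c: "continuous_on UNIV ?u" by (rule continuous_zero_extension[OF assms])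
  then have "?u \<in> borel_measurable borel" by (rule borel_measurable_continuous_onI)
  then have "borel_version \<Omega> (\<lambda>x. indicator \<Omega> x * ?u x) ?u"
    by (intro borel_version_borel) (use assms in auto)
  moreover have "(\<lambda>x. indicator \<Omega> x * ?u x) = ?u" by auto
  ultimately have "borel_version \<Omega> ?u ?u" by simp
  then show "borel_version \<Omega> ?u (\<lambda>x. f x * h x)" by (rule borel_version_cong) simp
  obtain a b where ab: "S \<subseteq> cbox a b"
    using compact_imp_bounded[OF assms(2)] bounded_subset_cbox_symmetric by metis
  show "integrable lborel ?u"
    by (rule integral_lborel_cbox(1)[of a b])
      (use assms ab continuous_on_subset[OF c] in \<open>auto simp: subset_iff\<close>)
qed

lemma test_fn_mult:
  assumes "test_fn \<Omega> \<eta>" "smooth \<phi>"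
  shows "test_fn \<Omega> (\<lambda>x. \<eta> x * \<phi> x)"
proof -
  have "closure {x. \<eta> x * \<phi> x \<noteq> 0} \<subseteq> closure {x. \<eta> x \<noteq> 0}"
    by (rule closure_mono) auto
  moreover from this have "compact (closure {x. \<eta> x * \<phi> x \<noteq> 0})"
    using assms(1) unfolding test_fn_def compact_eq_bounded_closed
    by (auto intro: bounded_subset)
  ultimately show ?thesis
    using assms smooth_mult[OF test_fn_smooth] by (auto simp: test_fn_def smooth_def)
qed

text \<open>The product rule for a cut-off \<open>\<eta>\<close>: testing the weak derivative of \<open>v\<close> with \<open>\<eta> \<phi>\<close>.\<close>

lemma weak_pd_cutoff:
  assumes \<Omega>: "open \<Omega>" and v: "continuous_on \<Omega> v" and g: "integrable (lebesgue_on \<Omega>) g" "weak_partial \<Omega> v i g"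
    and \<eta>: "test_fn \<Omega> \<eta>"
  obtains G where "weak_pd (\<lambda>x. if x \<in> \<Omega> then v x * \<eta> x else 0) i G"
    "borel_version \<Omega> G (\<lambda>x. \<eta> x * g x + v x * pderiv2 i \<eta> x)"
    "\<And>x. x \<notin> closure {x. \<eta> x \<noteq> 0} \<Longrightarrow> G x = 0"
proof -
  define S where "S = closure {x. \<eta> x \<noteq> 0}"
  have S: "compact S" "S \<subseteq> \<Omega>" using \<eta> by (auto simp: test_fn_def S_def)
  have \<eta>0: "\<eta> x = 0" "pderiv2 i \<eta> x = 0" if "x \<notin> S" for x i
    using that closure_subset[of "{x. \<eta> x \<noteq> 0}"] pderiv2_outside_support[of x \<eta> i] by (auto simp: S_def)
  have sm: "smooth \<eta>" by (rule test_fn_smooth[OF \<eta>])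
  note c\<eta> = smooth_continuous[OF sm] smooth_continuous[OF smooth_pderiv2[OF sm]]
  have \<Omega>b: "\<Omega> \<in> sets borel" "\<Omega> \<in> sets lebesgue" using \<Omega> by auto
  obtain g' where g': "borel_version \<Omega> g' g"
    using ex_borel_version[OF \<Omega>b(1)] g(1) borel_measurable_integrable by blast
  have ig': "integrable lborel g'" using borel_version_integral(1)[OF \<Omega>b(2) g'] g(1) by simp
  note bv = borel_version_mult_borel[OF \<Omega>b(1) g']
  define r where "r h x = (if x \<in> \<Omega> then v x * h x else 0)" for h x
  define G where "G x = g' x * \<eta> x + r (pderiv2 i \<eta>) x" for x
  obtain a b where ab: "S \<subseteq> cbox a b"
    using compact_imp_bounded[OF S(1)] bounded_subset_cbox_symmetric by metis
  have bnd: "\<exists>B. \<forall>x. g' x \<noteq> 0 \<longrightarrow> \<bar>h x\<bar> \<le> B" if "continuous_on UNIV h" "\<And>x. x \<notin> S \<Longrightarrow> h x = 0" for h :: "pt \<Rightarrow> real"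
    using bounded_cpt_obtain[OF that(1), of a b] that(2) ab by (metis subsetD)
  have i1: "integrable lborel (\<lambda>x. g' x * h x)" if h: "continuous_on UNIV h" "\<And>x. x \<notin> S \<Longrightarrow> h x = 0" for h
  proof -
    obtain B where "\<And>x. g' x \<noteq> 0 \<longrightarrow> \<bar>h x\<bar> \<le> B" using bnd[OF h] by blast
    with ig' h show ?thesis
      by (intro integrable_mult_bounded[where B = B]) (auto intro: borel_measurable_continuous_onI)
  qed
  have rr: "borel_version \<Omega> (r h) (\<lambda>x. v x * h x)" "integrable lborel (r h)"
    if "continuous_on UNIV h" "\<And>x. x \<notin> S \<Longrightarrow> h x = 0" for h
    using borel_version_zero_extension[OF \<Omega> S v that] by (simp_all add: r_def[abs_def])
  have "weak_pd (r \<eta>) i G"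
    unfolding weak_pd_def
  proof (intro conjI allI impI)
    show "integrable lborel G"
      unfolding G_def by (intro Bochner_Integration.integrable_add i1 rr c\<eta>) (use \<eta>0 in auto)
    fix \<phi> assume \<phi>: "smooth \<phi>"
    note c\<phi> = smooth_continuous[OF \<phi>] smooth_continuous[OF smooth_pderiv2[OF \<phi>]]
    \<comment> \<open>The product rule splits the derivative of \<open>?h3\<close> into
      \<open>?h1\<close>, which stays on the left of the claim, and \<open>?h2\<close>, which joins
      \<open>?h3\<close> to form the integral of \<open>G\<close> times \<phi>.\<close>
    let ?h1 = "\<lambda>x. \<eta> x * pderiv2 i \<phi> x" and ?h2 = "\<lambda>x. pderiv2 i \<eta> x * \<phi> x" and ?h3 = "\<lambda>x. \<eta> x * \<phi> x"
    have "(\<integral>x. v x * pderiv2 i ?h3 x \<partial>lebesgue_on \<Omega>) = - (\<integral>x. g x * ?h3 x \<partial>lebesgue_on \<Omega>)"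
      using g(2) test_fn_mult[OF \<eta> \<phi>] by (simp add: weak_partial_def)
    moreover have "(\<lambda>x. v x * pderiv2 i ?h3 x) = (\<lambda>x. v x * ?h1 x + v x * ?h2 x)"
      by (simp add: pderiv2_mult[OF sm \<phi>] algebra_simps)
    moreover have h1: "borel_version \<Omega> (r ?h1) (\<lambda>x. v x * ?h1 x)" "integrable lborel (r ?h1)"
      by (intro rr continuous_intros c\<eta> c\<phi>; simp add: \<eta>0)+
    moreover have h2: "borel_version \<Omega> (r ?h2) (\<lambda>x. v x * ?h2 x)" "integrable lborel (r ?h2)"
      by (intro rr continuous_intros c\<eta> c\<phi>; simp add: \<eta>0)+
    moreover have h3: "borel_version \<Omega> (\<lambda>x. g' x * ?h3 x) (\<lambda>x. g x * ?h3 x)"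
      by (intro bv borel_measurable_times smooth_borel sm \<phi>)
    ultimately have "(\<integral>x. r ?h1 x \<partial>lborel) + (\<integral>x. r ?h2 x \<partial>lborel) = - (\<integral>x. g' x * ?h3 x \<partial>lborel)"
      using borel_version_integral[OF \<Omega>b(2) h1(1)] borel_version_integral[OF \<Omega>b(2) h2(1)]
        borel_version_integral[OF \<Omega>b(2) h3] by simp
    moreover have "(\<integral>x. G x * \<phi> x \<partial>lborel) = (\<integral>x. g' x * ?h3 x \<partial>lborel) + (\<integral>x. r ?h2 x \<partial>lborel)"
    proof -
      have "(\<lambda>x. G x * \<phi> x) = (\<lambda>x. g' x * ?h3 x + r ?h2 x)"
        by (auto simp: G_def r_def algebra_simps)
      moreover have "integrable lborel (\<lambda>x. g' x * ?h3 x)"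
        by (intro i1 continuous_intros c\<eta> c\<phi>) (simp add: \<eta>0)
      ultimately show ?thesis using h2 by simp
    qed
    moreover have "(\<lambda>x. r \<eta> x * pderiv2 i \<phi> x) = r ?h1" by (auto simp: r_def)
    ultimately show "(\<integral>x. r \<eta> x * pderiv2 i \<phi> x \<partial>lborel) = - (\<integral>x. G x * \<phi> x \<partial>lborel)" by simp
  qed
  moreover have "borel_version \<Omega> G (\<lambda>x. \<eta> x * g x + v x * pderiv2 i \<eta> x)"
  proof -
    have "borel_version \<Omega> (\<lambda>x. g' x * \<eta> x + r (pderiv2 i \<eta>) x) (\<lambda>x. g x * \<eta> x + v x * pderiv2 i \<eta> x)"
      by (intro borel_version_add bv rr smooth_borel[OF sm] c\<eta>) (use \<eta>0 in auto)
    then show ?thesis by (simp add: G_def[abs_def] mult.commute)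
  qed
  moreover have "G x = 0" if "x \<notin> S" for x using that \<eta>0 by (simp add: G_def r_def)
  ultimately show ?thesis using that by (auto simp: r_def[abs_def] S_def)
qed

text \<open>The weak divergence of a field is tested with \<open>v x * \<eta> x\<close> and with its
  square. The first identity serves the flux of the unknown \<open>\<tau>\<close>, the second the
  convection term, where the field is \<open>\<beta>\<close>. The assumptions on the field (bounded,
  continuous at almost every point) cover both a continuous field and one that is polynomial on each
  triangle.\<close>

lemma weak_div_cutoff:
  fixes \<tau> :: "pt \<Rightarrow> pt"
  assumes \<Omega>: "open \<Omega>" "bounded \<Omega>" and v: "continuous_on \<Omega> v"
    and g: "\<And>i. integrable (lebesgue_on \<Omega>) (g i)" "\<And>i. weak_partial \<Omega> v i (g i)"
    and \<eta>: "test_fn \<Omega> \<eta>"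
    and \<tau>: "\<And>i. (\<lambda>x. \<tau> x $ i) \<in> borel_measurable (lebesgue_on \<Omega>)"
      "\<And>i. AE x in lebesgue_on \<Omega>. \<bar>\<tau> x $ i\<bar> \<le> B" "\<And>i. AE x in lebesgue_on \<Omega>. isCont (\<lambda>x. \<tau> x $ i) x"
    and d: "integrable (lebesgue_on \<Omega>) d" "weak_div \<Omega> \<tau> d"
  shows "(\<Sum>i\<in>UNIV. \<integral>x. (\<eta> x * g i x + v x * pderiv2 i \<eta> x) * \<tau> x $ i \<partial>lebesgue_on \<Omega>)
      = - (\<integral>x. d x * (v x * \<eta> x) \<partial>lebesgue_on \<Omega>)" (is ?linear)
    and "(\<Sum>i\<in>UNIV. \<integral>x. (2 * (v x * \<eta> x) * (\<eta> x * g i x + v x * pderiv2 i \<eta> x)) * \<tau> x $ i \<partial>lebesgue_on \<Omega>)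
      = - (\<integral>x. d x * (v x * \<eta> x)\<^sup>2 \<partial>lebesgue_on \<Omega>)" (is ?square)
proof -
  have \<Omega>b: "\<Omega> \<in> sets borel" "\<Omega> \<in> sets lebesgue" using \<Omega> by auto
  define S where "S = closure {x. \<eta> x \<noteq> 0}"
  have S: "compact S" "S \<subseteq> \<Omega>" using \<eta> by (auto simp: test_fn_def S_def)
  have \<eta>0: "\<eta> x = 0" if "x \<notin> S" for x
    using that closure_subset[of "{x. \<eta> x \<noteq> 0}"] by (auto simp: S_def)
  have sm: "smooth \<eta>" by (rule test_fn_smooth[OF \<eta>])
  note c\<eta> = smooth_continuous[OF sm]
  define u where "u x = (if x \<in> \<Omega> then v x * \<eta> x else 0)" for x
  have u: "continuous_on UNIV u" "borel_version \<Omega> u (\<lambda>x. v x * \<eta> x)" "\<And>x. x \<notin> S \<Longrightarrow> u x = 0"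
    using continuous_zero_extension[OF \<Omega>(1) S v c\<eta> \<eta>0] borel_version_zero_extension(1)[OF \<Omega>(1) S v c\<eta> \<eta>0]
      \<eta>0 by (auto simp: u_def[abs_def])
  obtain a b where ab: "S \<subseteq> cbox a b"
    using compact_imp_bounded[OF S(1)] bounded_subset_cbox_symmetric by metis
  have "\<exists>G. weak_pd u i G \<and> borel_version \<Omega> G (\<lambda>x. \<eta> x * g i x + v x * pderiv2 i \<eta> x) \<and> (\<forall>x. x \<notin> S \<longrightarrow> G x = 0)" for i
    unfolding u_def[abs_def] S_def
    by (rule weak_pd_cutoff[OF \<Omega>(1) v g(1)[of i] g(2)[of i] \<eta>]) blast
  then obtain G where G: "\<And>i. weak_pd u i (G i)"
      "\<And>i. borel_version \<Omega> (G i) (\<lambda>x. \<eta> x * g i x + v x * pderiv2 i \<eta> x)" "\<And>i x. x \<notin> S \<Longrightarrow> G i x = 0"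
    by metis
  define C where "C = max B 0"
  have "\<forall>i. \<exists>F. borel_version \<Omega> F (\<lambda>x. \<tau> x $ i) \<and> (\<forall>x. \<bar>F x\<bar> \<le> C)"
  proof
    fix i
    have "AE x in lebesgue_on \<Omega>. \<bar>\<tau> x $ i\<bar> \<le> C"
      using \<tau>(2)[of i] by eventually_elim (simp add: C_def)
    then show "\<exists>F. borel_version \<Omega> F (\<lambda>x. \<tau> x $ i) \<and> (\<forall>x. \<bar>F x\<bar> \<le> C)"
      using ex_borel_version_bounded[OF \<Omega>b(1) \<tau>(1)[of i], of C] unfolding C_def by (metis max.cobounded2)
  qed
  then obtain F where F: "\<And>i. borel_version \<Omega> (F i) (\<lambda>x. \<tau> x $ i)" "\<And>i x. \<bar>F i x\<bar> \<le> C"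
    by metis
  obtain D where D: "borel_version \<Omega> D d"
    using ex_borel_version[OF \<Omega>b(1)] d(1) borel_measurable_integrable by blast
  have iD: "integrable lborel D" using borel_version_integral(1)[OF \<Omega>b(2) D] d(1) by simp
  have iF: "integrable lborel (F i)" for i
  proof -
    have "emeasure lborel \<Omega> < \<infinity>" using \<Omega>(2) by (rule emeasure_bounded_finite)
    then have "integrable lborel (indicator \<Omega> :: pt \<Rightarrow> real)" using \<Omega>b by simp
    then have "integrable lborel (\<lambda>x. indicator \<Omega> x * F i x)"
      by (rule integrable_mult_bounded[where B = C]) (use F in \<open>auto simp: borel_version_def\<close>)
    moreover have "(\<lambda>x. indicator \<Omega> x * F i x) = F i"
      using F(1)[of i] by (force simp: borel_version_def indicator_def)
    ultimately show ?thesis by simp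
  qed
  \<comment> \<open>\<open>F i\<close> agrees with the component of \<open>\<tau>\<close> only
    almost everywhere, so continuity of \<open>\<tau>\<close> at \<open>y\<close> survives only as
    essential continuity of \<open>F i\<close>.\<close>
  have ess: "AE y in lborel. y \<in> \<Omega> \<longrightarrow> ess_cont (F i) y" for i
  proof -
    have ae: "AE x in lborel. x \<in> \<Omega> \<longrightarrow> F i x = \<tau> x $ i" using F(1) by (simp add: borel_version_def)
    moreover have "AE x in lborel. x \<in> \<Omega> \<longrightarrow> isCont (\<lambda>x. \<tau> x $ i) x"
      using \<tau>(3)[of i] \<Omega>b by (simp add: AE_lebesgue_on_iff)
    ultimately show ?thesis
    proof eventually_elim
      case (elim y)
      show ?case
        unfolding ess_cont_def
      proof (intro impI allI)
        fix e :: real assume y: "y \<in> \<Omega>" and e: "0 < e"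
        obtain r where r: "r > 0" "ball y r \<subseteq> \<Omega>" using \<Omega>(1) y open_contains_ball by blast
        obtain s where s: "s > 0" "\<And>x. norm (x - y) < s \<Longrightarrow> \<bar>\<tau> x $ i - \<tau> y $ i\<bar> < e"
          using elim y e unfolding isCont_def LIM_def
          by (metis abs_0 diff_self dist_norm real_norm_def)
        have "AE x in lborel. norm (x - y) < min r s \<longrightarrow> \<bar>F i x - F i y\<bar> \<le> e"
          using ae
        proof eventually_elim
          case (elim x)
          show ?case
          proof
            assume x: "norm (x - y) < min r s"
            then have "x \<in> \<Omega>" using r by (auto simp: dist_norm norm_minus_commute subset_iff)
            then show "\<bar>F i x - F i y\<bar> \<le> e"
              using elim x s(2)[of x] \<open>y \<in> \<Omega> \<longrightarrow> F i y = \<tau> y $ i\<close> y by simp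
          qed
        qed
        then show "\<exists>d>0. AE x in lborel. norm (x - y) < d \<longrightarrow> \<bar>F i x - F i y\<bar> \<le> e"
          using r s by (intro exI[of _ "min r s"]) simp
      qed
    qed
  qed
  have weak: "(\<Sum>i\<in>UNIV. \<integral>x. F i x * pderiv2 i \<phi> x \<partial>lborel) = - (\<integral>x. D x * \<phi> x \<partial>lborel)"
    if \<phi>: "test_fn \<Omega> \<phi>" for \<phi>
  proof -
    have sm: "smooth \<phi>" by (rule test_fn_smooth[OF \<phi>])
    note bv = borel_version_mult_borel[OF \<Omega>b(1)]
    have b1: "borel_version \<Omega> (\<lambda>x. F i x * pderiv2 i \<phi> x) (\<lambda>x. \<tau> x $ i * pderiv2 i \<phi> x)" for i
      by (intro bv F smooth_borel smooth_pderiv2 sm)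
    have b2: "borel_version \<Omega> (\<lambda>x. D x * \<phi> x) (\<lambda>x. d x * \<phi> x)"
      by (intro bv D smooth_borel sm)
    have "integrable lborel (\<lambda>x. F i x * pderiv2 i \<phi> x)" for i
    proof -
      obtain a b where ab: "closure {x. \<phi> x \<noteq> 0} \<subseteq> cbox a b"
        using \<phi> compact_imp_bounded bounded_subset_cbox_symmetric unfolding test_fn_def by metis
      have "pderiv2 i \<phi> x = 0" if "x \<notin> cbox a b" for x
        using that ab by (intro pderiv2_outside_support) blast
      then obtain P where "\<And>x. \<bar>pderiv2 i \<phi> x\<bar> \<le> P"
        using bounded_cpt_obtain[OF smooth_continuous[OF smooth_pderiv2[OF sm]]] by blast
      then show ?thesis
        by (intro integrable_mult_bounded[OF iF, where B = P]) (auto intro: smooth_borel smooth_pderiv2 sm)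
    qed
    then have i1: "integrable (lebesgue_on \<Omega>) (\<lambda>x. \<tau> x $ i * pderiv2 i \<phi> x)" for i
      using borel_version_integral(1)[OF \<Omega>b(2) b1] by simp
    have "(\<integral>x. \<tau> x \<bullet> grad2 \<phi> x \<partial>lebesgue_on \<Omega>) = (\<integral>x. (\<Sum>i\<in>UNIV. \<tau> x $ i * pderiv2 i \<phi> x) \<partial>lebesgue_on \<Omega>)"
      by (simp add: inner_vec_def grad2_def)
    also have "\<dots> = (\<Sum>i\<in>UNIV. \<integral>x. \<tau> x $ i * pderiv2 i \<phi> x \<partial>lebesgue_on \<Omega>)"
      by (rule Bochner_Integration.integral_sum) (rule i1)
    finally show ?thesis
      using d(2) \<phi> borel_version_integral(2)[OF \<Omega>b(2) b1] borel_version_integral(2)[OF \<Omega>b(2) b2]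
      by (simp add: weak_div_def)
  qed
  note main = weak_div_test_continuous[where F = F and D = D and \<Omega> = \<Omega> and S = S, OF _ S(1) _ \<Omega>(1) S(2) _ _ iF F(2) ess iD weak]
  have "(\<Sum>i\<in>UNIV. \<integral>x. G i x * F i x \<partial>lborel) = - (\<integral>x. D x * u x \<partial>lborel)"
    by (rule main) (use u G in auto)
  then show ?linear
    using borel_version_integral(2)[OF \<Omega>b(2) borel_version_mult[OF G(2) F(1)]]
      borel_version_integral(2)[OF \<Omega>b(2) borel_version_mult[OF D u(2)]] by simp
  have "weak_pd (\<lambda>x. (u x)\<^sup>2) i (\<lambda>x. 2 * u x * G i x)" for i
    by (rule weak_pd_power2[OF u(1) _ G(1), of a b]) (use ab in \<open>auto intro!: u(3) G(3)\<close>)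
  then have sq: "(\<Sum>i\<in>UNIV. \<integral>x. (2 * u x * G i x) * F i x \<partial>lborel) = - (\<integral>x. D x * (u x)\<^sup>2 \<partial>lborel)"
    by (intro main) (use u G in \<open>auto intro!: continuous_intros\<close>)
  have uu: "borel_version \<Omega> (\<lambda>x. (u x)\<^sup>2) (\<lambda>x. (v x * \<eta> x)\<^sup>2)"
    unfolding power2_eq_square by (intro borel_version_mult u)
  have "borel_version \<Omega> (\<lambda>x. indicator \<Omega> x * 2) (\<lambda>x. 2)"
    by (intro borel_version_borel \<Omega>b) simp
  from borel_version_mult[OF borel_version_mult[OF borel_version_mult[OF this u(2)] G(2)] F(1)]
  have "(\<integral>x. (2 * (v x * \<eta> x) * (\<eta> x * g i x + v x * pderiv2 i \<eta> x)) * \<tau> x $ i \<partial>lebesgue_on \<Omega>)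
     = (\<integral>x. (indicator \<Omega> x * 2 * u x * G i x) * F i x \<partial>lborel)" for i
    by (rule borel_version_integral(2)[OF \<Omega>b(2)])
  moreover have "indicator \<Omega> x * 2 * u x = 2 * u x" for x by (simp add: u_def)
  ultimately show ?square
    using sq borel_version_integral(2)[OF \<Omega>b(2) borel_version_mult[OF D uu]] by simp
qed

section \<open>Boundary strips\<close>

lemma pderiv2_prod:
  assumes "finite I" "\<And>i. i \<in> I \<Longrightarrow> smooth (f i)"
  shows "pderiv2 j (\<lambda>x. \<Prod>i\<in>I. f i x) x = (\<Sum>i\<in>I. pderiv2 j (f i) x * (\<Prod>k\<in>I - {i}. f k x))"
proof -
  have "((\<lambda>x. \<Prod>i\<in>I. f i x) has_derivative
      (\<lambda>h. \<Sum>i\<in>I. (\<Sum>j\<in>UNIV. pderiv2 j (f i) x * h $ j) * (\<Prod>k\<in>I - {i}. f k x))) (at x)"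
    by (rule has_derivative_prod) (use assms smooth_has_derivative in blast)
  from pderiv2_eqI[OF this] show ?thesis
    by (simp add: axis_def if_distrib cong: if_cong)
qed

locale polygon_sides =
  fixes \<Omega> :: "pt set" and I :: "'i set" and n :: "'i \<Rightarrow> pt" and b :: "'i \<Rightarrow> real"
  assumes finite_sides: "finite I" and Omega_eq: "\<Omega> = {x. \<forall>i\<in>I. n i \<bullet> x < b i}"
    and bounded_Omega: "bounded \<Omega>" and norm_normal: "i \<in> I \<Longrightarrow> norm (n i) = 1"
begin

text \<open>Since \<open>n i\<close> is a unit vector, this is the signed distance to the line that
  carries side \<open>i\<close>, positive on the inner side.\<close>

definition gap :: "'i \<Rightarrow> pt \<Rightarrow> real" where
  "gap i x = b i - n i \<bullet> x"

definition strip :: "real \<Rightarrow> pt set" where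
  "strip \<delta> = {x. \<exists>i\<in>I. gap i x < \<delta>}"

lemma open_Omega: "open \<Omega>"
proof -
  have "\<Omega> = (\<Inter>i\<in>I. {x. n i \<bullet> x < b i})" unfolding Omega_eq by auto
  then show ?thesis by (simp add: finite_sides open_INT open_halfspace_lt)
qed

lemma convex_Omega: "convex \<Omega>"
proof -
  have "\<Omega> = (\<Inter>i\<in>I. {x. n i \<bullet> x < b i})" unfolding Omega_eq by auto
  then show ?thesis by (auto intro: convex_INT convex_halfspace_lt)
qed

lemma compact_closure_Omega: "compact (closure \<Omega>)" and convex_closure_Omega: "convex (closure \<Omega>)"
  using bounded_Omega convex_closure[OF convex_Omega] by simp_all

lemma open_strip: "open (strip \<delta>)"
proof -
  have "strip \<delta> = (\<Union>i\<in>I. {x. gap i x < \<delta>})" unfolding strip_def by auto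
  moreover have "open {x. gap i x < \<delta>}" for i
    unfolding gap_def by (intro open_Collect_less continuous_intros)
  ultimately show ?thesis by auto
qed

lemma Omega_sets [simp]: "\<Omega> \<in> sets borel" "\<Omega> \<in> sets lebesgue"
  and strip_sets [simp]: "strip \<delta> \<in> sets borel" "strip \<delta> \<in> sets lebesgue"
  using open_Omega open_strip by auto

lemma gap_nonneg: "x \<in> closure \<Omega> \<Longrightarrow> i \<in> I \<Longrightarrow> 0 \<le> gap i x"
proof -
  assume i: "i \<in> I" and x: "x \<in> closure \<Omega>"
  have "\<Omega> \<subseteq> {x. n i \<bullet> x \<le> b i}" using i Omega_eq by force
  then have "closure \<Omega> \<subseteq> {x. n i \<bullet> x \<le> b i}"
    by (rule closure_minimal) (rule closed_halfspace_le)
  then show ?thesis using x by (auto simp: gap_def)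
qed

text \<open>\<open>K \<delta> i\<close> is the part of minus the gradient of the cut-off \<open>\<eta> \<delta>\<close> that points across side \<open>i\<close>.\<close>

lemma ex_cutoff:
  obtains \<eta> :: "real \<Rightarrow> pt \<Rightarrow> real" and K :: "real \<Rightarrow> 'i \<Rightarrow> pt \<Rightarrow> real" and M :: real
  where "0 \<le> M" "\<And>\<delta>. 0 < \<delta> \<Longrightarrow> test_fn \<Omega> (\<eta> \<delta>)"
    "\<And>\<delta> x. 0 \<le> \<eta> \<delta> x" "\<And>\<delta> x. \<eta> \<delta> x \<le> 1"
    "\<And>\<delta> x. 0 < \<delta> \<Longrightarrow> x \<notin> strip (3 * \<delta>) \<Longrightarrow> \<eta> \<delta> x = 1"
    "\<And>\<delta> j x. 0 < \<delta> \<Longrightarrow> pderiv2 j (\<eta> \<delta>) x = - (\<Sum>i\<in>I. n i $ j * K \<delta> i x)"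
    "\<And>\<delta> i. K \<delta> i \<in> borel_measurable borel" "\<And>\<delta> i x. 0 < \<delta> \<Longrightarrow> 0 \<le> K \<delta> i x"
    "\<And>\<delta> i x. 0 < \<delta> \<Longrightarrow> K \<delta> i x \<le> M / \<delta>"
    "\<And>\<delta> i x. 0 < \<delta> \<Longrightarrow> 3 * \<delta> \<le> gap i x \<Longrightarrow> K \<delta> i x = 0"
proof -
  obtain s s' :: "real \<Rightarrow> real" and M where
    ds: "\<And>t. (s has_real_derivative s' t) (at t)"
    and s: "\<And>t. 0 \<le> s t" "\<And>t. s t \<le> 1" "\<And>t. t \<le> 0 \<Longrightarrow> s t = 0" "\<And>t. 1 \<le> t \<Longrightarrow> s t = 1"
    and s': "\<And>t. 0 \<le> s' t" "\<And>t. s' t \<le> M" "\<And>t. 1 < t \<Longrightarrow> s' t = 0" "continuous_on UNIV s'"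
    and sm: "\<And>f. smooth f \<Longrightarrow> smooth (\<lambda>x. s (f x))"
    by (rule ex_smooth_step) blast
  \<comment> \<open>This is (gap - \<delta>)/\<delta>, so the step runs from gap \<delta> to gap 2
    \<delta>. The cut-off vanishes within distance \<delta> of a side line, which makes its support
    compact in \<Omega>. The width \<open>3 * \<delta>\<close> in the claims leaves slack, as
    \<open>s'\<close> is known to vanish only for arguments beyond 1.\<close>
  define a where "a \<delta> i x = (b i / \<delta> - 1) - (inverse \<delta> *\<^sub>R n i) \<bullet> x" for \<delta> i x
  have a: "a \<delta> i x = (gap i x - \<delta>) / \<delta>" if "0 < \<delta>" for \<delta> i x
    using that by (simp add: a_def gap_def field_simps)
  have sma: "smooth (a \<delta> i)" for \<delta> i
    unfolding a_def by (intro smooth_minus smooth_inner smooth_const)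
  define \<eta> where "\<eta> \<delta> x = (\<Prod>i\<in>I. s (a \<delta> i x))" for \<delta> x
  define K where "K \<delta> i x = s' (a \<delta> i x) / \<delta> * (\<Prod>k\<in>I - {i}. s (a \<delta> k x))" for \<delta> i x
  have sc: "s \<in> borel_measurable borel" "s' \<in> borel_measurable borel"
    using DERIV_continuous_on[of UNIV s] ds s' by (auto intro!: borel_measurable_continuous_onI has_field_derivative_at_within)
  show ?thesis
  proof (rule that[of M \<eta> K])
    show "0 \<le> M" using s'(1)[of 0] s'(2)[of 0] by linarith
    show "0 \<le> \<eta> \<delta> x" "\<eta> \<delta> x \<le> 1" for \<delta> x
      unfolding \<eta>_def using s by (auto intro!: prod_nonneg prod_le_1)
    fix \<delta> :: real
    have am: "a \<delta> i \<in> borel_measurable borel" for i using sma smooth_borel by blast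
    show "K \<delta> i \<in> borel_measurable borel" for i
      unfolding K_def[abs_def]
      by (intro borel_measurable_times borel_measurable_divide borel_measurable_prod borel_measurable_const
          measurable_compose[OF am sc(1)] measurable_compose[OF am sc(2)])
    assume \<delta>: "0 < \<delta>"
    show "test_fn \<Omega> (\<eta> \<delta>)"
    proof -
      define C where "C = {x. \<forall>i\<in>I. \<delta> \<le> gap i x}"
      have "C = (\<Inter>i\<in>I. {x. \<delta> \<le> gap i x})" unfolding C_def by auto
      moreover have "closed {x. \<delta> \<le> gap i x}" for i
        unfolding gap_def by (intro closed_Collect_le continuous_intros)
      ultimately have "closed C" by auto
      have "C \<subseteq> \<Omega>" using \<delta> unfolding C_def Omega_eq gap_def by force
      then have "compact C" using \<open>closed C\<close> bounded_Omega bounded_subset compact_eq_bounded_closed by blast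
      have "{x. \<eta> \<delta> x \<noteq> 0} \<subseteq> C"
      proof
        fix x assume "x \<in> {x. \<eta> \<delta> x \<noteq> 0}"
        then have "\<forall>i\<in>I. s (a \<delta> i x) \<noteq> 0" using finite_sides by (simp add: \<eta>_def)
        then have "\<forall>i\<in>I. 0 < a \<delta> i x" using s(3) not_le by blast
        then show "x \<in> C" using \<delta> by (force simp: C_def a[OF \<delta>] zero_less_divide_iff)
      qed
      then have "closure {x. \<eta> \<delta> x \<noteq> 0} \<subseteq> C" using \<open>closed C\<close> by (rule closure_minimal)
      moreover have "smooth (\<eta> \<delta>)" unfolding \<eta>_def[abs_def] by (intro smooth_prod sm sma)
      ultimately show ?thesis
        using \<open>compact C\<close> \<open>C \<subseteq> \<Omega>\<close> unfolding test_fn_def smooth_def compact_eq_bounded_closed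
        by (auto intro: bounded_subset)
    qed
    show "\<eta> \<delta> x = 1" if "x \<notin> strip (3 * \<delta>)" for x
      unfolding \<eta>_def
    proof (rule prod.neutral, rule ballI)
      fix i assume "i \<in> I"
      then have "3 * \<delta> \<le> gap i x" using that by (auto simp: strip_def)
      then show "s (a \<delta> i x) = 1" using \<delta> by (intro s) (simp add: a field_simps)
    qed
    show "pderiv2 j (\<eta> \<delta>) x = - (\<Sum>i\<in>I. n i $ j * K \<delta> i x)" for j x
    proof -
      have "pderiv2 j (\<eta> \<delta>) x = (\<Sum>i\<in>I. pderiv2 j (\<lambda>x. s (a \<delta> i x)) x * (\<Prod>k\<in>I - {i}. s (a \<delta> k x)))"
        unfolding \<eta>_def[abs_def] by (intro pderiv2_prod finite_sides sm sma)
      moreover have "pderiv2 j (\<lambda>x. s (a \<delta> i x)) x = s' (a \<delta> i x) * (- (n i $ j / \<delta>))" for i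
      proof -
        have "pderiv2 j (a \<delta> i) x = - (n i $ j / \<delta>)"
          unfolding a_def pderiv2_affine by (simp add: divide_inverse)
        then show ?thesis using pderiv2_compose_real[OF ds sma] by simp
      qed
      ultimately show ?thesis by (simp add: K_def sum_negf[symmetric] ac_simps)
    qed
    have P: "0 \<le> (\<Prod>k\<in>I - {i}. s (a \<delta> k x))" "(\<Prod>k\<in>I - {i}. s (a \<delta> k x)) \<le> 1" for i x
      using s by (auto intro!: prod_nonneg prod_le_1)
    show "0 \<le> K \<delta> i x" for i x using P s' \<delta> by (simp add: K_def)
    show "K \<delta> i x \<le> M / \<delta>" for i x
    proof -
      have "K \<delta> i x \<le> s' (a \<delta> i x) / \<delta> * 1"
        unfolding K_def using P s' \<delta> by (intro mult_left_mono) auto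
      then show ?thesis using s'(2)[of "a \<delta> i x"] \<delta> by (simp add: field_simps)
    qed
    show "K \<delta> i x = 0" if "3 * \<delta> \<le> gap i x" for i x
    proof -
      have "1 < a \<delta> i x" using that \<delta> by (simp add: a field_simps)
      then show ?thesis by (simp add: K_def s')
    qed
  qed
qed

text \<open>Shrinking \<open>K\<close> towards \<open>c\<close> by the factor \<open>1 - \<delta>/r\<close> moves it out of the strip.\<close>

lemma measure_strip:
  assumes K: "compact K" "convex K" "\<And>x i. x \<in> K \<Longrightarrow> i \<in> I \<Longrightarrow> 0 \<le> gap i x"
    and r: "ball c r \<subseteq> K" "0 < r" and \<delta>: "0 \<le> \<delta>"
  shows "measure lebesgue (K \<inter> strip \<delta>) \<le> 2 * \<delta> / r * measure lebesgue K"
proof -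
  define s where "s = \<delta> / r"
  have s0: "0 \<le> s" using \<delta> r by (simp add: s_def)
  have Km: "K \<in> lmeasurable" using K by (simp add: lmeasurable_compact)
  have KSm: "K \<inter> strip \<delta> \<in> lmeasurable" by (intro fmeasurable_Int_fmeasurable Km) simp
  show ?thesis
  proof (cases "1 < s")
    case True
    have "measure lebesgue (K \<inter> strip \<delta>) \<le> measure lebesgue K"
      by (intro measure_mono_fmeasurable Km) (use KSm in auto)
    also have "\<dots> \<le> 2 * s * measure lebesgue K" 
      using True mult_right_mono[of 1 "2 * s" "measure lebesgue K"] by simp
    finally show ?thesis by (simp add: s_def)
  next
    case False
    define K' where "K' = (\<lambda>x. (1 - s) *\<^sub>R x + s *\<^sub>R c) ` K"
    have "K' = (+) (s *\<^sub>R c) ` ((*\<^sub>R) (1 - s) ` K)" by (auto simp: K'_def add.commute)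
    then have m': "measure lebesgue K' = (1 - s)\<^sup>2 * measure lebesgue K"
      using measure_lebesgue_affine[of "1 - s" "s *\<^sub>R c" K]
      by (simp add: K'_def add.commute power2_eq_square)
    have K'm: "K' \<in> lmeasurable"
      unfolding K'_def by (intro lmeasurable_compact compact_continuous_image K continuous_intros)
    have c: "c \<in> K" using r by auto
    have gc: "r \<le> gap i c" if "i \<in> I" for i
    proof (rule field_le_epsilon)
      fix e :: real assume "0 < e"
      \<comment> \<open>The ball is open, so points at distance \<open>r\<close> from
        \<open>c\<close> are only approached; moving by \<open>t < r\<close> along the normal stays
        inside it.\<close>
      define t where "t = max 0 (r - e)"
      have "c + t *\<^sub>R n i \<in> ball c r"
        using r \<open>0 < e\<close> norm_normal[OF that] by (auto simp: dist_norm t_def)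
      then have "0 \<le> gap i (c + t *\<^sub>R n i)" using r K that by blast
      moreover have "n i \<bullet> n i = 1" using norm_normal[OF that] by (simp add: norm_eq_1)
      ultimately show "r \<le> gap i c + e" by (auto simp: gap_def inner_add_right t_def)
    qed
    have "K' \<subseteq> K" unfolding K'_def using convexD[OF K(2) _ c, of _ "1 - s" s] False s0 by auto
    moreover have "K' \<inter> strip \<delta> = {}"
    proof -
      have "\<delta> \<le> gap i ((1 - s) *\<^sub>R x + s *\<^sub>R c)" if "x \<in> K" "i \<in> I" for x i
      proof -
        have "gap i ((1 - s) *\<^sub>R x + s *\<^sub>R c) = (1 - s) * gap i x + s * gap i c"
          by (simp add: gap_def inner_add_right algebra_simps)
        moreover have "0 \<le> (1 - s) * gap i x" using K(3)[OF that] False by simp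
        moreover have "s * r \<le> s * gap i c" using gc[OF that(2)] s0 by (rule mult_left_mono)
        ultimately show ?thesis using r by (simp add: s_def)
      qed
      then show ?thesis by (fastforce simp: K'_def strip_def)
    qed
    ultimately have "measure lebesgue (K \<inter> strip \<delta>) \<le> measure lebesgue (K - K')"
      by (intro measure_mono_fmeasurable) (use Km K'm KSm in auto)
    also have "\<dots> = measure lebesgue K - measure lebesgue K'"
      using \<open>K' \<subseteq> K\<close> Km K'm by (intro measurable_measure_Diff) auto
    also have "\<dots> = (2 * s - s * s) * measure lebesgue K" by (simp add: m' power2_eq_square algebra_simps)
    also have "\<dots> \<le> 2 * s * measure lebesgue K" by (intro mult_right_mono) auto
    finally show ?thesis by (simp add: s_def)
  qed
qed

text \<open>A point of \<Omega> has positive distance from each of the finitely many sides, so the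
  cut-off is eventually 1 there. The family is left general because both the cut-off and its square
  are used.\<close>

lemma tendsto_cutoff_integral:
  fixes \<eta> :: "real \<Rightarrow> pt \<Rightarrow> real"
  assumes \<eta>: "\<And>\<delta>. 0 < \<delta> \<Longrightarrow> smooth (\<eta> \<delta>)" "\<And>\<delta> x. 0 \<le> \<eta> \<delta> x" "\<And>\<delta> x. \<eta> \<delta> x \<le> 1"
    "\<And>\<delta> x. 0 < \<delta> \<Longrightarrow> x \<notin> strip (3 * \<delta>) \<Longrightarrow> \<eta> \<delta> x = 1"
    and P: "integrable (lebesgue_on \<Omega>) P" and d: "\<And>k. 0 < d k" "d \<longlonglongrightarrow> 0"
  shows "(\<lambda>k. \<integral>x. \<eta> (d k) x * P x \<partial>lebesgue_on \<Omega>) \<longlonglongrightarrow> (\<integral>x. P x \<partial>lebesgue_on \<Omega>)"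
proof (rule integral_dominated_convergence[where w = "\<lambda>x. \<bar>P x\<bar>"])
  show "P \<in> borel_measurable (lebesgue_on \<Omega>)" using P by simp
  then show "(\<lambda>x. \<eta> (d k) x * P x) \<in> borel_measurable (lebesgue_on \<Omega>)" for k
    by (rule borel_measurable_times[OF borel_measurable_lebesgue_onI[OF smooth_borel[OF \<eta>(1)[OF d(1)]]]])
  show "integrable (lebesgue_on \<Omega>) (\<lambda>x. \<bar>P x\<bar>)" using P by simp
  show "AE x in lebesgue_on \<Omega>. norm (\<eta> (d k) x * P x) \<le> \<bar>P x\<bar>" for k
    using \<eta> by (intro AE_I2) (simp add: abs_mult mult_left_le_one_le)
  have "(\<lambda>k. \<eta> (d k) x * P x) \<longlonglongrightarrow> P x" if x: "x \<in> \<Omega>" for x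
  proof -
    have "\<forall>i\<in>I. eventually (\<lambda>k. 3 * d k < gap i x) sequentially"
    proof
      fix i assume "i \<in> I"
      then have "3 * 0 < gap i x" using x by (simp add: Omega_eq gap_def)
      then show "eventually (\<lambda>k. 3 * d k < gap i x) sequentially"
        by (intro order_tendstoD(2)[of _ "3 * 0"] tendsto_intros d)
    qed
    then have "eventually (\<lambda>k. \<forall>i\<in>I. 3 * d k < gap i x) sequentially"
      by (simp add: eventually_ball_finite finite_sides)
    then have "eventually (\<lambda>k. P x = \<eta> (d k) x * P x) sequentially"
    proof (rule eventually_mono)
      fix k assume "\<forall>i\<in>I. 3 * d k < gap i x"
      then have "x \<notin> strip (3 * d k)" by (auto simp: strip_def not_less less_imp_le)
      then show "P x = \<eta> (d k) x * P x" using \<eta>(4)[OF d(1)] by simp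
    qed
    then show ?thesis by (rule Lim_transform_eventually[OF tendsto_const])
  qed
  then show "AE x in lebesgue_on \<Omega>. (\<lambda>k. \<eta> (d k) x * P x) \<longlonglongrightarrow> P x"
    by (intro AE_I2) simp
qed

end

lemma integrable_lebesgue_on_bounded:
  fixes f :: "pt \<Rightarrow> real"
  assumes "bounded \<Omega>" "\<Omega> \<in> sets lebesgue" "f \<in> borel_measurable (lebesgue_on \<Omega>)"
    "AE x in lebesgue_on \<Omega>. \<bar>f x\<bar> \<le> B"
  shows "integrable (lebesgue_on \<Omega>) f"
proof -
  have "\<Omega> \<in> lmeasurable" using assms bounded_set_imp_lmeasurable by blast
  then have "finite_measure (lebesgue_on \<Omega>)" by (rule finite_measure_lebesgue_on)
  then show ?thesis
    by (rule finite_measure.integrable_const_bound[where B = B]) (use assms(3,4) in simp_all)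
qed

context polygon_sides
begin

text \<open>The integral is the boundary term \<open>\<integral>(\<tau> \<cdot> n) v\<close>; averages over thin boundary strips replace
  normal traces.\<close>

lemma ex_boundary_flux_bound:
  obtains M where "0 \<le> M"
    "\<And>v g \<tau> d V T B \<delta>\<^sub>0. \<lbrakk>continuous_on \<Omega> v; \<And>x. x \<in> \<Omega> \<Longrightarrow> \<bar>v x\<bar> \<le> V;
      \<And>i. integrable (lebesgue_on \<Omega>) (g i); \<And>i. weak_partial \<Omega> v i (g i);
      \<And>i. (\<lambda>x. \<tau> x $ i) \<in> borel_measurable (lebesgue_on \<Omega>);
      \<And>i. AE x in lebesgue_on \<Omega>. \<bar>\<tau> x $ i\<bar> \<le> T; \<And>i. AE x in lebesgue_on \<Omega>. isCont (\<lambda>x. \<tau> x $ i) x;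
      integrable (lebesgue_on \<Omega>) d; weak_div \<Omega> \<tau> d; 0 < \<delta>\<^sub>0;
      \<And>\<delta>. 0 < \<delta> \<Longrightarrow> \<delta> < \<delta>\<^sub>0 \<Longrightarrow>
        (\<integral>x. indicator (strip (3 * \<delta>)) x * (\<bar>v x\<bar> * norm (\<tau> x)) \<partial>lebesgue_on \<Omega>) \<le> B * \<delta>\<rbrakk> \<Longrightarrow>
      \<bar>\<integral>x. (\<Sum>i\<in>UNIV. g i x * \<tau> x $ i) + d x * v x \<partial>lebesgue_on \<Omega>\<bar> \<le> M * B"
proof -
  obtain \<eta> K M where M: "0 \<le> M" and test: "\<And>\<delta>. 0 < \<delta> \<Longrightarrow> test_fn \<Omega> (\<eta> \<delta>)"
    and \<eta>: "\<And>\<delta> x. 0 \<le> \<eta> \<delta> x" "\<And>\<delta> x. \<eta> \<delta> x \<le> 1"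
      "\<And>\<delta> x. 0 < \<delta> \<Longrightarrow> x \<notin> strip (3 * \<delta>) \<Longrightarrow> \<eta> \<delta> x = 1"
    and d\<eta>: "\<And>\<delta> j x. 0 < \<delta> \<Longrightarrow> pderiv2 j (\<eta> \<delta>) x = - (\<Sum>i\<in>I. n i $ j * K \<delta> i x)"
    and K: "\<And>\<delta> i. K \<delta> i \<in> borel_measurable borel" "\<And>\<delta> i x. 0 < \<delta> \<Longrightarrow> 0 \<le> K \<delta> i x"
      "\<And>\<delta> i x. 0 < \<delta> \<Longrightarrow> K \<delta> i x \<le> M / \<delta>"
      "\<And>\<delta> i x. 0 < \<delta> \<Longrightarrow> 3 * \<delta> \<le> gap i x \<Longrightarrow> K \<delta> i x = 0"
    by (rule ex_cutoff) blast
  show ?thesis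
  proof (rule that[of "real (card I) * M"])
    show "0 \<le> real (card I) * M" using M by simp
    fix v :: "pt \<Rightarrow> real" and g :: "2 \<Rightarrow> pt \<Rightarrow> real" and \<tau> :: "pt \<Rightarrow> pt" and d :: "pt \<Rightarrow> real"
      and V T B \<delta>\<^sub>0 :: real
    assume v: "continuous_on \<Omega> v" "\<And>x. x \<in> \<Omega> \<Longrightarrow> \<bar>v x\<bar> \<le> V"
      and g: "\<And>i. integrable (lebesgue_on \<Omega>) (g i)" "\<And>i. weak_partial \<Omega> v i (g i)"
      and \<tau>: "\<And>i. (\<lambda>x. \<tau> x $ i) \<in> borel_measurable (lebesgue_on \<Omega>)"
        "\<And>i. AE x in lebesgue_on \<Omega>. \<bar>\<tau> x $ i\<bar> \<le> T" "\<And>i. AE x in lebesgue_on \<Omega>. isCont (\<lambda>x. \<tau> x $ i) x"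
      and d: "integrable (lebesgue_on \<Omega>) d" "weak_div \<Omega> \<tau> d" and \<delta>0: "0 < \<delta>\<^sub>0"
      and B: "\<And>\<delta>. 0 < \<delta> \<Longrightarrow> \<delta> < \<delta>\<^sub>0 \<Longrightarrow>
        (\<integral>x. indicator (strip (3 * \<delta>)) x * (\<bar>v x\<bar> * norm (\<tau> x)) \<partial>lebesgue_on \<Omega>) \<le> B * \<delta>"
    have vm: "v \<in> borel_measurable (lebesgue_on \<Omega>)"
      by (rule continuous_imp_measurable_on_sets_lebesgue[OF v(1)]) simp
    have "(\<lambda>x. norm (\<tau> x)) = (\<lambda>x. sqrt (\<Sum>i\<in>UNIV. \<tau> x $ i * \<tau> x $ i))"
      by (simp add: norm_eq_sqrt_inner inner_vec_def)
    then have \<tau>m: "(\<lambda>x. norm (\<tau> x)) \<in> borel_measurable (lebesgue_on \<Omega>)"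
      using \<tau>(1) by (auto intro!: borel_measurable_sum borel_measurable_times)
    define P where "P x = (\<Sum>i\<in>UNIV. g i x * \<tau> x $ i) + d x * v x" for x
    have ig: "integrable (lebesgue_on \<Omega>) (\<lambda>x. g i x * \<tau> x $ i)" for i
      by (rule integrable_mult_bounded[OF g(1) \<tau>(1), where B = T]) (use \<tau>(2)[of i] in auto)
    have id: "integrable (lebesgue_on \<Omega>) (\<lambda>x. d x * v x)"
      by (rule integrable_mult_bounded[OF d(1) vm, where B = V]) (use v in auto)
    have iP: "integrable (lebesgue_on \<Omega>) P"
      unfolding P_def[abs_def] using ig id by auto
    \<comment> \<open>The weak identity leaves only the term in which the cut-off is differentiated.
      Its gradient is at most \<open>real (card I) * M / \<delta>\<close> on the strip, the strip
      integral is at most \<open>B * \<delta>\<close>, and \<delta> cancels.\<close>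
    have bound: "\<bar>\<integral>x. \<eta> \<delta> x * P x \<partial>lebesgue_on \<Omega>\<bar> \<le> real (card I) * M * B" if \<delta>: "0 < \<delta>" "\<delta> < \<delta>\<^sub>0" for \<delta>
    proof -
      have sm: "smooth (\<eta> \<delta>)" using test_fn_smooth[OF test[OF \<delta>(1)]] .
      have \<eta>m: "\<eta> \<delta> \<in> borel_measurable (lebesgue_on \<Omega>)" "pderiv2 i (\<eta> \<delta>) \<in> borel_measurable (lebesgue_on \<Omega>)" for i
        by (intro borel_measurable_lebesgue_onI smooth_borel sm smooth_pderiv2)+
      have i\<eta>: "integrable (lebesgue_on \<Omega>) (\<lambda>x. f x * \<eta> \<delta> x)" if "integrable (lebesgue_on \<Omega>) f" for f
        by (rule integrable_mult_bounded[OF that \<eta>m(1), where B = 1]) (use \<eta> in auto)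
      have d\<eta>_bound: "\<bar>\<Sum>j\<in>UNIV. pderiv2 j (\<eta> \<delta>) x * \<tau> x $ j\<bar> \<le> real (card I) * M / \<delta> * (indicator (strip (3 * \<delta>)) x * norm (\<tau> x))" for x
      proof -
        have "(\<Sum>j\<in>UNIV. pderiv2 j (\<eta> \<delta>) x * \<tau> x $ j) = - (\<Sum>j\<in>UNIV. \<Sum>i\<in>I. K \<delta> i x * (n i $ j * \<tau> x $ j))"
          by (simp add: d\<eta>[OF \<delta>(1)] sum_distrib_left sum_distrib_right sum_negf[symmetric] ac_simps)
        also have "\<dots> = - (\<Sum>i\<in>I. K \<delta> i x * (n i \<bullet> \<tau> x))"
          by (subst sum.swap) (simp add: sum_distrib_left inner_vec_def)
        also have "\<bar>\<dots>\<bar> \<le> (\<Sum>i\<in>I. \<bar>K \<delta> i x * (n i \<bullet> \<tau> x)\<bar>)" by simp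
        also have "\<dots> \<le> (\<Sum>i\<in>I. M / \<delta> * (indicator (strip (3 * \<delta>)) x * norm (\<tau> x)))"
        proof (rule sum_mono)
          fix i assume i: "i \<in> I"
          show "\<bar>K \<delta> i x * (n i \<bullet> \<tau> x)\<bar> \<le> M / \<delta> * (indicator (strip (3 * \<delta>)) x * norm (\<tau> x))"
          proof (cases "3 * \<delta> \<le> gap i x")
            case True
            then show ?thesis using K(4)[OF \<delta>(1)] M \<delta> by simp
          next
            case False
            then have "x \<in> strip (3 * \<delta>)" using i by (force simp: strip_def)
            moreover have "\<bar>n i \<bullet> \<tau> x\<bar> \<le> norm (\<tau> x)"
              using Cauchy_Schwarz_ineq2[of "n i" "\<tau> x"] norm_normal[OF i] by simp
            moreover from this have "K \<delta> i x * \<bar>n i \<bullet> \<tau> x\<bar> \<le> M / \<delta> * norm (\<tau> x)"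
              using K(2,3)[OF \<delta>(1), of i x] by (intro mult_mono) auto
            ultimately show ?thesis using K(2)[OF \<delta>(1), of i x] by (simp add: abs_mult)
          qed
        qed
        finally show ?thesis by simp
      qed
      define R where "R x = v x * (\<Sum>j\<in>UNIV. pderiv2 j (\<eta> \<delta>) x * \<tau> x $ j)" for x
      have iS: "integrable (lebesgue_on \<Omega>) (\<lambda>x. indicator (strip (3 * \<delta>)) x * (\<bar>v x\<bar> * norm (\<tau> x)))"
      proof (rule integrable_lebesgue_on_bounded[OF bounded_Omega])
        show "AE x in lebesgue_on \<Omega>. \<bar>indicator (strip (3 * \<delta>)) x * (\<bar>v x\<bar> * norm (\<tau> x))\<bar> \<le> V * (T + T)"
          using \<tau>(2)[of 1] \<tau>(2)[of 2] AE_space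
        proof eventually_elim
          case (elim x)
          have "norm (\<tau> x) \<le> T + T" using elim norm_le_l1_cart[of "\<tau> x"] by (simp add: sum_2)
          moreover have "\<bar>v x\<bar> \<le> V" using v(2) elim by simp
          ultimately have "\<bar>v x\<bar> * norm (\<tau> x) \<le> V * (T + T)" by (intro mult_mono) auto
          moreover from this have "0 \<le> V * (T + T)" by (meson abs_ge_zero mult_nonneg_nonneg norm_ge_zero order_trans)
          ultimately show ?case by (simp add: indicator_def abs_mult)
        qed
        show "(\<lambda>x. indicator (strip (3 * \<delta>)) x * (\<bar>v x\<bar> * norm (\<tau> x))) \<in> borel_measurable (lebesgue_on \<Omega>)"
          by (intro borel_measurable_times borel_measurable_lebesgue_onI borel_measurable_indicator
              borel_measurable_abs vm \<tau>m) simp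
      qed simp
      have R_bound: "\<bar>R x\<bar> \<le> real (card I) * M / \<delta> * (indicator (strip (3 * \<delta>)) x * (\<bar>v x\<bar> * norm (\<tau> x)))" for x
        using mult_left_mono[OF d\<eta>_bound[of x], of "\<bar>v x\<bar>"] by (simp add: R_def abs_mult ac_simps)
      have Rm: "R \<in> borel_measurable (lebesgue_on \<Omega>)"
        unfolding R_def[abs_def] by (intro borel_measurable_times borel_measurable_sum vm \<eta>m \<tau>)
      have iR: "integrable (lebesgue_on \<Omega>) R"
        by (rule Bochner_Integration.integrable_bound[OF integrable_mult_right[OF iS, of "real (card I) * M / \<delta>"] Rm])
          (intro AE_I2, simp only: real_norm_def, rule order_trans[OF R_bound abs_ge_self])
      have iRj: "integrable (lebesgue_on \<Omega>) (\<lambda>x. v x * pderiv2 i (\<eta> \<delta>) x * \<tau> x $ i)" for i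
      proof -
        obtain C where C: "0 \<le> C" "\<And>x. x \<in> \<Omega> \<Longrightarrow> \<bar>pderiv2 i (\<eta> \<delta>) x\<bar> \<le> C"
          using bounded_on_cbox_obtain[OF smooth_continuous[OF smooth_pderiv2[OF sm]]]
            bounded_subset_cbox_symmetric[OF bounded_Omega] by (metis subsetD)
        show ?thesis
        proof (rule integrable_lebesgue_on_bounded[OF bounded_Omega])
          show "AE x in lebesgue_on \<Omega>. \<bar>v x * pderiv2 i (\<eta> \<delta>) x * \<tau> x $ i\<bar> \<le> V * C * T"
            using \<tau>(2)[of i] AE_space
          proof eventually_elim
            case (elim x)
            then have "\<bar>v x\<bar> \<le> V" "\<bar>pderiv2 i (\<eta> \<delta>) x\<bar> \<le> C" using v C by auto
            moreover from this have "0 \<le> V" by linarith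
            ultimately show ?case unfolding abs_mult using elim C(1) by (intro mult_mono) auto
          qed
        qed (simp, intro borel_measurable_times vm \<eta>m \<tau>)
      qed
      have "(\<Sum>i\<in>UNIV. \<integral>x. (\<eta> \<delta> x * g i x + v x * pderiv2 i (\<eta> \<delta>) x) * \<tau> x $ i \<partial>lebesgue_on \<Omega>)
          = - (\<integral>x. d x * (v x * \<eta> \<delta> x) \<partial>lebesgue_on \<Omega>)"
        by (rule weak_div_cutoff(1)[OF open_Omega bounded_Omega v(1) g test[OF \<delta>(1)] \<tau> d])
      moreover have "(\<integral>x. (\<eta> \<delta> x * g i x + v x * pderiv2 i (\<eta> \<delta>) x) * \<tau> x $ i \<partial>lebesgue_on \<Omega>)
         = (\<integral>x. (g i x * \<tau> x $ i) * \<eta> \<delta> x \<partial>lebesgue_on \<Omega>) + (\<integral>x. v x * pderiv2 i (\<eta> \<delta>) x * \<tau> x $ i \<partial>lebesgue_on \<Omega>)" for i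
        by (subst Bochner_Integration.integral_add[symmetric, OF i\<eta>[OF ig] iRj]) (simp add: algebra_simps)
      moreover have "(\<Sum>i\<in>UNIV. \<integral>x. v x * pderiv2 i (\<eta> \<delta>) x * \<tau> x $ i \<partial>lebesgue_on \<Omega>) = (\<integral>x. R x \<partial>lebesgue_on \<Omega>)"
        by (subst Bochner_Integration.integral_sum[symmetric, OF iRj]) (simp add: R_def[abs_def] sum_distrib_left mult.assoc)
      moreover have "(\<integral>x. \<eta> \<delta> x * P x \<partial>lebesgue_on \<Omega>) =
          (\<Sum>i\<in>UNIV. \<integral>x. (g i x * \<tau> x $ i) * \<eta> \<delta> x \<partial>lebesgue_on \<Omega>) + (\<integral>x. d x * (v x * \<eta> \<delta> x) \<partial>lebesgue_on \<Omega>)"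
      proof -
        have "integrable (lebesgue_on \<Omega>) (\<lambda>x. d x * (v x * \<eta> \<delta> x))" using i\<eta>[OF id] by (simp add: mult.assoc)
        moreover have "(\<lambda>x. \<eta> \<delta> x * P x) = (\<lambda>x. (\<Sum>i\<in>UNIV. (g i x * \<tau> x $ i) * \<eta> \<delta> x) + d x * (v x * \<eta> \<delta> x))"
          by (simp add: P_def algebra_simps sum_distrib_left)
        ultimately show ?thesis using i\<eta>[OF ig] by simp
      qed
      ultimately have "(\<integral>x. \<eta> \<delta> x * P x \<partial>lebesgue_on \<Omega>) = - (\<integral>x. R x \<partial>lebesgue_on \<Omega>)"
        by (simp add: sum.distrib)
      also have "\<bar>\<dots>\<bar> \<le> (\<integral>x. \<bar>R x\<bar> \<partial>lebesgue_on \<Omega>)" using integral_abs_bound[of "lebesgue_on \<Omega>" R] by simp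
      also have "\<dots> \<le> (\<integral>x. real (card I) * M / \<delta> * (indicator (strip (3 * \<delta>)) x * (\<bar>v x\<bar> * norm (\<tau> x))) \<partial>lebesgue_on \<Omega>)"
        using iR iS R_bound by (intro integral_mono) auto
      also have "\<dots> \<le> real (card I) * M / \<delta> * (B * \<delta>)"
        using B[OF \<delta>] M \<delta> by (simp only: integral_mult_right_zero) (intro mult_left_mono, auto)
      finally show ?thesis using \<delta> by simp
    qed
    \<comment> \<open>\<open>Suc (Suc k)\<close> keeps every \<open>e k\<close> strictly below
      \<open>\<delta>\<^sub>0\<close>, as the strip hypothesis demands.\<close>
    define e where "e k = \<delta>\<^sub>0 * inverse (real (Suc (Suc k)))" for k
    have e: "0 < e k" "e k < \<delta>\<^sub>0" for k using \<delta>0 by (auto simp: e_def field_simps add_pos_nonneg)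
    have "e \<longlonglongrightarrow> \<delta>\<^sub>0 * 0"
      unfolding e_def[abs_def] by (intro tendsto_intros LIMSEQ_Suc[OF LIMSEQ_inverse_real_of_nat])
    then have "(\<lambda>k. \<integral>x. \<eta> (e k) x * P x \<partial>lebesgue_on \<Omega>) \<longlonglongrightarrow> (\<integral>x. P x \<partial>lebesgue_on \<Omega>)"
      by (intro tendsto_cutoff_integral \<eta> iP e test_fn_smooth[OF test]) auto
    then have "(\<lambda>k. \<bar>\<integral>x. \<eta> (e k) x * P x \<partial>lebesgue_on \<Omega>\<bar>) \<longlonglongrightarrow> \<bar>\<integral>x. P x \<partial>lebesgue_on \<Omega>\<bar>"
      by (rule tendsto_rabs)
    then have "\<bar>\<integral>x. P x \<partial>lebesgue_on \<Omega>\<bar> \<le> real (card I) * M * B"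
      by (rule LIMSEQ_le_const2) (use bound e in blast)
    then show "\<bar>\<integral>x. (\<Sum>i\<in>UNIV. g i x * \<tau> x $ i) + d x * v x \<partial>lebesgue_on \<Omega>\<bar> \<le> real (card I) * M * B"
      by (simp add: P_def[abs_def])
  qed
qed

text \<open>Formally the integrand is the divergence of v^2 \<beta>, and the integral equals that of
  (\<beta> . n) v^2 over the boundary. The assumption \<open>outward\<close> is the sign of this
  density, stated approximately on a strip. The gradient of the squared cut-off weighs the density
  with nonnegative weights \<open>K\<close> of order 1/\<delta>, supported on a strip of measure of
  order \<delta>, so an error e in the sign costs a multiple of e.\<close>

lemma convection_nonneg:
  assumes v: "continuous_on \<Omega> v" "\<And>x. x \<in> \<Omega> \<Longrightarrow> \<bar>v x\<bar> \<le> V"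
    and g: "\<And>i. integrable (lebesgue_on \<Omega>) (g i)" "\<And>i. weak_partial \<Omega> v i (g i)"
    and \<beta>: "\<And>i. (\<lambda>x. \<beta> x $ i) \<in> borel_measurable (lebesgue_on \<Omega>)"
      "\<And>i. AE x in lebesgue_on \<Omega>. \<bar>\<beta> x $ i\<bar> \<le> T" "\<And>i. AE x in lebesgue_on \<Omega>. isCont (\<lambda>x. \<beta> x $ i) x"
    and d: "integrable (lebesgue_on \<Omega>) d" "weak_div \<Omega> \<beta> d"
    and outward: "\<And>e. 0 < e \<Longrightarrow> \<exists>\<delta>>0. \<forall>x\<in>\<Omega>. \<forall>i\<in>I. gap i x < \<delta> \<longrightarrow> - e \<le> (n i \<bullet> \<beta> x) * (v x)\<^sup>2"
    and ne: "\<Omega> \<noteq> {}"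
  shows "0 \<le> (\<integral>x. 2 * v x * (\<Sum>i\<in>UNIV. g i x * \<beta> x $ i) + d x * (v x)\<^sup>2 \<partial>lebesgue_on \<Omega>)"
proof -
  obtain \<eta> K M where M: "0 \<le> M" and test: "\<And>\<delta>. 0 < \<delta> \<Longrightarrow> test_fn \<Omega> (\<eta> \<delta>)"
    and \<eta>: "\<And>\<delta> x. 0 \<le> \<eta> \<delta> x" "\<And>\<delta> x. \<eta> \<delta> x \<le> 1"
      "\<And>\<delta> x. 0 < \<delta> \<Longrightarrow> x \<notin> strip (3 * \<delta>) \<Longrightarrow> \<eta> \<delta> x = 1"
    and d\<eta>: "\<And>\<delta> j x. 0 < \<delta> \<Longrightarrow> pderiv2 j (\<eta> \<delta>) x = - (\<Sum>i\<in>I. n i $ j * K \<delta> i x)"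
    and K: "\<And>\<delta> i. K \<delta> i \<in> borel_measurable borel" "\<And>\<delta> i x. 0 < \<delta> \<Longrightarrow> 0 \<le> K \<delta> i x"
      "\<And>\<delta> i x. 0 < \<delta> \<Longrightarrow> K \<delta> i x \<le> M / \<delta>"
      "\<And>\<delta> i x. 0 < \<delta> \<Longrightarrow> 3 * \<delta> \<le> gap i x \<Longrightarrow> K \<delta> i x = 0"
    by (rule ex_cutoff) blast
  obtain c r where r: "ball c r \<subseteq> \<Omega>" "0 < r"
    using ne open_Omega open_contains_ball by fast
  note cl = compact_closure_Omega convex_closure_Omega
  define C where "C = 2 / r * measure lebesgue (closure \<Omega>)"
  have strip_small: "measure lebesgue (\<Omega> \<inter> strip \<delta>) \<le> C * \<delta>" if "0 < \<delta>" for \<delta>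
  proof -
    have "measure lebesgue (\<Omega> \<inter> strip \<delta>) \<le> measure lebesgue (closure \<Omega> \<inter> strip \<delta>)"
      by (intro measure_mono_fmeasurable fmeasurable_Int_fmeasurable lmeasurable_compact cl)
        (use closure_subset in auto)
    also have "\<dots> \<le> 2 * \<delta> / r * measure lebesgue (closure \<Omega>)"
      by (rule measure_strip[OF cl gap_nonneg _ r(2)]) (use that r closure_subset in auto)
    finally show ?thesis by (simp add: C_def ac_simps)
  qed
  have C: "0 \<le> C" using r by (simp add: C_def)
  have vm: "v \<in> borel_measurable (lebesgue_on \<Omega>)"
    by (rule continuous_imp_measurable_on_sets_lebesgue[OF v(1)]) simp
  have V: "0 \<le> V" using v(2) ne abs_ge_zero order_trans by blast
  define Q where "Q x = 2 * v x * (\<Sum>i\<in>UNIV. g i x * \<beta> x $ i) + d x * (v x)\<^sup>2" for x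
  have ig: "integrable (lebesgue_on \<Omega>) (\<lambda>x. g i x * (2 * v x * \<beta> x $ i))" for i
  proof (rule integrable_mult_bounded[OF g(1), where B = "2 * V * T"])
    show "AE x in lebesgue_on \<Omega>. g i x \<noteq> 0 \<longrightarrow> \<bar>2 * v x * \<beta> x $ i\<bar> \<le> 2 * V * T"
      using \<beta>(2)[of i] AE_space
    proof eventually_elim
      case (elim x)
      then have "\<bar>v x\<bar> \<le> V" using v(2) by simp
      then show ?case unfolding abs_mult using elim V by (auto intro!: mult_mono)
    qed
  qed (intro borel_measurable_times borel_measurable_const vm \<beta>)
  have id: "integrable (lebesgue_on \<Omega>) (\<lambda>x. d x * (v x)\<^sup>2)"
  proof (rule integrable_mult_bounded[OF d(1), where B = "V\<^sup>2"])
    show "AE x in lebesgue_on \<Omega>. d x \<noteq> 0 \<longrightarrow> \<bar>(v x)\<^sup>2\<bar> \<le> V\<^sup>2"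
      using v(2) V by (intro AE_I2) (simp add: abs_le_square_iff[symmetric])
  qed (use vm in measurable)
  have Q_eq: "Q = (\<lambda>x. (\<Sum>i\<in>UNIV. g i x * (2 * v x * \<beta> x $ i)) + d x * (v x)\<^sup>2)"
    by (simp add: Q_def fun_eq_iff sum_distrib_left ac_simps)
  have iQ: "integrable (lebesgue_on \<Omega>) Q"
    unfolding Q_eq using ig id by auto
  \<comment> \<open>The factor 6 is 2 from differentiating the square of the cut-off times 3 from
    the strip width \<open>3 * \<delta>\<close>.\<close>
  have lower: "- (6 * e * real (card I) * M * C) \<le> (\<integral>x. (\<eta> \<delta> x)\<^sup>2 * Q x \<partial>lebesgue_on \<Omega>)"
    if e: "0 < e" and \<delta>: "0 < \<delta>"
      and out: "\<And>x i. x \<in> \<Omega> \<Longrightarrow> i \<in> I \<Longrightarrow> gap i x < 3 * \<delta> \<Longrightarrow> - e \<le> (n i \<bullet> \<beta> x) * (v x)\<^sup>2" for e \<delta>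
  proof -
    have sm: "smooth (\<eta> \<delta>)" using test_fn_smooth[OF test[OF \<delta>]] .
    have \<eta>m: "\<eta> \<delta> \<in> borel_measurable (lebesgue_on \<Omega>)" "pderiv2 i (\<eta> \<delta>) \<in> borel_measurable (lebesgue_on \<Omega>)" for i
      by (intro borel_measurable_lebesgue_onI smooth_borel sm smooth_pderiv2)+
    have i\<eta>: "integrable (lebesgue_on \<Omega>) (\<lambda>x. f x * (\<eta> \<delta> x)\<^sup>2)" if "integrable (lebesgue_on \<Omega>) f" for f
      by (rule integrable_mult_bounded[OF that, where B = 1])
        (use \<eta> \<eta>m(1) in \<open>auto simp: power_le_one\<close>)
    define R where "R x = - (2 * (v x)\<^sup>2 * \<eta> \<delta> x * (\<Sum>j\<in>UNIV. pderiv2 j (\<eta> \<delta>) x * \<beta> x $ j))" for x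
    have R_bound: "- (2 * e * real (card I) * M / \<delta> * indicator (strip (3 * \<delta>)) x) \<le> R x" if x: "x \<in> \<Omega>" for x
    proof -
      have "(\<Sum>j\<in>UNIV. pderiv2 j (\<eta> \<delta>) x * \<beta> x $ j) = - (\<Sum>j\<in>UNIV. \<Sum>i\<in>I. K \<delta> i x * (n i $ j * \<beta> x $ j))"
        by (simp add: d\<eta>[OF \<delta>] sum_distrib_left sum_distrib_right sum_negf[symmetric] ac_simps)
      also have "\<dots> = - (\<Sum>i\<in>I. K \<delta> i x * (n i \<bullet> \<beta> x))"
        by (subst sum.swap) (simp add: sum_distrib_left inner_vec_def)
      finally have "R x = (\<Sum>i\<in>I. 2 * \<eta> \<delta> x * K \<delta> i x * ((n i \<bullet> \<beta> x) * (v x)\<^sup>2))"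
        by (simp add: R_def sum_distrib_left ac_simps)
      also have "\<dots> \<ge> (\<Sum>i\<in>I. - (2 * e * M / \<delta> * indicator (strip (3 * \<delta>)) x))"
      proof (rule sum_mono)
        fix i assume i: "i \<in> I"
        show "- (2 * e * M / \<delta> * indicator (strip (3 * \<delta>)) x) \<le> 2 * \<eta> \<delta> x * K \<delta> i x * ((n i \<bullet> \<beta> x) * (v x)\<^sup>2)"
        proof (cases "3 * \<delta> \<le> gap i x")
          case True
          then show ?thesis using K(4)[OF \<delta>] e M \<delta> by simp
        next
          case False
          then have s: "x \<in> strip (3 * \<delta>)" using i by (force simp: strip_def)
          define k where "k = 2 * \<eta> \<delta> x * K \<delta> i x"
          have "\<eta> \<delta> x * K \<delta> i x \<le> 1 * (M / \<delta>)"
            using \<eta> K(2,3)[OF \<delta>, of i x] by (intro mult_mono) auto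
          then have k: "0 \<le> k" "k \<le> 2 * (M / \<delta>)"
            using \<eta> K(2)[OF \<delta>, of i x] by (auto simp: k_def)
          have "- e \<le> (n i \<bullet> \<beta> x) * (v x)\<^sup>2" using out[OF x i] False by simp
          then have "k * (- e) \<le> k * ((n i \<bullet> \<beta> x) * (v x)\<^sup>2)" using k by (intro mult_left_mono) auto
          moreover have "k * e \<le> 2 * (M / \<delta>) * e" using k e by (intro mult_right_mono) auto
          ultimately have "- (2 * e * M / \<delta>) \<le> k * ((n i \<bullet> \<beta> x) * (v x)\<^sup>2)" by (simp add: ac_simps)
          then show ?thesis using s by (simp add: k_def)
        qed
      qed
      finally show ?thesis by (simp add: ac_simps)
    qed
    have iRj: "integrable (lebesgue_on \<Omega>) (\<lambda>x. 2 * (v x)\<^sup>2 * \<eta> \<delta> x * pderiv2 i (\<eta> \<delta>) x * \<beta> x $ i)" for i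
    proof -
      obtain D where D: "0 \<le> D" "\<And>x. x \<in> \<Omega> \<Longrightarrow> \<bar>pderiv2 i (\<eta> \<delta>) x\<bar> \<le> D"
        using bounded_on_cbox_obtain[OF smooth_continuous[OF smooth_pderiv2[OF sm]]]
          bounded_subset_cbox_symmetric[OF bounded_Omega] by (metis subsetD)
      show ?thesis
      proof (rule integrable_lebesgue_on_bounded[OF bounded_Omega])
        show "AE x in lebesgue_on \<Omega>. \<bar>2 * (v x)\<^sup>2 * \<eta> \<delta> x * pderiv2 i (\<eta> \<delta>) x * \<beta> x $ i\<bar> \<le> 2 * V\<^sup>2 * 1 * D * T"
          using \<beta>(2)[of i] AE_space
        proof eventually_elim
          case (elim x)
          then have "\<bar>v x\<bar> \<le> V" "\<bar>pderiv2 i (\<eta> \<delta>) x\<bar> \<le> D" using v D by auto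
          moreover from this have "\<bar>(v x)\<^sup>2\<bar> \<le> V\<^sup>2" using V by (simp add: abs_le_square_iff[symmetric])
          ultimately show ?case unfolding abs_mult using elim D(1) \<eta>(1,2)[of \<delta> x]
            by (intro mult_mono) auto
        qed
      qed (simp, intro borel_measurable_times borel_measurable_power borel_measurable_const vm \<eta>m \<beta>)
    qed
    have R_eq: "R = (\<lambda>x. - (\<Sum>i\<in>UNIV. 2 * (v x)\<^sup>2 * \<eta> \<delta> x * pderiv2 i (\<eta> \<delta>) x * \<beta> x $ i))"
      by (simp add: R_def fun_eq_iff sum_distrib_left mult.assoc)
    have iR: "integrable (lebesgue_on \<Omega>) R"
      unfolding R_eq using iRj by auto
    define q where "q = 2 * e * real (card I) * M / \<delta>"
    have q: "0 \<le> q" using e M \<delta> by (simp add: q_def)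
    have iq: "integrable (lebesgue_on \<Omega>) (\<lambda>x. - (q * indicator (strip (3 * \<delta>)) x))"
    proof (rule integrable_lebesgue_on_bounded[OF bounded_Omega, where B = q])
      show "(\<lambda>x. - (q * indicator (strip (3 * \<delta>)) x)) \<in> borel_measurable (lebesgue_on \<Omega>)"
        by (intro borel_measurable_lebesgue_onI borel_measurable_uminus borel_measurable_times
            borel_measurable_const borel_measurable_indicator strip_sets)
      show "AE x in lebesgue_on \<Omega>. \<bar>- (q * indicator (strip (3 * \<delta>)) x)\<bar> \<le> q"
        by (intro AE_I2) (use q in \<open>simp add: indicator_def abs_mult\<close>)
    qed simp
    have "(\<Sum>i\<in>UNIV. \<integral>x. (2 * (v x * \<eta> \<delta> x) * (\<eta> \<delta> x * g i x + v x * pderiv2 i (\<eta> \<delta>) x)) * \<beta> x $ i \<partial>lebesgue_on \<Omega>)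
        = - (\<integral>x. d x * (v x * \<eta> \<delta> x)\<^sup>2 \<partial>lebesgue_on \<Omega>)"
      by (rule weak_div_cutoff(2)[OF open_Omega bounded_Omega v(1) g test[OF \<delta>] \<beta> d])
    moreover have "(\<integral>x. (2 * (v x * \<eta> \<delta> x) * (\<eta> \<delta> x * g i x + v x * pderiv2 i (\<eta> \<delta>) x)) * \<beta> x $ i \<partial>lebesgue_on \<Omega>)
       = (\<integral>x. (g i x * (2 * v x * \<beta> x $ i)) * (\<eta> \<delta> x)\<^sup>2 \<partial>lebesgue_on \<Omega>)
         + (\<integral>x. 2 * (v x)\<^sup>2 * \<eta> \<delta> x * pderiv2 i (\<eta> \<delta>) x * \<beta> x $ i \<partial>lebesgue_on \<Omega>)" for i
      by (subst Bochner_Integration.integral_add[symmetric, OF i\<eta>[OF ig] iRj])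
        (simp add: algebra_simps power2_eq_square)
    moreover have "(\<integral>x. R x \<partial>lebesgue_on \<Omega>) =
        - (\<Sum>i\<in>UNIV. \<integral>x. 2 * (v x)\<^sup>2 * \<eta> \<delta> x * pderiv2 i (\<eta> \<delta>) x * \<beta> x $ i \<partial>lebesgue_on \<Omega>)"
      unfolding R_eq using iRj by simp
    moreover have "(\<integral>x. (\<eta> \<delta> x)\<^sup>2 * Q x \<partial>lebesgue_on \<Omega>) =
        (\<Sum>i\<in>UNIV. \<integral>x. (g i x * (2 * v x * \<beta> x $ i)) * (\<eta> \<delta> x)\<^sup>2 \<partial>lebesgue_on \<Omega>) + (\<integral>x. d x * (v x * \<eta> \<delta> x)\<^sup>2 \<partial>lebesgue_on \<Omega>)"
    proof -
      have "(\<lambda>x. (\<eta> \<delta> x)\<^sup>2 * Q x) = (\<lambda>x. (\<Sum>i\<in>UNIV. (g i x * (2 * v x * \<beta> x $ i)) * (\<eta> \<delta> x)\<^sup>2) + (d x * (v x)\<^sup>2) * (\<eta> \<delta> x)\<^sup>2)"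
        by (simp add: Q_eq distrib_left sum_distrib_left ac_simps)
      moreover have "(\<lambda>x. d x * (v x * \<eta> \<delta> x)\<^sup>2) = (\<lambda>x. (d x * (v x)\<^sup>2) * (\<eta> \<delta> x)\<^sup>2)"
        by (simp add: power_mult_distrib mult.assoc)
      ultimately show ?thesis using i\<eta>[OF ig] i\<eta>[OF id] by simp
    qed
    ultimately have "(\<integral>x. (\<eta> \<delta> x)\<^sup>2 * Q x \<partial>lebesgue_on \<Omega>) = (\<integral>x. R x \<partial>lebesgue_on \<Omega>)"
      by (simp add: sum.distrib)
    moreover have "(\<integral>x. - (q * indicator (strip (3 * \<delta>)) x) \<partial>lebesgue_on \<Omega>) \<le> (\<integral>x. R x \<partial>lebesgue_on \<Omega>)"
      using R_bound by (intro integral_mono[OF iq iR]) (simp add: q_def)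
    moreover have "(\<integral>x. - (q * indicator (strip (3 * \<delta>)) x) \<partial>lebesgue_on \<Omega>)
      = - (q * measure lebesgue (\<Omega> \<inter> strip (3 * \<delta>)))"
      by (simp add: measure_restrict_space Int_commute)
    moreover have "q * measure lebesgue (\<Omega> \<inter> strip (3 * \<delta>)) \<le> q * (C * (3 * \<delta>))"
      by (intro mult_left_mono strip_small q) (use \<delta> in auto)
    moreover have "q * (C * (3 * \<delta>)) = 6 * e * real (card I) * M * C"
      using \<delta> by (simp add: q_def)
    ultimately show ?thesis by linarith
  qed
  have "- (6 * e * real (card I) * M * C) \<le> (\<integral>x. Q x \<partial>lebesgue_on \<Omega>)" if e: "0 < e" for e
  proof -
    obtain \<delta>0 where \<delta>0: "0 < \<delta>0" "\<And>x i. x \<in> \<Omega> \<Longrightarrow> i \<in> I \<Longrightarrow> gap i x < \<delta>0 \<Longrightarrow> - e \<le> (n i \<bullet> \<beta> x) * (v x)\<^sup>2"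
      using outward[OF e] by blast
    define s where "s k = \<delta>0 / 3 * inverse (real (Suc k))" for k
    have s: "0 < s k" "3 * s k \<le> \<delta>0" for k using \<delta>0(1) by (auto simp: s_def field_simps)
    have "s \<longlonglongrightarrow> \<delta>0 / 3 * 0"
      unfolding s_def[abs_def] by (intro tendsto_intros LIMSEQ_inverse_real_of_nat)
    then have "(\<lambda>k. \<integral>x. (\<eta> (s k) x)\<^sup>2 * Q x \<partial>lebesgue_on \<Omega>) \<longlonglongrightarrow> (\<integral>x. Q x \<partial>lebesgue_on \<Omega>)"
      using \<eta> test_fn_smooth[OF test]
      by (intro tendsto_cutoff_integral[of "\<lambda>\<delta> x. (\<eta> \<delta> x)\<^sup>2"] iQ s)
        (auto simp: power_le_one power2_eq_square mult_le_one intro: smooth_mult)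
    moreover have "- (6 * e * real (card I) * M * C) \<le> (\<integral>x. (\<eta> (s k) x)\<^sup>2 * Q x \<partial>lebesgue_on \<Omega>)" for k
      using s[of k] by (intro lower e \<delta>0(2)) auto
    ultimately show ?thesis by (intro LIMSEQ_le_const) auto
  qed
  then have lim: "- (6 * e * real (card I) * M * C) \<le> (\<integral>x. Q x \<partial>lebesgue_on \<Omega>)" if "0 < e" for e
    using that by blast
  have "0 \<le> (\<integral>x. Q x \<partial>lebesgue_on \<Omega>)"
  proof (rule field_le_epsilon)
    fix e :: real assume "0 < e"
    define q where "q = 6 * real (card I) * M * C"
    have q: "0 \<le> q" using M C by (simp add: q_def)
    then have "0 < e / (q + 1)" using \<open>0 < e\<close> by simp
    from lim[OF this] have "- (e * (q / (q + 1))) \<le> (\<integral>x. Q x \<partial>lebesgue_on \<Omega>)"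
      by (simp add: q_def ac_simps)
    moreover have "e * (q / (q + 1)) \<le> e * 1" using q \<open>0 < e\<close> by (intro mult_left_mono) auto
    ultimately show "0 \<le> (\<integral>x. Q x \<partial>lebesgue_on \<Omega>) + e" by simp
  qed
  then show ?thesis by (simp add: Q_def[abs_def])
qed

end

section \<open>An inverse inequality for polynomials\<close>

text \<open>Extrapolation works along lines, so a degree bound on each line is all it needs. The
  type is general because the inverse inequality is applied in the plane (triangles) and on the real
  line (edges).\<close>

definition line_poly :: "nat \<Rightarrow> ('a::real_vector \<Rightarrow> real) \<Rightarrow> bool" where
  "line_poly m q \<longleftrightarrow> (\<forall>x y. \<exists>P::real poly. degree P \<le> m \<and> (\<forall>t. q (x + t *\<^sub>R y) = poly P t))"

lemma line_poly_const: "line_poly m (\<lambda>x. a)"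
  unfolding line_poly_def by (intro allI exI[of _ "[:a:]"]) simp

lemma line_poly_le: "line_poly m q \<Longrightarrow> m \<le> m' \<Longrightarrow> line_poly m' q"
  unfolding line_poly_def by (meson order_trans)

lemma line_poly_add:
  assumes "line_poly m p" "line_poly m q"
  shows "line_poly m (\<lambda>x. p x + q x)"
  unfolding line_poly_def
proof (intro allI)
  fix x y
  obtain P Q where "degree P \<le> m" "\<forall>t. p (x + t *\<^sub>R y) = poly P t"
      "degree Q \<le> m" "\<forall>t. q (x + t *\<^sub>R y) = poly Q t"
    using assms unfolding line_poly_def by blast
  then show "\<exists>P. degree P \<le> m \<and> (\<forall>t. p (x + t *\<^sub>R y) + q (x + t *\<^sub>R y) = poly P t)"
    by (intro exI[of _ "P + Q"]) (simp add: degree_add_le)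
qed

lemma line_poly_mult:
  assumes "line_poly m p" "line_poly m' q"
  shows "line_poly (m + m') (\<lambda>x. p x * q x)"
  unfolding line_poly_def
proof (intro allI)
  fix x y
  obtain P Q where "degree P \<le> m" "\<forall>t. p (x + t *\<^sub>R y) = poly P t"
      "degree Q \<le> m'" "\<forall>t. q (x + t *\<^sub>R y) = poly Q t"
    using assms unfolding line_poly_def by blast
  then show "\<exists>P. degree P \<le> m + m' \<and> (\<forall>t. p (x + t *\<^sub>R y) * q (x + t *\<^sub>R y) = poly P t)"
    by (intro exI[of _ "P * Q"]) (simp add: order_trans[OF degree_mult_le] add_mono)
qed

lemma line_poly_power:
  assumes "line_poly m p"
  shows "line_poly (j * m) (\<lambda>x. p x ^ j)"
proof (induction j)
  case (Suc j)
  show ?case using line_poly_mult[OF assms Suc] by simp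
qed (simp add: line_poly_const)

lemma line_poly_sum:
  "(\<And>i. i \<in> I \<Longrightarrow> line_poly m (f i)) \<Longrightarrow> line_poly m (\<lambda>x. \<Sum>i\<in>I. f i x)"
  by (induction I rule: infinite_finite_induct) (auto intro: line_poly_const line_poly_add)

lemma line_poly_component: "line_poly 1 (\<lambda>x::pt. x $ i)"
  unfolding line_poly_def
  by (intro allI, rule_tac x = "[:x $ i, y $ i:]" in exI) simp

lemma line_poly_compose_line:
  assumes "line_poly m q"
  shows "line_poly m (\<lambda>t::real. q (a + t *\<^sub>R w))"
  unfolding line_poly_def
proof (intro allI)
  fix x y :: real
  obtain P where "degree P \<le> m" "\<forall>t. q ((a + x *\<^sub>R w) + t *\<^sub>R (y *\<^sub>R w)) = poly P t"
    using assms unfolding line_poly_def by blast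
  then show "\<exists>P. degree P \<le> m \<and> (\<forall>t. q (a + (x + t *\<^sub>R y) *\<^sub>R w) = poly P t)"
    by (intro exI[of _ P]) (simp add: scaleR_add_left add.assoc)
qed

lemma poly2_line_poly:
  assumes "poly2 k p"
  shows "line_poly k p"
proof -
  obtain a where a: "\<And>x. p x = (\<Sum>(i, j)\<in>{(i, j). i + j \<le> k}. a i j * (x $ 1) ^ i * (x $ 2) ^ j)"
    using assms unfolding poly2_def by blast
  have "line_poly k (\<lambda>x::pt. \<Sum>z\<in>{(i, j). i + j \<le> k}. a (fst z) (snd z) * (x $ 1) ^ fst z * (x $ 2) ^ snd z)"
  proof (rule line_poly_sum)
    fix z :: "nat \<times> nat" assume z: "z \<in> {(i, j). i + j \<le> k}"
    have "line_poly (0 + fst z * 1 + snd z * 1) (\<lambda>x::pt. a (fst z) (snd z) * (x $ 1) ^ fst z * (x $ 2) ^ snd z)"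
      by (intro line_poly_mult line_poly_const line_poly_power line_poly_component)
    then show "line_poly k (\<lambda>x::pt. a (fst z) (snd z) * (x $ 1) ^ fst z * (x $ 2) ^ snd z)"
      by (rule line_poly_le) (use z in auto)
  qed
  moreover have "p = (\<lambda>x. \<Sum>z\<in>{(i, j). i + j \<le> k}. a (fst z) (snd z) * (x $ 1) ^ fst z * (x $ 2) ^ snd z)"
    by (simp add: fun_eq_iff a split_beta)
  ultimately show ?thesis by simp
qed

lemma poly2_continuous:
  assumes "poly2 k p"
  shows "continuous_on S p"
proof -
  obtain a where a: "\<And>x. p x = (\<Sum>(i, j)\<in>{(i, j). i + j \<le> k}. a i j * (x $ 1) ^ i * (x $ 2) ^ j)"
    using assms unfolding poly2_def by blast
  then have "p = (\<lambda>x. \<Sum>z\<in>{(i, j). i + j \<le> k}. a (fst z) (snd z) * (x $ 1) ^ fst z * (x $ 2) ^ snd z)"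
    by (simp add: fun_eq_iff a split_beta)
  then show ?thesis by (simp only:) (intro continuous_intros)
qed

text \<open>Translation preserves the degree and the leading coefficient, so the top terms
  cancel.\<close>

lemma degree_forward_difference:
  fixes P :: "real poly"
  assumes "degree P \<le> Suc m"
  shows "degree (P - pcompose P [:1, 1:]) \<le> m"
proof (rule degree_le, intro allI impI)
  fix i assume i: "m < i"
  let ?Q = "pcompose P [:1, 1:]"
  have dQ: "degree ?Q = degree P" by (simp add: degree_pcompose)
  have lc: "coeff ?Q (degree P) = coeff P (degree P)"
    using lead_coeff_comp[of "[:1, 1:]" P] by (simp add: dQ)
  show "coeff (P - ?Q) i = 0"
  proof (cases "i = degree P")
    case False
    then have "degree P < i" using i assms by linarith
    then show ?thesis by (simp add: coeff_eq_0 dQ)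
  qed (simp add: lc)
qed

text \<open>Vanishing of the finite differences of order \<open>m + 1\<close>.\<close>

lemma ex_extrapolation_weights:
  "\<exists>c :: nat \<Rightarrow> real. \<forall>P. degree P \<le> m \<longrightarrow> poly P 0 = (\<Sum>j=1..Suc m. c j * poly P (real j))"
proof (induction m)
  case 0
  have "poly P 0 = poly P 1" if "degree P \<le> 0" for P :: "real poly"
  proof -
    have "degree P = 0" using that by simp
    then obtain a where "P = [:a:]" by (rule degree_eq_zeroE)
    then show ?thesis by simp
  qed
  then show ?case by (intro exI[of _ "\<lambda>_. 1"]) simp
next
  case (Suc m)
  then obtain c :: "nat \<Rightarrow> real" where
    c: "\<And>P. degree P \<le> m \<Longrightarrow> poly P 0 = (\<Sum>j=1..Suc m. c j * poly P (real j))" by blast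
  \<comment> \<open>P(0) = P(1) + (P - P(1 + .))(0), and the induction hypothesis applies to the
    difference. This puts the weight c_j on P(j) and -c_j on P(j + 1), the latter re-indexed to
    -c_(j-1) on P(j).\<close>
  define c' where "c' j = (if j = 1 then 1 else 0) + (if j \<le> Suc m then c j else 0)
      - (if 2 \<le> j then c (j - 1) else 0)" for j
  have "poly P 0 = (\<Sum>j=1..Suc (Suc m). c' j * poly P (real j))" if P: "degree P \<le> Suc m" for P
  proof -
    have "poly P 0 = poly P 1 + poly (P - pcompose P [:1, 1:]) 0"
      by (simp add: poly_pcompose)
    also have "poly (P - pcompose P [:1, 1:]) 0 = (\<Sum>j=1..Suc m. c j * poly (P - pcompose P [:1, 1:]) (real j))"
      by (rule c[OF degree_forward_difference[OF P]])
    also have "\<dots> = (\<Sum>j=1..Suc m. c j * poly P (real j)) - (\<Sum>j=1..Suc m. c j * poly P (real (Suc j)))"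
      by (simp only: poly_diff poly_pcompose right_diff_distrib sum_subtractf) (simp add: add.commute)
    also have "(\<Sum>j=1..Suc m. c j * poly P (real (Suc j))) = (\<Sum>j=2..Suc (Suc m). c (j - 1) * poly P (real j))"
      by (rule sum.reindex_bij_witness[of _ "\<lambda>j. j - 1" Suc]) auto
    also have "\<dots> = (\<Sum>j=1..Suc (Suc m). (if 2 \<le> j then c (j - 1) else 0) * poly P (real j))"
      by (rule sum.mono_neutral_cong_left) auto
    also have "(\<Sum>j=1..Suc m. c j * poly P (real j)) = (\<Sum>j=1..Suc (Suc m). (if j \<le> Suc m then c j else 0) * poly P (real j))"
      by (rule sum.mono_neutral_cong_left) auto
    also have "poly P 1 = (\<Sum>j=1..Suc (Suc m). (if j = 1 then 1 else 0) * poly P (real j))"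
      by (simp only: if_distrib[of "\<lambda>z. z * poly P _"] mult_1 mult_zero_left sum.delta finite_atLeastAtMost)
        simp
    finally show ?thesis
      by (simp only: c'_def left_diff_distrib distrib_right sum.distrib sum_subtractf)
  qed
  then show ?case by blast
qed

text \<open>The contraction by \<open>s\<close> about a point of the convex set \<open>K\<close>
  maps \<open>K\<close> into itself and scales volume by the power \<open>s ^ DIM('a)\<close>; a
  nonnegative integrand loses by restriction to the image.\<close>

lemma integral_contraction_le:
  fixes f :: "'a::euclidean_space \<Rightarrow> real"
  assumes K: "compact K" "convex K" "x0 \<in> K" and f: "continuous_on UNIV f" "\<And>x. 0 \<le> f x"
    and s: "0 < s" "s \<le> 1"
  shows "s ^ DIM('a) * (\<integral>y. indicator K y * f (x0 + s *\<^sub>R (y - x0)) \<partial>lborel) \<le> (\<integral>y. indicator K y * f y \<partial>lborel)"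
proof -
  have Kb: "K \<in> sets borel" using K by (simp add: borel_compact)
  define g where "g y = indicator K y * f y" for y
  define t where "t = (1 - s) *\<^sub>R x0"
  have t: "t + s *\<^sub>R y = x0 + s *\<^sub>R (y - x0)" for y by (simp add: t_def algebra_simps)
  have ig: "integrable lborel g"
    using borel_integrable_compact[OF K(1) continuous_on_subset[OF f(1)]] by (simp add: g_def[abs_def])
  then have gm: "g \<in> borel_measurable borel" by simp
  have affine: "(lborel :: 'a measure) = density (distr lborel borel (\<lambda>x. t + s *\<^sub>R x)) (\<lambda>_. \<bar>s\<bar> ^ DIM('a))"
    using s by (intro lborel_affine) simp
  have eq: "integral\<^sup>L lborel g = s ^ DIM('a) * (\<integral>y. g (t + s *\<^sub>R y) \<partial>lborel)"
  proof -
    have "integral\<^sup>L lborel g = integral\<^sup>L (density (distr lborel borel (\<lambda>x. t + s *\<^sub>R x)) (\<lambda>_. ennreal (s ^ DIM('a)))) g"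
      using affine s by (simp add: abs_of_pos ennreal_power)
    also have "\<dots> = s ^ DIM('a) * (\<integral>y. g (t + s *\<^sub>R y) \<partial>lborel)"
      using gm s by (subst integral_density) (auto simp: integral_distr)
    finally show ?thesis .
  qed
  have ig': "integrable lborel (\<lambda>y. g (t + s *\<^sub>R y))"
  proof -
    have "integrable (density (distr lborel borel (\<lambda>x. t + s *\<^sub>R x)) (\<lambda>_. ennreal (s ^ DIM('a)))) g"
      using affine ig s by (simp add: abs_of_pos ennreal_power)
    then have "integrable (distr lborel borel (\<lambda>x. t + s *\<^sub>R x)) (\<lambda>x. s ^ DIM('a) * g x)"
      using gm s by (subst (asm) integrable_density) auto
    then have "integrable lborel (\<lambda>y. s ^ DIM('a) * g (t + s *\<^sub>R y))"
      using gm by (subst (asm) integrable_distr_eq) auto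
    then show ?thesis using s by (subst (asm) integrable_mult_left_iff) auto
  qed
  have "(\<integral>y. indicator K y * f (x0 + s *\<^sub>R (y - x0)) \<partial>lborel) \<le> (\<integral>y. g (t + s *\<^sub>R y) \<partial>lborel)"
  proof (rule integral_mono[OF _ ig'])
    have "continuous_on K (\<lambda>y. f (x0 + s *\<^sub>R (y - x0)))"
      by (intro continuous_on_compose2[OF f(1)] continuous_intros) auto
    from borel_integrable_compact[OF K(1) this]
    show "integrable lborel (\<lambda>y. indicator K y * f (x0 + s *\<^sub>R (y - x0)))" by simp
    fix y
    have "x0 + s *\<^sub>R (y - x0) \<in> K" if "y \<in> K"
      using convexD[OF K(2) K(3) that, of "1 - s" s] s by (simp add: algebra_simps)
    then show "indicator K y * f (x0 + s *\<^sub>R (y - x0)) \<le> g (t + s *\<^sub>R y)"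
      using f(2) by (auto simp: g_def t indicator_def)
  qed
  then have "s ^ DIM('a) * (\<integral>y. indicator K y * f (x0 + s *\<^sub>R (y - x0)) \<partial>lborel) \<le> s ^ DIM('a) * (\<integral>y. g (t + s *\<^sub>R y) \<partial>lborel)"
    using s by (intro mult_left_mono) auto
  then show ?thesis using eq by (simp add: g_def[abs_def])
qed

text \<open>Extrapolating from the points \<open>x0 + (j / (m + 1)) (y - x0)\<close> to \<open>x0\<close> and averaging over \<open>y \<in> K\<close>
  gives a constant that depends on neither the size nor the shape of \<open>K\<close>.\<close>

lemma ex_inverse_inequality:
  obtains C :: real where "0 \<le> C"
    "\<And>(q :: 'a::euclidean_space \<Rightarrow> real) (K :: 'a set) (x0 :: 'a). \<lbrakk>line_poly m q; continuous_on UNIV q; compact K; convex K; x0 \<in> K\<rbrakk>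
      \<Longrightarrow> measure lborel K * \<bar>q x0\<bar> \<le> C * (\<integral>y. indicator K y * \<bar>q y\<bar> \<partial>lborel)"
proof -
  obtain c :: "nat \<Rightarrow> real" where
    c: "\<And>P. degree P \<le> m \<Longrightarrow> poly P 0 = (\<Sum>j=1..Suc m. c j * poly P (real j))"
    using ex_extrapolation_weights by blast
  \<comment> \<open>Division by \<open>Suc m\<close> keeps every sample point on the segment from
    \<open>x0\<close> to \<open>y\<close>, hence in \<open>K\<close>.\<close>
  define s where "s j = real j / real (Suc m)" for j
  define C where "C = (\<Sum>j=1..Suc m. \<bar>c j\<bar> / s j ^ DIM('a))"
  have s: "0 < s j" "s j \<le> 1" if "j \<in> {1..Suc m}" for j using that by (auto simp: s_def)
  show ?thesis
  proof (rule that[of C])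
    show "0 \<le> C" unfolding C_def using s by (intro sum_nonneg) (auto simp: less_imp_le)
    fix q :: "'a \<Rightarrow> real" and K :: "'a set" and x0 :: 'a
    assume q: "line_poly m q" "continuous_on UNIV q" and K: "compact K" "convex K" "x0 \<in> K"
    have pt: "\<bar>q x0\<bar> \<le> (\<Sum>j=1..Suc m. \<bar>c j\<bar> * \<bar>q (x0 + s j *\<^sub>R (y - x0))\<bar>)" for y
    proof -
      obtain P where P: "degree P \<le> m" "\<And>t. q (x0 + t *\<^sub>R (inverse (real (Suc m)) *\<^sub>R (y - x0))) = poly P t"
        using q(1) unfolding line_poly_def by blast
      have "q x0 = poly P 0" using P(2)[of 0] by simp
      also have "\<dots> = (\<Sum>j=1..Suc m. c j * poly P (real j))" by (rule c[OF P(1)])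
      also have "\<dots> = (\<Sum>j=1..Suc m. c j * q (x0 + s j *\<^sub>R (y - x0)))"
        by (rule sum.cong) (simp_all only: P(2)[symmetric] s_def divide_inverse scaleR_scaleR)
      finally show ?thesis by (simp only: abs_mult[symmetric] sum_abs)
    qed
    have i: "integrable lborel (\<lambda>y. indicator K y * f y)" if "continuous_on UNIV f" for f :: "'a \<Rightarrow> real"
      using borel_integrable_compact[OF K(1) continuous_on_subset[OF that]] by simp
    have cont: "continuous_on UNIV (\<lambda>y. \<bar>q (x0 + s j *\<^sub>R (y - x0))\<bar>)" for j
      by (intro continuous_intros continuous_on_compose2[OF q(2)]) auto
    have "measure lborel K * \<bar>q x0\<bar> = (\<integral>y. indicator K y * \<bar>q x0\<bar> \<partial>lborel)" by simp
    also have "\<dots> \<le> (\<integral>y. (\<Sum>j=1..Suc m. \<bar>c j\<bar> * (indicator K y * \<bar>q (x0 + s j *\<^sub>R (y - x0))\<bar>)) \<partial>lborel)"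
    proof (rule integral_mono)
      show "integrable lborel (\<lambda>y. indicator K y * \<bar>q x0\<bar>)" by (intro i continuous_intros)
      show "integrable lborel (\<lambda>y. \<Sum>j=1..Suc m. \<bar>c j\<bar> * (indicator K y * \<bar>q (x0 + s j *\<^sub>R (y - x0))\<bar>))"
        by (intro Bochner_Integration.integrable_sum integrable_mult_right i cont)
      show "indicator K y * \<bar>q x0\<bar> \<le> (\<Sum>j=1..Suc m. \<bar>c j\<bar> * (indicator K y * \<bar>q (x0 + s j *\<^sub>R (y - x0))\<bar>))" for y
        using pt[of y] by (simp add: indicator_def)
    qed
    also have "\<dots> = (\<Sum>j=1..Suc m. \<bar>c j\<bar> * (\<integral>y. indicator K y * \<bar>q (x0 + s j *\<^sub>R (y - x0))\<bar> \<partial>lborel))"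
      by (subst Bochner_Integration.integral_sum) (intro integrable_mult_right i cont, simp)
    also have "\<dots> \<le> (\<Sum>j=1..Suc m. \<bar>c j\<bar> / s j ^ DIM('a) * (\<integral>y. indicator K y * \<bar>q y\<bar> \<partial>lborel))"
    proof (rule sum_mono)
      fix j assume j: "j \<in> {1..Suc m}"
      have "s j ^ DIM('a) * (\<integral>y. indicator K y * \<bar>q (x0 + s j *\<^sub>R (y - x0))\<bar> \<partial>lborel) \<le> (\<integral>y. indicator K y * \<bar>q y\<bar> \<partial>lborel)"
        by (rule integral_contraction_le[OF K _ _ s[OF j]]) (use q in \<open>auto intro: continuous_intros\<close>)
      then have "(\<integral>y. indicator K y * \<bar>q (x0 + s j *\<^sub>R (y - x0))\<bar> \<partial>lborel) \<le> (\<integral>y. indicator K y * \<bar>q y\<bar> \<partial>lborel) / s j ^ DIM('a)"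
        using s[OF j] by (simp add: field_simps)
      then have "\<bar>c j\<bar> * (\<integral>y. indicator K y * \<bar>q (x0 + s j *\<^sub>R (y - x0))\<bar> \<partial>lborel) \<le> \<bar>c j\<bar> * ((\<integral>y. indicator K y * \<bar>q y\<bar> \<partial>lborel) / s j ^ DIM('a))"
        by (rule mult_left_mono) simp
      then show "\<bar>c j\<bar> * (\<integral>y. indicator K y * \<bar>q (x0 + s j *\<^sub>R (y - x0))\<bar> \<partial>lborel) \<le> \<bar>c j\<bar> / s j ^ DIM('a) * (\<integral>y. indicator K y * \<bar>q y\<bar> \<partial>lborel)"
        by simp
    qed
    also have "\<dots> = C * (\<integral>y. indicator K y * \<bar>q y\<bar> \<partial>lborel)"
      unfolding C_def by (rule sum_distrib_right[symmetric])
    finally show "measure lborel K * \<bar>q x0\<bar> \<le> C * (\<integral>y. indicator K y * \<bar>q y\<bar> \<partial>lborel)" .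
  qed
qed

section \<open>Polygons and triangulations\<close>

text \<open>\<open>side_nontrivial\<close> excludes half-planes that touch the polygon in a corner
  only. The sign information on the frontier holds almost everywhere on segments, so each point of a
  side must lie on a nondegenerate segment of that side.\<close>

locale polygon = polygon_sides +
  assumes nonempty: "\<Omega> \<noteq> {}" and closure_eq: "closure \<Omega> = {x. \<forall>i\<in>I. n i \<bullet> x \<le> b i}"
    and side_nontrivial: "i \<in> I \<Longrightarrow> x \<in> closure \<Omega> \<Longrightarrow> gap i x = 0 \<Longrightarrow> \<exists>z\<in>closure \<Omega>. z \<noteq> x \<and> gap i z = 0"

text \<open>A minimal family of half-planes is taken, because minimality makes each of its lines cut
  out a facet. A facet of a two-dimensional polyhedron has affine dimension 1 and so is not a single
  point. The half-planes themselves serve as indices of the sides.\<close>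

lemma convex_polygon_imp_polygon:
  assumes "convex_polygon \<Omega>"
  obtains I :: "pt set set" and n b where "polygon \<Omega> I n b"
proof -
  obtain P where P: "finite P" "\<Omega> = interior (convex hull P)" "\<Omega> \<noteq> {}"
    using assms unfolding convex_polygon_def by blast
  define H where "H = convex hull P"
  have H: "compact H" "convex H" "polyhedron H"
    using P by (auto simp: H_def finite_imp_compact_convex_hull polytope_convex_hull polytope_imp_polyhedron)
  have int: "interior H \<noteq> {}" "\<Omega> = interior H" using P by (auto simp: H_def)
  have aff: "affine hull H = UNIV" using int(1) affine_hull_nonempty_interior by blast
  have cl: "closure \<Omega> = H"
    using H int by (simp add: convex_closure_interior compact_imp_closed closure_closed)
  obtain F where F: "finite F" "H = affine hull H \<inter> \<Inter>F"
    "\<forall>h \<in> F. \<exists>a b. a \<noteq> 0 \<and> h = {x. a \<bullet> x \<le> b}" "\<And>F'. F' \<subset> F \<Longrightarrow> H \<subset> affine hull H \<inter> \<Inter>F'"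
    using H(3) polyhedron_Int_affine_minimal[of H] by blast
  from F(3) obtain a b where ab: "\<And>h. h \<in> F \<Longrightarrow> a h \<noteq> 0 \<and> h = {x. a h \<bullet> x \<le> b h}" by metis
  have ri: "rel_interior H = {x \<in> H. \<forall>h \<in> F. a h \<bullet> x < b h}"
    by (rule rel_interior_polyhedron_explicit[OF F(1,2) ab F(4)])
  have fac: "C facet_of H \<longleftrightarrow> (\<exists>h. h \<in> F \<and> C = H \<inter> {x. a h \<bullet> x = b h})" for C
    by (rule facet_of_polyhedron_explicit[OF F(1,2) ab F(4)])
  have "H = \<Inter>F" using F(2) aff by simp
  then have H_eq: "H = {x. \<forall>h\<in>F. a h \<bullet> x \<le> b h}" using ab by blast
  have Om: "\<Omega> = {x. \<forall>h\<in>F. a h \<bullet> x < b h}"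
    using ri rel_interior_nonempty_interior[OF int(1)] int(2) unfolding H_eq by (auto simp: less_imp_le)
  define n' where "n' h = a h /\<^sub>R norm (a h)" for h
  define b' where "b' h = b h / norm (a h)" for h
  have na: "0 < norm (a h)" if "h \<in> F" for h using ab[OF that] by simp
  have lt: "n' h \<bullet> x < b' h \<longleftrightarrow> a h \<bullet> x < b h" and le: "n' h \<bullet> x \<le> b' h \<longleftrightarrow> a h \<bullet> x \<le> b h"
    and eq: "n' h \<bullet> x = b' h \<longleftrightarrow> a h \<bullet> x = b h" if "h \<in> F" for h x
    using na[OF that] by (auto simp: n'_def b'_def field_simps)
  interpret ps: polygon_sides \<Omega> F n' b'
  proof
    show "\<Omega> = {x. \<forall>i\<in>F. n' i \<bullet> x < b' i}" using Om lt by auto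
    show "bounded \<Omega>" using H(1) int(2) bounded_subset compact_imp_bounded interior_subset by metis
    show "norm (n' i) = 1" if "i \<in> F" for i using na[OF that] by (simp add: n'_def)
  qed (rule F(1))
  have "polygon \<Omega> F n' b'"
  proof
    show "\<Omega> \<noteq> {}" by (rule P(3))
    show "closure \<Omega> = {x. \<forall>i\<in>F. n' i \<bullet> x \<le> b' i}" unfolding cl H_eq using le by auto
    fix i x assume i: "i \<in> F" and x: "x \<in> closure \<Omega>" "ps.gap i x = 0"
    define C where "C = H \<inter> {x. a i \<bullet> x = b i}"
    have "C facet_of H" unfolding fac C_def using i by blast
    then have "aff_dim C = aff_dim H - 1" by (simp add: facet_of_def)
    moreover have "aff_dim H = 2" using aff_dim_nonempty_interior[OF int(1)] by simp
    ultimately have "aff_dim C = 1" by simp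
    then have "\<not> C \<subseteq> {x}" using aff_dim_subset[of C "{x}"] by auto
    then obtain z where "z \<in> C" "z \<noteq> x" by blast
    moreover from this have "n' i \<bullet> z = b' i" using eq[OF i] by (simp add: C_def)
    ultimately show "\<exists>z\<in>closure \<Omega>. z \<noteq> x \<and> ps.gap i z = 0"
      by (auto simp: cl C_def ps.gap_def)
  qed
  then show ?thesis by (rule that)
qed

text \<open>A negative value would persist on an interval of positive length. The conclusion
  includes the endpoints, which is how corners and vertices are reached.\<close>

lemma nonneg_of_AE_nonneg:
  fixes f :: "real \<Rightarrow> real"
  assumes f: "continuous_on {0..1} f" and N: "N \<in> null_sets lborel"
    and nn: "\<And>t. 0 < t \<Longrightarrow> t < 1 \<Longrightarrow> t \<notin> N \<Longrightarrow> 0 \<le> f t" and t: "t \<in> {0..1}"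
  shows "0 \<le> f t"
proof (rule ccontr)
  assume "\<not> 0 \<le> f t"
  then have "0 < - f t" by simp
  then obtain d where d: "0 < d" "\<And>s. s \<in> {0..1} \<Longrightarrow> dist s t < d \<Longrightarrow> dist (f s) (f t) < - f t"
    using f t unfolding continuous_on_iff by meson
  define l u where "l = max 0 (t - d)" and "u = min 1 (t + d)"
  have lu: "l < u" using t d(1) by (auto simp: l_def u_def)
  have "s \<in> N" if s: "s \<in> {l<..<u}" for s
  proof (rule ccontr)
    assume "s \<notin> N"
    then have "0 \<le> f s" using nn s by (auto simp: l_def u_def)
    moreover have "dist (f s) (f t) < - f t" using s by (intro d(2)) (auto simp: l_def u_def dist_real_def)
    ultimately show False by (simp add: dist_real_def)
  qed
  then have "{l<..<u} \<subseteq> N" by blast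
  then have "{l<..<u} \<in> null_sets lborel" using null_sets_subset[OF N] by simp
  then show False using lu by (simp add: null_sets_def)
qed

text \<open>The part of \<open>C\<close> where \<open>f\<close> is not positive is compact and
  \<open>g\<close> is positive on it, so \<open>g\<close> has a positive minimum there. With
  \<open>g\<close> a gap function this carries strict inequalities from a side to a strip along
  it.\<close>

lemma compact_near_zero_set:
  fixes f g :: "'a::metric_space \<Rightarrow> real"
  assumes "compact C" "continuous_on C f" "continuous_on C g" "\<And>x. x \<in> C \<Longrightarrow> 0 \<le> g x"
    and "\<And>x. x \<in> C \<Longrightarrow> g x = 0 \<Longrightarrow> 0 < f x"
  obtains \<delta> where "0 < \<delta>" "\<And>x. x \<in> C \<Longrightarrow> g x < \<delta> \<Longrightarrow> 0 < f x"
proof -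
  define D where "D = C \<inter> f -` {..0}"
  have "closedin (top_of_set C) D"
    unfolding D_def by (rule continuous_closedin_preimage[OF assms(2)]) simp
  then have D: "compact D" using assms(1) closedin_compact by blast
  show ?thesis
  proof (cases "D = {}")
    case True
    then show ?thesis by (intro that[of 1]) (auto simp: D_def not_le)
  next
    case False
    have "continuous_on D g" using assms(3) by (rule continuous_on_subset) (auto simp: D_def)
    then obtain x where x: "x \<in> D" "\<And>y. y \<in> D \<Longrightarrow> g x \<le> g y"
      using continuous_attains_inf[OF D False] by blast
    have "0 < g x" using x(1) assms(4,5)[of x] by (force simp: D_def less_le)
    then show ?thesis
    proof (rule that)
      fix y assume "y \<in> C" "g y < g x"
      then show "0 < f y" using x(2)[of y] by (force simp: D_def)
    qed
  qed
qed

section \<open>Sides, frontier and the sign of the convective flux\<close>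

context polygon
begin

lemma gap_affine: "gap i (x + t *\<^sub>R (y - x)) = (1 - t) * gap i x + t * gap i y"
  by (simp add: gap_def inner_add_right inner_diff_right algebra_simps)

lemma continuous_gap [continuous_intros]: "continuous_on S (gap i)"
  unfolding gap_def[abs_def] by (intro continuous_intros)

lemma frontier_iff: "x \<in> frontier \<Omega> \<longleftrightarrow> x \<in> closure \<Omega> \<and> (\<exists>i\<in>I. gap i x = 0)"
proof -
  have "frontier \<Omega> = closure \<Omega> - \<Omega>" using open_Omega by (simp add: frontier_def interior_open)
  moreover have "x \<in> \<Omega> \<longleftrightarrow> (\<forall>i\<in>I. gap i x \<noteq> 0)" if "x \<in> closure \<Omega>"
  proof -
    have "n i \<bullet> x \<le> b i" if "i \<in> I" for i using \<open>x \<in> closure \<Omega>\<close> that by (auto simp: closure_eq)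
    then show ?thesis by (force simp: Omega_eq gap_def less_le)
  qed
  ultimately show ?thesis by blast
qed

lemma side_segment_frontier:
  assumes i: "i \<in> I" and x: "x \<in> closure \<Omega>" "gap i x = 0" and y: "y \<in> closure \<Omega>" "gap i y = 0"
  shows "closed_segment x y \<subseteq> frontier \<Omega>" "z \<in> closed_segment x y \<Longrightarrow> gap i z = 0"
proof -
  have g: "gap i z = 0" if z: "z \<in> closed_segment x y" for z
  proof -
    obtain t where "z = x + t *\<^sub>R (y - x)" using z by (auto simp: in_segment algebra_simps)
    then show ?thesis using x y by (simp add: gap_affine)
  qed
  then show "z \<in> closed_segment x y \<Longrightarrow> gap i z = 0" .
  have "closed_segment x y \<subseteq> closure \<Omega>"
    by (rule closed_segment_subset[OF x(1) y(1) convex_closure_Omega])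
  show "closed_segment x y \<subseteq> frontier \<Omega>"
  proof
    fix z assume z: "z \<in> closed_segment x y"
    then have "z \<in> closure \<Omega>" using \<open>closed_segment x y \<subseteq> closure \<Omega>\<close> by blast
    with g[OF z] i show "z \<in> frontier \<Omega>" by (auto simp: frontier_iff)
  qed
qed

lemma outward_normal_side:
  assumes "i \<in> I" "x \<in> closure \<Omega>" "gap i x = 0" "\<exists>!u. is_outward_normal \<Omega> x u"
  shows "outward_normal \<Omega> x = n i"
proof -
  have "is_outward_normal \<Omega> x (n i)"
    using assms norm_normal[OF assms(1)] unfolding is_outward_normal_def closure_eq gap_def
    by (auto simp: inner_diff_right inner_commute[of _ "n i"])
  then show ?thesis unfolding outward_normal_def using assms(4) by (rule the1_equality[rotated])
qed

text \<open>Almost every point of a side is an outflow point, where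
  \<open>n i \<bullet> \<beta> x\<close> is positive, or an inflow point, where \<open>v\<close>
  vanishes. Continuity extends the sign to the whole side and compactness, up to \<open>e\<close>,
  to a strip. This supplies the assumption \<open>outward\<close> of
  \<open>convection_nonneg\<close>.\<close>

lemma outflow_sign:
  assumes \<beta>: "continuous_on (closure \<Omega>) \<beta>" and v: "continuous_on (closure \<Omega>) v"
    and null: "\<And>a b. a \<noteq> b \<Longrightarrow> closed_segment a b \<subseteq> frontier \<Omega> \<Longrightarrow>
        {t \<in> {0..1}. a + t *\<^sub>R (b - a) \<notin> Gamma_plus \<Omega> \<beta> \<union> Gamma_minus \<Omega> \<beta>} \<in> null_sets lborel"
    and v0: "\<And>x. x \<in> Gamma_minus \<Omega> \<beta> \<Longrightarrow> v x = 0" and e: "0 < e"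
  shows "\<exists>\<delta>>0. \<forall>x\<in>\<Omega>. \<forall>i\<in>I. gap i x < \<delta> \<longrightarrow> - e \<le> (n i \<bullet> \<beta> x) * (v x :: real)\<^sup>2"
proof -
  have side: "0 \<le> (n i \<bullet> \<beta> x) * (v x)\<^sup>2" if i: "i \<in> I" and x: "x \<in> closure \<Omega>" "gap i x = 0" for i x
  proof -
    \<comment> \<open>With a second point \<open>z\<close> of the side, \<open>x\<close> becomes the
      endpoint t = 0 of a nondegenerate frontier segment, and \<open>nonneg_of_AE_nonneg\<close>
      reaches it even if it is a corner.\<close>
    obtain z where z: "z \<in> closure \<Omega>" "z \<noteq> x" "gap i z = 0" using side_nontrivial[OF i x] by blast
    let ?p = "\<lambda>t. x + t *\<^sub>R (z - x)"
    note seg = side_segment_frontier[OF i x z(1,3)]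
    have p: "?p t \<in> closed_segment x z" if "t \<in> {0..1}" for t
      using that by (auto simp: in_segment intro!: exI[of _ t] simp: algebra_simps)
    have pc: "?p t \<in> closure \<Omega>" if "t \<in> {0..1}" for t using p[OF that] seg(1) frontier_iff by blast
    define N where "N = {t \<in> {0..1}. ?p t \<notin> Gamma_plus \<Omega> \<beta> \<union> Gamma_minus \<Omega> \<beta>}"
    have "0 \<le> (n i \<bullet> \<beta> (?p 0)) * (v (?p 0))\<^sup>2"
    proof (rule nonneg_of_AE_nonneg[where N = N and f = "\<lambda>t. (n i \<bullet> \<beta> (?p t)) * (v (?p t))\<^sup>2" and t = 0])
      show "continuous_on {0..1} (\<lambda>t. (n i \<bullet> \<beta> (?p t)) * (v (?p t))\<^sup>2)"
        by (intro continuous_intros continuous_on_compose2[OF \<beta>] continuous_on_compose2[OF v]) (use pc in auto)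
      show "N \<in> null_sets lborel" unfolding N_def by (rule null[OF z(2)[symmetric] seg(1)])
      fix t :: real assume t: "0 < t" "t < 1" "t \<notin> N"
      then have "?p t \<in> Gamma_plus \<Omega> \<beta> \<or> ?p t \<in> Gamma_minus \<Omega> \<beta>" by (auto simp: N_def)
      then show "0 \<le> (n i \<bullet> \<beta> (?p t)) * (v (?p t))\<^sup>2"
      proof
        assume a: "?p t \<in> Gamma_plus \<Omega> \<beta>"
        have "outward_normal \<Omega> (?p t) = n i"
        proof (rule outward_normal_side[OF i])
          show "?p t \<in> closure \<Omega>" "gap i (?p t) = 0" using t pc p seg(2) by auto
          show "\<exists>!u. is_outward_normal \<Omega> (?p t) u" using a by (auto simp: Gamma_plus_def)
        qed
        then show ?thesis using a by (simp add: Gamma_plus_def inner_commute)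
      qed (simp add: v0)
    qed simp
    then show ?thesis by simp
  qed
  have "\<exists>\<delta>>0. \<forall>x\<in>closure \<Omega>. gap i x < \<delta> \<longrightarrow> - e \<le> (n i \<bullet> \<beta> x) * (v x)\<^sup>2" if i: "i \<in> I" for i
  proof -
    obtain \<delta> where "0 < \<delta>" "\<And>x. x \<in> closure \<Omega> \<Longrightarrow> gap i x < \<delta> \<Longrightarrow> 0 < (n i \<bullet> \<beta> x) * (v x)\<^sup>2 + e"
    proof (rule compact_near_zero_set[of "closure \<Omega>" "\<lambda>x. (n i \<bullet> \<beta> x) * (v x)\<^sup>2 + e" "gap i"])
      show "continuous_on (closure \<Omega>) (\<lambda>x. n i \<bullet> \<beta> x * (v x)\<^sup>2 + e)"
        by (intro continuous_intros \<beta> v)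
      show "0 < n i \<bullet> \<beta> x * (v x)\<^sup>2 + e" if "x \<in> closure \<Omega>" "gap i x = 0" for x
        using side[OF i that] e by simp
    qed (use compact_closure_Omega continuous_gap gap_nonneg i in auto)
    then have "- e \<le> (n i \<bullet> \<beta> x) * (v x)\<^sup>2" if "x \<in> closure \<Omega>" "gap i x < \<delta>" for x
      using that by fastforce
    with \<open>0 < \<delta>\<close> show ?thesis by blast
  qed
  then obtain d where d: "\<And>i. i \<in> I \<Longrightarrow> 0 < d i" 
    "\<And>i x. i \<in> I \<Longrightarrow> x \<in> closure \<Omega> \<Longrightarrow> gap i x < d i \<Longrightarrow> - e \<le> (n i \<bullet> \<beta> x) * (v x)\<^sup>2" by metis
  define \<delta> where "\<delta> = Min (insert 1 (d ` I))"
  have "0 < \<delta>" using d finite_sides by (simp add: \<delta>_def)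
  moreover have "\<delta> \<le> d i" if "i \<in> I" for i using that finite_sides by (simp add: \<delta>_def)
  ultimately show ?thesis
    using d(2) closure_subset[of \<Omega>] by (intro exI[of _ \<delta>]) (meson less_le_trans subsetD)
qed

end

section \<open>Conforming triangulations and their boundary edges\<close>

locale polygon_mesh = polygon +
  fixes T :: "pt set set"
  assumes mesh: "mesh \<Omega> T"
begin

lemma mesh_props:
  shows finite_T: "finite T" and triangle: "K \<in> T \<Longrightarrow> card K = 3" "K \<in> T \<Longrightarrow> \<not> collinear K"
    and covers: "\<Union>((\<lambda>K. convex hull K) ` T) = closure \<Omega>"
    and conforming: "K \<in> T \<Longrightarrow> K' \<in> T \<Longrightarrow> convex hull K \<inter> convex hull K' = convex hull (K \<inter> K')"
  using mesh by (auto simp: mesh_def)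

lemma finite_triangle: "K \<in> T \<Longrightarrow> finite K"
  using triangle(1) card.infinite by fastforce

lemma hull_compact: "K \<in> T \<Longrightarrow> compact (convex hull K)"
  by (simp add: finite_triangle finite_imp_compact_convex_hull)

lemma hull_subset_closure: "K \<in> T \<Longrightarrow> convex hull K \<subseteq> closure \<Omega>"
  using covers by blast

text \<open>The gap is affine and nonnegative at the vertices, so a convex combination of gap 0
  gives no weight to a vertex off the side.\<close>

lemma hull_side:
  assumes K: "K \<in> T" and i: "i \<in> I" and x: "x \<in> convex hull K" "gap i x = 0"
  shows "x \<in> convex hull {y \<in> K. gap i y = 0}"
proof -
  have fin: "finite K" by (rule finite_triangle[OF K])
  obtain u where u: "\<And>y. y \<in> K \<Longrightarrow> 0 \<le> u y" "sum u K = 1" "(\<Sum>y\<in>K. u y *\<^sub>R y) = x"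
    using x(1) unfolding convex_hull_finite[OF fin] by blast
  have "gap i x = (\<Sum>y\<in>K. u y * gap i y)"
    unfolding u(3)[symmetric] gap_def
    by (simp add: inner_sum_right right_diff_distrib sum_subtractf sum_distrib_right[symmetric] u(2))
  then have z: "(\<Sum>y\<in>K. u y * gap i y) = 0" using x by simp
  have gn: "0 \<le> gap i y" if "y \<in> K" for y
    using hull_subset_closure[OF K] hull_subset[of K convex] that by (intro gap_nonneg i) auto
  have "\<forall>y\<in>K. u y * gap i y = 0"
    using z fin u(1) gn by (subst (asm) sum_nonneg_eq_0_iff) auto
  then have u0: "u y = 0" if "y \<in> K" "gap i y \<noteq> 0" for y using that by auto
  let ?K = "{y \<in> K. gap i y = 0}"
  have "sum u ?K = 1" using u(2) fin u0 by (subst sum.mono_neutral_left[of K ?K u]) auto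
  moreover have "(\<Sum>y\<in>?K. u y *\<^sub>R y) = x"
    using u(3) fin u0 by (subst sum.mono_neutral_left[of K ?K]) auto
  ultimately show ?thesis using fin u(1) unfolding convex_hull_finite[OF finite_subset[OF _ fin, of ?K, simplified]]
    by blast
qed

lemma side_not_triangle:
  assumes K: "K \<in> T" and i: "i \<in> I"
  shows "{y \<in> K. gap i y = 0} \<noteq> K"
proof
  assume "{y \<in> K. gap i y = 0} = K"
  then have "gap i y = 0" if "y \<in> K" for y using that by blast
  then have "K \<subseteq> {x. n i \<bullet> x = b i}" by (auto simp: gap_def)
  then have "aff_dim K \<le> aff_dim {x. n i \<bullet> x = b i}" by (rule aff_dim_subset)
  moreover have "n i \<noteq> 0" using norm_normal[OF i] by auto
  ultimately have "aff_dim K \<le> 1" by simp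
  then show False using triangle(2)[OF K] collinear_aff_dim by blast
qed

text \<open>A triangle that contains a point of the side meets the side in a vertex or an edge. The
  edges lying on the side form a closed set \<open>E\<close>. If \<open>x\<close> were outside it, a
  short piece of the side starting at \<open>x\<close> would avoid \<open>E\<close> as well, and all
  its points would be vertices; but there are only finitely many of those.\<close>

lemma frontier_in_edge:
  assumes i: "i \<in> I" and x: "x \<in> closure \<Omega>" "gap i x = 0"
  obtains K p q where "K \<in> T" "p \<in> K" "q \<in> K" "p \<noteq> q" "gap i p = 0" "gap i q = 0" "x \<in> closed_segment p q"
proof -
  define A where "A = {z \<in> T \<times> \<Union>T \<times> \<Union>T. fst (snd z) \<in> fst z \<and> snd (snd z) \<in> fst z \<and> fst (snd z) \<noteq> snd (snd z) \<and>
      gap i (fst (snd z)) = 0 \<and> gap i (snd (snd z)) = 0}"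
  define E where "E = (\<Union>z\<in>A. closed_segment (fst (snd z)) (snd (snd z)))"
  have finUT: "finite (\<Union>T)" using finite_T finite_triangle by blast
  have "finite A" unfolding A_def using finite_T finUT by auto
  then have "closed E" unfolding E_def by (intro closed_UN) auto
  have "x \<in> E"
  proof (rule ccontr)
    assume "x \<notin> E"
    then obtain r where r: "0 < r" "ball x r \<inter> E = {}"
      using \<open>closed E\<close> open_contains_ball[of "- E"] by (auto simp: disjoint_eq_subset_Compl closed_def)
    obtain z where z: "z \<in> closure \<Omega>" "z \<noteq> x" "gap i z = 0" using side_nontrivial[OF i x] by blast
    define p where "p t = x + t *\<^sub>R (z - x)" for t
    define m where "m = min 1 (r / norm (z - x))"
    have m: "0 < m" using r z by (simp add: m_def)
    have "p t \<in> \<Union>T" if t: "t \<in> {0<..<m}" for t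
    proof -
      have "norm (t *\<^sub>R (z - x)) = \<bar>t\<bar> * norm (z - x)" by (rule norm_scaleR)
      also have "\<dots> < r" using t z by (auto simp: m_def field_simps)
      finally have "norm (t *\<^sub>R (z - x)) < r" .
      moreover have "dist x (p t) = norm (t *\<^sub>R (z - x))"
        unfolding p_def dist_norm by (metis add_diff_cancel_left' norm_minus_commute)
      ultimately have "p t \<in> ball x r" by simp
      then have nE: "p t \<notin> E" using r by auto
      have "t \<in> {0..1}" using t by (auto simp: m_def)
      then have "p t \<in> closed_segment x z"
        by (auto simp: p_def in_segment intro!: exI[of _ t] simp: algebra_simps)
      then have pt: "p t \<in> closure \<Omega>" "gap i (p t) = 0"
        using side_segment_frontier[OF i x z(1,3)] frontier_iff by auto
      then obtain K where K: "K \<in> T" "p t \<in> convex hull K" using covers by blast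
      let ?S = "{y \<in> K. gap i y = 0}"
      have pS: "p t \<in> convex hull ?S" by (rule hull_side[OF K(1) i K(2) pt(2)])
      have "?S \<subset> K" using side_not_triangle[OF K(1) i] by auto
      then have "card ?S < 3" using psubset_card_mono[OF finite_triangle[OF K(1)], of ?S] triangle(1)[OF K(1)] by simp
      moreover have "card ?S \<noteq> 0"
      proof -
        have "?S \<noteq> {}" using pS by (metis convex_hull_empty empty_iff)
        moreover have "finite ?S" using finite_triangle[OF K(1)] by simp
        ultimately show ?thesis by (simp only: card_eq_0_iff) simp
      qed
      moreover have "card ?S \<noteq> 2"
      proof
        assume "card ?S = 2"
        then obtain y y' where S: "?S = {y, y'}" "y \<noteq> y'" by (auto simp: card_2_iff)
        then have "y \<in> ?S" "y' \<in> ?S" by auto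
        then have "(K, y, y') \<in> A" using S(2) K(1) by (auto simp: A_def)
        moreover have "p t \<in> closed_segment y y'" using pS S(1) by (simp add: segment_convex_hull)
        ultimately show False using nE by (force simp: E_def)
      qed
      ultimately have "card ?S = 1" by linarith
      then obtain y where S: "?S = {y}" by (auto simp: card_1_singleton_iff)
      then have "p t = y" using pS by simp
      moreover have "y \<in> K" using S by blast
      ultimately show ?thesis using K(1) by blast
    qed
    then have "p ` {0<..<m} \<subseteq> \<Union>T" by blast
    then have "finite (p ` {0<..<m})" using finUT finite_subset by blast
    moreover have "inj_on p {0<..<m}" using z by (auto simp: inj_on_def p_def)
    ultimately have "finite {0<..<m}" using finite_imageD by blast
    then show False using infinite_Ioo[OF m] by simp
  qed
  then show ?thesis using that by (auto simp: E_def A_def)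
qed

text \<open>The point lies on a boundary edge. By compatibility this is an outflow edge, or its
  interior misses the outflow boundary and thus consists, up to a null set, of inflow points, where
  \<open>v\<close> is zero; by continuity \<open>v\<close> would then vanish on the closed edge.
  Hence outflow edges alone control the boundary values of \<open>v\<close>.\<close>

lemma outflow_edge:
  assumes v: "continuous_on (closure \<Omega>) v"
    and null: "\<And>a b. a \<noteq> b \<Longrightarrow> closed_segment a b \<subseteq> frontier \<Omega> \<Longrightarrow>
        {t \<in> {0..1}. a + t *\<^sub>R (b - a) \<notin> Gamma_plus \<Omega> \<beta> \<union> Gamma_minus \<Omega> \<beta>} \<in> null_sets lborel"
    and v0: "\<And>x. x \<in> Gamma_minus \<Omega> \<beta> \<Longrightarrow> v x = 0"
    and out: "outflow_compatible \<Omega> \<beta> T" and x: "x \<in> frontier \<Omega>" "v x \<noteq> (0::real)"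
  shows "\<exists>e\<in>out_edges \<Omega> \<beta> T. x \<in> convex hull e"
proof -
  obtain i where i: "i \<in> I" "x \<in> closure \<Omega>" "gap i x = 0" using x frontier_iff by blast
  obtain K p q where K: "K \<in> T" "p \<in> K" "q \<in> K" "p \<noteq> q" and pq: "gap i p = 0" "gap i q = 0" "x \<in> closed_segment p q"
    using frontier_in_edge[OF i] by blast
  have cl: "p \<in> closure \<Omega>" "q \<in> closure \<Omega>"
    using hull_subset_closure[OF K(1)] hull_subset[of K convex] K by auto
  have e: "{p, q} \<in> edges T" using K by (auto simp: edges_def)
  have seg: "closed_segment p q \<subseteq> frontier \<Omega>"
    by (rule side_segment_frontier(1)[OF i(1) cl(1) pq(1) cl(2) pq(2)])
  consider "open_segment p q \<subseteq> Gamma_plus \<Omega> \<beta>" | "open_segment p q \<inter> Gamma_plus \<Omega> \<beta> = {}"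
    using out e seg unfolding outflow_compatible_def by blast
  then show ?thesis
  proof cases
    case 1
    then have "{p, q} \<in> out_edges \<Omega> \<beta> T" using e by (auto simp: out_edges_def)
    moreover have "x \<in> convex hull {p, q}" using pq by (simp add: segment_convex_hull)
    ultimately show ?thesis by blast
  next
    case 2
    let ?p = "\<lambda>t. p + t *\<^sub>R (q - p)"
    define N where "N = {t \<in> {0..1}. ?p t \<notin> Gamma_plus \<Omega> \<beta> \<union> Gamma_minus \<Omega> \<beta>}"
    have N: "N \<in> null_sets lborel" unfolding N_def by (rule null[OF K(4) seg])
    have pc: "?p t \<in> closure \<Omega>" if "t \<in> {0..1}" for t
    proof -
      have "?p t \<in> closed_segment p q"
        using that by (auto simp: in_segment intro!: exI[of _ t] simp: algebra_simps)
      then show ?thesis using seg frontier_iff by blast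
    qed
    have c: "continuous_on {0..1} (\<lambda>t. v (?p t))"
      by (intro continuous_on_compose2[OF v] continuous_intros) (use pc in auto)
    obtain t where t: "t \<in> {0..1}" "x = ?p t" using pq(3) by (auto simp: in_segment algebra_simps)
    have z: "v (?p s) = 0" if s: "0 < s" "s < 1" "s \<notin> N" for s
    proof -
      have "?p s \<in> open_segment p q"
        using s K(4) by (auto simp: in_segment intro!: exI[of _ s] simp: algebra_simps)
      then have "?p s \<in> Gamma_minus \<Omega> \<beta>" using 2 s by (auto simp: N_def)
      then show ?thesis by (rule v0)
    qed
    have "0 \<le> v (?p t)" by (rule nonneg_of_AE_nonneg[OF c N _ t(1)]) (simp add: z)
    moreover have "0 \<le> - v (?p t)"
      by (rule nonneg_of_AE_nonneg[OF continuous_on_minus[OF c] N _ t(1)]) (simp add: z)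
    ultimately show ?thesis using x t by simp
  qed
qed

lemma continuous_piecewise:
  assumes "\<And>K. K \<in> T \<Longrightarrow> \<exists>p. continuous_on UNIV p \<and> (\<forall>x\<in>convex hull K. v x = (p x :: real))"
  shows "continuous_on (closure \<Omega>) v"
proof -
  have "continuous_on (convex hull K) v" if K: "K \<in> T" for K
  proof -
    obtain p where "continuous_on UNIV p" "\<forall>x\<in>convex hull K. v x = p x" using assms[OF K] by blast
    then show ?thesis by (metis continuous_on_cong continuous_on_subset subset_UNIV)
  qed
  then have "continuous_on (\<Union>K\<in>T. convex hull K) v"
    using finite_T hull_compact compact_imp_closed by (intro continuous_on_closed_Union) auto
  then show ?thesis using covers by simp
qed

text \<open>Conformity makes the intersection the hull of at most two common vertices, which has
  dimension at most 1 and empty interior.\<close>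

lemma interiors_disjoint:
  assumes "K \<in> T" "K' \<in> T" "K \<noteq> K'"
  shows "interior (convex hull K) \<inter> interior (convex hull K') = {}"
proof -
  have "K \<inter> K' \<noteq> K"
  proof
    assume "K \<inter> K' = K"
    then have "K \<subseteq> K'" by blast
    then have "K = K'" using card_subset_eq[OF finite_triangle[OF assms(2)]] triangle(1) assms by metis
    then show False using assms by simp
  qed
  then have "K \<inter> K' \<subset> K" by blast
  then have "card (K \<inter> K') < 3"
    using psubset_card_mono[OF finite_triangle[OF assms(1)]] triangle(1)[OF assms(1)] by metis
  then have "aff_dim (K \<inter> K') \<le> 1"
    using aff_dim_le_card[of "K \<inter> K'"] finite_triangle[OF assms(1)] by simp
  then have "aff_dim (convex hull (K \<inter> K')) < 2" by (simp add: aff_dim_convex_hull)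
  then have "interior (convex hull (K \<inter> K')) = {}"
    using aff_dim_nonempty_interior[of "convex hull (K \<inter> K')"] by fastforce
  then show ?thesis using conforming[OF assms(1,2)] interior_Int by metis
qed

lemma interior_subset_Omega: "K \<in> T \<Longrightarrow> interior (convex hull K) \<subseteq> \<Omega>"
proof -
  assume "K \<in> T"
  then have "interior (convex hull K) \<subseteq> interior (closure \<Omega>)" by (intro interior_mono hull_subset_closure)
  then show ?thesis
    using convex_interior_closure[OF convex_Omega] interior_open[OF open_Omega] by simp
qed

end

section \<open>Regular triangulations\<close>

lemma diameter_doubleton: "diameter {p, q::pt} = dist p q"
proof (rule order_antisym)
  show "diameter {p, q} \<le> dist p q"
    by (rule diameter_le) (auto simp: dist_norm norm_minus_commute)
  show "dist p q \<le> diameter {p, q}"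
    by (rule diameter_bounded_bound) auto
qed

text \<open>The weight h_e^-1 cancels the length in \<open>edge_int\<close>, so the edge terms are
  means over a parameter in \<open>{0..1}\<close> and free of scale. The endpoints are those picked
  by the choice inside \<open>edge_int\<close>, and they are the same for every
  \<open>f\<close>.\<close>

lemma edge_mean_eq:
  assumes "card e = 2"
  obtains p q where "e = {p, q}" "p \<noteq> q"
    "\<And>f. inverse (diameter e) * edge_int e f = integral {0..1} (\<lambda>t. f (p + t *\<^sub>R (q - p)))"
proof -
  define z where "z = (SOME z. e = {fst z, snd z})"
  obtain a b where "e = {a, b}" using assms by (auto simp: card_2_iff)
  then have "\<exists>z. e = {fst z, snd z}" by (intro exI[of _ "(a, b)"]) simp
  then have z: "e = {fst z, snd z}" unfolding z_def by (rule someI_ex)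
  have ne: "fst z \<noteq> snd z"
  proof
    assume "fst z = snd z"
    then have "e = {snd z}" using z by simp
    then have "card e = 1" by simp
    then show False using assms by simp
  qed
  have "diameter e = dist (fst z) (snd z)" using z diameter_doubleton by metis
  then have "inverse (diameter e) * edge_int e f = integral {0..1} (\<lambda>t. f (fst z + t *\<^sub>R (snd z - fst z)))" for f
    using ne unfolding edge_int_def Let_def z_def[symmetric] by simp
  with z ne show ?thesis by (rule that)
qed

lemma edge_mean_square_nonneg:
  assumes "card e = 2" "continuous_on (convex hull e) v"
  shows "0 \<le> inverse (diameter e) * edge_int e (\<lambda>x. (v x)\<^sup>2)"
proof -
  obtain p q where pq: "e = {p, q}"
    "\<And>f. inverse (diameter e) * edge_int e f = integral {0..1} (\<lambda>t. f (p + t *\<^sub>R (q - p)))"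
    by (rule edge_mean_eq[OF assms(1)]) blast
  have "p + t *\<^sub>R (q - p) \<in> convex hull e" if "t \<in> {0..1}" for t
    using that by (auto simp: pq(1) segment_convex_hull[symmetric] in_segment intro!: exI[of _ t] simp: algebra_simps)
  then have "continuous_on {0..1} (\<lambda>t. (v (p + t *\<^sub>R (q - p)))\<^sup>2)"
    by (intro continuous_intros continuous_on_compose2[OF assms(2)]) auto
  then show ?thesis
    unfolding pq(2) by (intro Henstock_Kurzweil_Integration.integral_nonneg integrable_continuous_real) auto
qed

text \<open>The one-dimensional inverse inequality on \<open>{0..1}\<close>, applied to the square
  of the polynomial along the edge. Working with squares, hence with degree \<open>2 * m\<close>,
  turns an estimate by the integral of the modulus into one by the mean square.\<close>

lemma ex_edge_sup_bound:
  obtains c where "0 \<le> c"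
    "\<And>e v P x. \<lbrakk>card e = 2; poly2 m P; \<And>y. y \<in> convex hull e \<Longrightarrow> v y = P y; x \<in> convex hull e\<rbrakk>
      \<Longrightarrow> (v x)\<^sup>2 \<le> c * (inverse (diameter e) * edge_int e (\<lambda>x. (v x)\<^sup>2))"
proof -
  obtain c where c: "0 \<le> c" "\<And>(q :: real \<Rightarrow> real) K x0.
      \<lbrakk>line_poly (2 * m) q; continuous_on UNIV q; compact K; convex K; x0 \<in> K\<rbrakk>
      \<Longrightarrow> measure lborel K * \<bar>q x0\<bar> \<le> c * (\<integral>y. indicator K y * \<bar>q y\<bar> \<partial>lborel)"
    by (rule ex_inverse_inequality[where m = "2 * m"]) blast
  show ?thesis
  proof (rule that[OF c(1)])
    fix e v P x assume e: "card e = 2" and P: "poly2 m P" and v: "\<And>y. y \<in> convex hull e \<Longrightarrow> v y = P y"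
      and x: "x \<in> convex hull e"
    obtain p q where pq: "e = {p, q}"
      "\<And>f. inverse (diameter e) * edge_int e f = integral {0..1} (\<lambda>t. f (p + t *\<^sub>R (q - p)))"
      by (rule edge_mean_eq[OF e]) blast
    let ?p = "\<lambda>t. p + t *\<^sub>R (q - p)"
    have pe: "?p t \<in> convex hull e" if "t \<in> {0..1}" for t
      using that by (auto simp: pq(1) segment_convex_hull[symmetric] in_segment intro!: exI[of _ t] simp: algebra_simps)
    obtain t where t: "t \<in> {0..1}" "x = ?p t"
      using x by (auto simp: pq(1) segment_convex_hull[symmetric] in_segment algebra_simps)
    define f where "f t = (P (?p t))\<^sup>2" for t
    have fc: "continuous_on UNIV f"
      unfolding f_def by (intro continuous_intros continuous_on_compose2[OF poly2_continuous[OF P, of UNIV]]) auto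
    have "line_poly (2 * m) f"
      unfolding f_def by (intro line_poly_power line_poly_compose_line poly2_line_poly P)
    from c(2)[OF this fc compact_Icc convex_real_interval(5) t(1)]
    have "(v x)\<^sup>2 \<le> c * (\<integral>y. indicator {0..1} y * f y \<partial>lborel)"
      using v[OF x] t by (simp add: f_def)
    also have "(\<integral>y. indicator {0..1} y * f y \<partial>lborel) = integral {0..1} f"
    proof -
      have "set_integrable lborel {0..1} f"
        unfolding set_integrable_def
        by (rule borel_integrable_compact[OF compact_Icc continuous_on_subset[OF fc]]) simp
      from set_borel_integral_eq_integral(2)[OF this] show ?thesis
        by (simp add: set_lebesgue_integral_def)
    qed
    also have "\<dots> = integral {0..1} (\<lambda>t. (v (?p t))\<^sup>2)"
      by (rule integral_cong) (simp add: f_def v[OF pe])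
    finally show "(v x)\<^sup>2 \<le> c * (inverse (diameter e) * edge_int e (\<lambda>x. (v x)\<^sup>2))"
      by (simp add: pq(2))
  qed
qed

section \<open>Inscribed discs, overlap counts and bounds near the frontier\<close>

locale regular_mesh = polygon_mesh +
  fixes \<sigma> \<theta> :: real
  assumes regular: "shape_regular \<sigma> T" and uniform: "quasi_uniform \<theta> T"
begin

lemma diameter_pos: "K \<in> T \<Longrightarrow> 0 < diameter K"
proof -
  assume K: "K \<in> T"
  then obtain x y where "x \<in> K" "y \<in> K" "x \<noteq> y"
    using triangle(2)[OF K] by (metis collinear_empty collinear_sing empty_iff insert_iff subsetI subset_antisym subset_singletonD)
  then have "0 < dist x y" "dist x y \<le> diameter K"
    using finite_imp_bounded[OF finite_triangle[OF K]] by (auto intro: diameter_bounded_bound)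
  then show ?thesis by linarith
qed

lemma hull_subset_cball: "K \<in> T \<Longrightarrow> p \<in> K \<Longrightarrow> convex hull K \<subseteq> cball p (diameter K)"
  using diameter_bounded_bound[OF finite_imp_bounded[OF finite_triangle]]
  by (intro hull_minimal) auto

lemma inscribed_ball:
  assumes K: "K \<in> T"
  obtains c r where "0 < r" "ball c r \<subseteq> convex hull K" "diameter K \<le> 2 * \<sigma> * r" "0 < \<sigma>"
proof -
  define X where "X = {r. \<exists>x. ball x r \<subseteq> convex hull K}"
  have "0 \<in> X" by (simp add: X_def)
  obtain p where p: "p \<in> K" using triangle(1)[OF K] by fastforce
  \<comment> \<open>\<open>X\<close> also contains every nonpositive radius, because the ball is
    then empty; only positive ones need the comparison of diameters.\<close>
  have "r \<le> diameter K" if r: "r \<in> X" for r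
  proof (cases "0 < r")
    case True
    obtain x where "ball x r \<subseteq> convex hull K" using r unfolding X_def by blast
    then have "ball x r \<subseteq> cball p (diameter K)" using hull_subset_cball[OF K p] by blast
    then have "diameter (ball x r) \<le> diameter (cball p (diameter K))"
      by (rule diameter_subset) simp
    then show ?thesis using True diameter_pos[OF K] by simp
  qed (use diameter_pos[OF K] in auto)
  then have "bdd_above X" by (auto simp: bdd_above_def)
  then have "0 \<le> inradius K" unfolding inradius_def X_def[symmetric] using \<open>0 \<in> X\<close> cSup_upper by blast
  moreover have D: "diameter K \<le> \<sigma> * inradius K" using regular K by (simp add: shape_regular_def)
  moreover have "0 < \<sigma> * inradius K" using D diameter_pos[OF K] by linarith
  ultimately have pos: "0 < inradius K" "0 < \<sigma>" by (auto simp: zero_less_mult_iff)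
  then have "inradius K / 2 < Sup X" by (simp add: inradius_def X_def)
  \<comment> \<open>Some admissible radius exceeds half the supremum. Settling for half avoids
    showing that the supremum is attained and causes the factor 2 in
    \<open>2 * \<sigma> * r\<close>.\<close>
  then obtain r where r: "r \<in> X" "inradius K / 2 < r" using \<open>0 \<in> X\<close> less_cSupE by blast
  then obtain c where c: "ball c r \<subseteq> convex hull K" by (auto simp: X_def)
  show ?thesis
  proof (rule that[OF _ c])
    show "0 < r" using r pos by linarith
    have "\<sigma> * inradius K \<le> \<sigma> * (2 * r)" using r pos by (intro mult_left_mono) auto
    then show "diameter K \<le> 2 * \<sigma> * r" using D by simp
  qed (rule pos)
qed

lemma measure_hull_le: "K \<in> T \<Longrightarrow> measure lebesgue (convex hull K) \<le> pi * (diameter K)\<^sup>2"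
proof -
  assume K: "K \<in> T"
  obtain p where p: "p \<in> K" using triangle(1)[OF K] by fastforce
  have "measure lebesgue (convex hull K) \<le> measure lebesgue (cball p (diameter K))"
    using hull_subset_cball[OF K p] hull_compact[OF K]
    by (intro measure_mono_fmeasurable) (auto intro: lmeasurable_compact fmeasurableD)
  also have "\<dots> = pi * (diameter K)\<^sup>2"
    using diameter_pos[OF K] by (simp add: content_cball unit_ball_vol_2)
  finally show ?thesis .
qed

lemma theta_ge_1: "1 \<le> \<theta>"
proof -
  have "T \<noteq> {}" using covers nonempty closure_subset[of \<Omega>] by auto
  then obtain K where K: "K \<in> T" by blast
  then have "diameter K \<le> \<theta> * diameter K" using uniform by (auto simp: quasi_uniform_def)
  then show ?thesis using diameter_pos[OF K] by simp
qed

text \<open>Triangles that meet an edge contain disjoint discs of comparable radius in a disc of that size.\<close>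

lemma card_triangles_at_edge:
  assumes e: "e \<in> edges T"
  shows "real (card {K \<in> T. convex hull K \<inter> convex hull e \<noteq> {}}) \<le> (2 * \<sigma> * \<theta> * (2 * \<theta> + 1))\<^sup>2"
proof -
  define J where "J = {K \<in> T. convex hull K \<inter> convex hull e \<noteq> {}}"
  obtain K0 where K0: "K0 \<in> T" "e \<subseteq> K0" "card e = 2" using e by (auto simp: edges_def)
  then obtain p where p: "p \<in> K0" using triangle(1)[OF K0(1)] by fastforce
  define D where "D = diameter K0"
  have D: "0 < D" using diameter_pos[OF K0(1)] by (simp add: D_def)
  have \<sigma>: "0 < \<sigma>" using inscribed_ball[OF K0(1)] by blast
  have \<theta>: "1 \<le> \<theta>" by (rule theta_ge_1)
  have "\<exists>c r. 0 < r \<and> ball c r \<subseteq> convex hull K \<and> diameter K \<le> 2 * \<sigma> * r" if "K \<in> T" for K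
    by (rule inscribed_ball[OF that]) blast
  then obtain c r where cr: "\<And>K. K \<in> T \<Longrightarrow> 0 < r K" "\<And>K. K \<in> T \<Longrightarrow> ball (c K) (r K) \<subseteq> convex hull K"
      "\<And>K. K \<in> T \<Longrightarrow> diameter K \<le> 2 * \<sigma> * r K" by metis
  \<comment> \<open>A radius common to all triangles: diameters are at least D/\<theta> by
    quasi-uniformity, and inscribed radii at least a diameter divided by 2 \<sigma>.\<close>
  define q where "q = D / (2 * \<sigma> * \<theta>)"
  have q: "0 < q" using D \<sigma> \<theta> by (simp add: q_def)
  have qr: "q \<le> r K" if "K \<in> T" for K
  proof -
    have "D \<le> \<theta> * diameter K" using uniform K0(1) that by (simp add: quasi_uniform_def D_def)
    also have "\<dots> \<le> \<theta> * (2 * \<sigma> * r K)" using cr(3)[OF that] \<theta> by (intro mult_left_mono) auto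
    finally show ?thesis using \<sigma> \<theta> by (simp add: q_def field_simps)
  qed
  \<comment> \<open>A distance \<open>D\<close> from \<open>p\<close> to a common point of
    \<open>K\<close> and \<open>e\<close>, then two steps of length at most
    \<open>\<theta> * D\<close> through a vertex of \<open>K\<close>.\<close>
  have inside: "ball (c K) q \<subseteq> cball p ((2 * \<theta> + 1) * D)" if K: "K \<in> J" for K
  proof
    fix x assume "x \<in> ball (c K) q"
    have KT: "K \<in> T" using K by (simp add: J_def)
    then have x: "x \<in> convex hull K" using cr(2)[OF KT] qr[OF KT] \<open>x \<in> ball (c K) q\<close> by force
    obtain z where z: "z \<in> convex hull K" "z \<in> convex hull e" using K by (auto simp: J_def)
    then have "z \<in> convex hull K0" using hull_mono[OF K0(2)] by blast
    then have zp: "dist p z \<le> D" using hull_subset_cball[OF K0(1) p] by (auto simp: D_def)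
    obtain s where s: "s \<in> K" using triangle(1)[OF KT] by fastforce
    have "dist s x \<le> diameter K" "dist s z \<le> diameter K" using hull_subset_cball[OF KT s] x z by auto
    moreover have "diameter K \<le> \<theta> * D" using uniform K0(1) KT by (simp add: quasi_uniform_def D_def)
    moreover have "dist p x \<le> dist p z + dist s z + dist s x"
      using dist_triangle[of p x z] dist_triangle[of z x s] by (simp add: dist_commute)
    ultimately show "x \<in> cball p ((2 * \<theta> + 1) * D)" using zp by (simp add: algebra_simps)
  qed
  have fJ: "finite J" using finite_T by (simp add: J_def)
  have "measure lebesgue (\<Union>K\<in>J. ball (c K) q) = (\<Sum>K\<in>J. measure lebesgue (ball (c K) q))"
  proof (rule measure_UNION'[OF fJ])
    show "pairwise (\<lambda>K K'. disjnt (ball (c K) q) (ball (c K') q)) J"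
    proof (rule pairwiseI)
      fix K K' assume K: "K \<in> J" "K' \<in> J" "K \<noteq> K'"
      then have KT: "K \<in> T" "K' \<in> T" by (auto simp: J_def)
      have "ball (c L) q \<subseteq> interior (convex hull L)" if "L \<in> T" for L
        using cr(2)[OF that] qr[OF that] by (intro interior_maximal open_ball) force
      then show "disjnt (ball (c K) q) (ball (c K') q)"
        using interiors_disjoint[OF KT K(3)] KT by (meson disjnt_def disjnt_subset1 disjnt_subset2)
    qed
  qed simp
  moreover have "measure lebesgue (\<Union>K\<in>J. ball (c K) q) \<le> measure lebesgue (cball p ((2 * \<theta> + 1) * D))"
  proof (rule measure_mono_fmeasurable)
    show "(\<Union>K\<in>J. ball (c K) q) \<subseteq> cball p ((2 * \<theta> + 1) * D)" using inside by blast
    have "open (\<Union>K\<in>J. ball (c K) q)" by blast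
    then show "(\<Union>K\<in>J. ball (c K) q) \<in> sets lebesgue" by simp
  qed simp
  ultimately have "real (card J) * (pi * q\<^sup>2) \<le> pi * ((2 * \<theta> + 1) * D)\<^sup>2"
    using q D \<theta> by (simp add: content_cball content_ball unit_ball_vol_2)
  then have "real (card J) * q\<^sup>2 \<le> ((2 * \<theta> + 1) * D)\<^sup>2"
    using pi_gt_zero by (simp add: mult.left_commute[of _ pi])
  also have "((2 * \<theta> + 1) * D)\<^sup>2 = (2 * \<sigma> * \<theta> * (2 * \<theta> + 1))\<^sup>2 * q\<^sup>2"
  proof -
    have "(2 * \<theta> + 1) * D = 2 * \<sigma> * \<theta> * (2 * \<theta> + 1) * q" using \<sigma> \<theta> by (simp add: q_def)
    then show ?thesis by (simp only: power_mult_distrib)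
  qed
  finally show ?thesis using q by (simp add: J_def)
qed

text \<open>Carries a bound on the frontier part of a triangle to a strip at the price of
  \<open>e\<close>. The width depends on \<open>v\<close> and \<open>K\<close>, which is harmless
  because \<delta> tends to 0 on a fixed mesh and never enters a constant.\<close>

lemma near_frontier_bound:
  assumes K: "K \<in> T" and v: "continuous_on (closure \<Omega>) v" and e: "0 < e"
    and B: "\<And>x. x \<in> convex hull K \<Longrightarrow> x \<in> frontier \<Omega> \<Longrightarrow> (v x :: real)\<^sup>2 \<le> B"
  shows "\<exists>\<delta>>0. \<forall>x\<in>convex hull K. x \<in> strip \<delta> \<longrightarrow> (v x)\<^sup>2 \<le> B + e"
proof -
  have "\<exists>\<delta>>0. \<forall>x\<in>convex hull K. gap i x < \<delta> \<longrightarrow> (v x)\<^sup>2 \<le> B + e" if i: "i \<in> I" for i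
  proof -
    obtain \<delta> where \<delta>: "0 < \<delta>" "\<And>x. x \<in> convex hull K \<Longrightarrow> gap i x < \<delta> \<Longrightarrow> 0 < B + e - (v x)\<^sup>2"
    proof (rule compact_near_zero_set[of "convex hull K" "\<lambda>x. B + e - (v x)\<^sup>2" "gap i"])
      show "continuous_on (convex hull K) (\<lambda>x. B + e - (v x)\<^sup>2)"
        by (intro continuous_intros continuous_on_subset[OF v] hull_subset_closure K)
      show "0 < B + e - (v x)\<^sup>2" if "x \<in> convex hull K" "gap i x = 0" for x
      proof -
        have "x \<in> frontier \<Omega>" using that i hull_subset_closure[OF K] frontier_iff by blast
        then show ?thesis using B[OF that(1)] e by simp
      qed
      show "0 \<le> gap i x" if "x \<in> convex hull K" for x
        using gap_nonneg hull_subset_closure[OF K] i that by blast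
    qed (use hull_compact[OF K] continuous_gap in auto)
    have "(v x)\<^sup>2 \<le> B + e" if "x \<in> convex hull K" "gap i x < \<delta>" for x
      using \<delta>(2)[OF that] by simp
    with \<delta>(1) show ?thesis by blast
  qed
  then obtain d where d: "\<And>i. i \<in> I \<Longrightarrow> 0 < d i"
    "\<And>i x. i \<in> I \<Longrightarrow> x \<in> convex hull K \<Longrightarrow> gap i x < d i \<Longrightarrow> (v x)\<^sup>2 \<le> B + e" by metis
  define \<delta> where "\<delta> = Min (insert 1 (d ` I))"
  have "0 < \<delta>" using d finite_sides by (simp add: \<delta>_def)
  moreover have "\<delta> \<le> d i" if "i \<in> I" for i using that finite_sides by (simp add: \<delta>_def)
  ultimately show ?thesis
    using d(2) by (intro exI[of _ \<delta>]) (auto simp: strip_def intro: less_le_trans)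
qed

text \<open>The frontiers of the finitely many triangles are negligible, and off them each point of
  \<Omega> lies in exactly one triangle, in its interior. This splits integrals over \<Omega> into
  integrals over triangles, where \<open>\<tau>\<close> is a polynomial.\<close>

lemma AE_indicator_Omega:
  "AE x in lebesgue. indicator \<Omega> x = (\<Sum>K\<in>T. indicator (convex hull K) x :: real) \<and>
     (\<forall>K\<in>T. x \<in> convex hull K \<longrightarrow> x \<in> interior (convex hull K))"
proof -
  define N where "N = (\<Union>K\<in>T. frontier (convex hull K))"
  have "negligible N"
    unfolding N_def using finite_T by (intro negligible_Union) (auto simp: negligible_convex_frontier)
  then have "AE x in lebesgue. x \<notin> N"
    by (simp add: negligible_iff_null_sets AE_not_in)
  then show ?thesis
  proof (rule eventually_mono)
    fix x assume x: "x \<notin> N"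
    have int: "x \<in> interior (convex hull K)" if "K \<in> T" "x \<in> convex hull K" for K
      using x that closure_subset by (force simp: N_def frontier_def)
    have "indicator \<Omega> x = (\<Sum>K\<in>T. indicator (convex hull K) x :: real)"
    proof (cases "x \<in> \<Omega>")
      case True
      then obtain K where K: "K \<in> T" "x \<in> convex hull K" using covers closure_subset by blast
      have "x \<notin> convex hull K'" if "K' \<in> T - {K}" for K'
        using int[of K'] int[OF K] interiors_disjoint[OF K(1), of K'] that by auto
      then have "(\<Sum>K'\<in>T - {K}. indicator (convex hull K') x :: real) = 0"
        by (intro sum.neutral) auto
      then show ?thesis using True K sum.remove[OF finite_T K(1), of "\<lambda>K. indicator (convex hull K) x :: real"] by simp
    next
      case False
      then have "x \<notin> convex hull K" if "K \<in> T" for K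
        using int[OF that] interior_subset_Omega[OF that] by blast
      then show ?thesis using False by simp
    qed
    with int show "indicator \<Omega> x = (\<Sum>K\<in>T. indicator (convex hull K) x :: real) \<and>
     (\<forall>K\<in>T. x \<in> convex hull K \<longrightarrow> x \<in> interior (convex hull K))" by blast
  qed
qed

end

section \<open>The discrete boundary term\<close>

text \<open>The balance of scales in one triangle of area \<open>k\<close>, diameter
  \<open>D\<close> and inscribed radius \<open>r\<close>. The factor \<open>6 / r * k\<close> is, up
  to \<delta>, the measure of the strip of width 3 \<delta>; \<open>C * Q / k\<close> bounds the
  square of the field and \<open>m\<close> that of \<open>v\<close>. The Young parameter
  \<open>a\<close> is proportional to \<open>r\<close>, so in the first term \<open>k\<close> and
  \<open>r\<close> cancel exactly, and in the second only k/r^2 remains, which shape regularity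
  bounds by 4 \<pi> \<sigma>^2.\<close>

lemma young_local:
  fixes \<kappa> r C Q k m D \<sigma> :: real
  assumes pos: "0 < \<kappa>" "0 < r" "0 \<le> C" "0 \<le> Q" "0 \<le> m" "0 < k" and k: "k \<le> pi * D\<^sup>2" and D: "0 \<le> D" "D \<le> 2 * \<sigma> * r"
  defines "a \<equiv> \<kappa> * r / (3 * (C + 1))"
  shows "(a / 2 * (C * Q / k) + m / (2 * a)) * (6 / r * k) \<le> \<kappa> * Q + 36 * pi * \<sigma>\<^sup>2 * (C + 1) / \<kappa> * m"
proof -
  have a: "0 < a" using pos by (simp add: a_def)
  have "D\<^sup>2 \<le> (2 * \<sigma> * r)\<^sup>2" using D by (intro power_mono) auto
  then have "pi * D\<^sup>2 \<le> pi * (4 * \<sigma>\<^sup>2 * r\<^sup>2)" by (intro mult_left_mono) (auto simp: power_mult_distrib)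
  with k have "k \<le> pi * (4 * \<sigma>\<^sup>2 * r\<^sup>2)" by (rule order_trans)
  then have kr: "k / r\<^sup>2 \<le> 4 * pi * \<sigma>\<^sup>2" using pos by (simp add: divide_le_eq ac_simps)
  define c where "c = C + 1"
  have c: "0 < c" "C / c \<le> 1" using pos by (auto simp: c_def)
  have a_eq: "a = \<kappa> * r / (3 * c)" by (simp add: a_def c_def)
  have "(a / 2 * (C * Q / k)) * (6 / r * k) = \<kappa> * (C / c * Q)"
    using pos c by (simp add: a_eq field_simps)
  also have "\<dots> \<le> \<kappa> * (1 * Q)" using pos c by (intro mult_left_mono mult_right_mono) auto
  finally have 1: "(a / 2 * (C * Q / k)) * (6 / r * k) \<le> \<kappa> * Q" by simp
  have "m / (2 * a) * (6 / r * k) = 9 * c / \<kappa> * m * (k / r\<^sup>2)"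
    using pos c by (simp add: a_eq power2_eq_square field_simps)
  also have "\<dots> \<le> 9 * c / \<kappa> * m * (4 * pi * \<sigma>\<^sup>2)"
    using pos c kr by (intro mult_left_mono) auto
  finally have 2: "m / (2 * a) * (6 / r * k) \<le> 36 * pi * \<sigma>\<^sup>2 * (C + 1) / \<kappa> * m"
    by (simp add: c_def[symmetric] ac_simps)
  show ?thesis using 1 2 by (simp only: distrib_right)
qed

text \<open>The discrete trace inequality for the flux term. In the strip within a triangle, v^2 is
  nearly bounded by its frontier values, hence by the outflow edges that touch the triangle, and the
  square of \<open>\<tau>\<close> by the inverse inequality. \<open>C\<close> is obtained before
  \<open>T\<close>, \<open>\<tau>\<close> and \<open>v\<close>, which is the uniformity in the
  mesh.\<close>

lemma (in polygon) ex_flux_estimate: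
  assumes null: "\<And>a b. a \<noteq> b \<Longrightarrow> closed_segment a b \<subseteq> frontier \<Omega> \<Longrightarrow>
        {t \<in> {0..1}. a + t *\<^sub>R (b - a) \<notin> Gamma_plus \<Omega> \<beta> \<union> Gamma_minus \<Omega> \<beta>} \<in> null_sets lborel"
  obtains C where "0 \<le> C"
    "\<And>T \<tau> v g d. \<lbrakk>mesh \<Omega> T; shape_regular \<sigma> T; quasi_uniform \<theta> T; outflow_compatible \<Omega> \<beta> T;
      \<And>K. K \<in> T \<Longrightarrow> \<exists>p. poly2 m p \<and> (\<forall>x\<in>convex hull K. v x = p x);
      \<And>x. x \<in> Gamma_minus \<Omega> \<beta> \<Longrightarrow> v x = 0;
      \<And>i. integrable (lebesgue_on \<Omega>) (g i); \<And>i. weak_partial \<Omega> v i (g i);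
      \<And>i. (\<lambda>x. \<tau> x $ i) \<in> borel_measurable (lebesgue_on \<Omega>);
      \<And>K. K \<in> T \<Longrightarrow> \<exists>P. \<forall>i. line_poly m (P i) \<and> continuous_on UNIV (P i) \<and>
        (\<forall>x\<in>interior (convex hull K). \<tau> x $ i = P i x);
      integrable (lebesgue_on \<Omega>) d; weak_div \<Omega> \<tau> d\<rbrakk> \<Longrightarrow>
      \<bar>\<integral>x. (\<Sum>i\<in>UNIV. g i x * \<tau> x $ i) + d x * v x \<partial>lebesgue_on \<Omega>\<bar> \<le>
        (1 / 8) * (\<integral>x. (norm (\<tau> x))\<^sup>2 \<partial>lebesgue_on \<Omega>) +
        C * (\<Sum>e\<in>out_edges \<Omega> \<beta> T. inverse (diameter e) * edge_int e (\<lambda>x. (v x)\<^sup>2))"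
proof -
  obtain M where M: "0 \<le> M" and flux:
    "\<And>v g \<tau> d V T B \<delta>\<^sub>0. \<lbrakk>continuous_on \<Omega> v; \<And>x. x \<in> \<Omega> \<Longrightarrow> \<bar>v x\<bar> \<le> V;
      \<And>i. integrable (lebesgue_on \<Omega>) (g i); \<And>i. weak_partial \<Omega> v i (g i);
      \<And>i. (\<lambda>x. \<tau> x $ i) \<in> borel_measurable (lebesgue_on \<Omega>);
      \<And>i. AE x in lebesgue_on \<Omega>. \<bar>\<tau> x $ i\<bar> \<le> T; \<And>i. AE x in lebesgue_on \<Omega>. isCont (\<lambda>x. \<tau> x $ i) x;
      integrable (lebesgue_on \<Omega>) d; weak_div \<Omega> \<tau> d; 0 < \<delta>\<^sub>0;
      \<And>\<delta>. 0 < \<delta> \<Longrightarrow> \<delta> < \<delta>\<^sub>0 \<Longrightarrow>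
        (\<integral>x. indicator (strip (3 * \<delta>)) x * (\<bar>v x\<bar> * norm (\<tau> x)) \<partial>lebesgue_on \<Omega>) \<le> B * \<delta>\<rbrakk> \<Longrightarrow>
      \<bar>\<integral>x. (\<Sum>i\<in>UNIV. g i x * \<tau> x $ i) + d x * v x \<partial>lebesgue_on \<Omega>\<bar> \<le> M * B"
    by (rule ex_boundary_flux_bound) blast
  obtain C2 where C2: "0 \<le> C2" "\<And>(q :: pt \<Rightarrow> real) (K :: pt set) (x0 :: pt).
      \<lbrakk>line_poly (2 * m) q; continuous_on UNIV q; compact K; convex K; x0 \<in> K\<rbrakk>
      \<Longrightarrow> measure lborel K * \<bar>q x0\<bar> \<le> C2 * (\<integral>y. indicator K y * \<bar>q y\<bar> \<partial>lborel)"
    by (rule ex_inverse_inequality[where m = "2 * m"]) blast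
  obtain c1 where c1: "0 \<le> c1" "\<And>e v P x. \<lbrakk>card e = 2; poly2 m P; \<And>y. y \<in> convex hull e \<Longrightarrow> v y = P y; x \<in> convex hull e\<rbrakk>
      \<Longrightarrow> (v x)\<^sup>2 \<le> c1 * (inverse (diameter e) * edge_int e (\<lambda>x. (v x)\<^sup>2))"
    by (rule ex_edge_sup_bound[where m = m]) blast
  \<comment> \<open>Chosen so that the factor \<open>M\<close> of the boundary flux bound leaves at
    most the share 1/8 of the squared norm of \<open>\<tau>\<close>.\<close>
  define \<kappa> where "\<kappa> = 1 / (8 * (M + 1))"
  have \<kappa>: "0 < \<kappa>" "M * \<kappa> \<le> 1 / 8" using M by (auto simp: \<kappa>_def field_simps)
  define W where "W = 36 * pi * \<sigma>\<^sup>2 * (C2 + 1) / \<kappa>"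
  have W: "0 \<le> W" using \<kappa> C2 by (simp add: W_def)
  define N where "N = (2 * \<sigma> * \<theta> * (2 * \<theta> + 1))\<^sup>2"
  show ?thesis
  proof (rule that[of "M * W * c1 * N"])
    show "0 \<le> M * W * c1 * N" using M W c1 by (simp add: N_def)
    fix T \<tau> v g d
    assume mesh: "mesh \<Omega> T" "shape_regular \<sigma> T" "quasi_uniform \<theta> T" and out: "outflow_compatible \<Omega> \<beta> T"
      and vp: "\<And>K. K \<in> T \<Longrightarrow> \<exists>p. poly2 m p \<and> (\<forall>x\<in>convex hull K. v x = p x)"
      and v0: "\<And>x. x \<in> Gamma_minus \<Omega> \<beta> \<Longrightarrow> v x = 0"
      and g: "\<And>i. integrable (lebesgue_on \<Omega>) (g i)" "\<And>i. weak_partial \<Omega> v i (g i)"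
      and \<tau>m: "\<And>i. (\<lambda>x. \<tau> x $ i) \<in> borel_measurable (lebesgue_on \<Omega>)"
      and \<tau>p: "\<And>K. K \<in> T \<Longrightarrow> \<exists>P. \<forall>i. line_poly m (P i) \<and> continuous_on UNIV (P i) \<and>
        (\<forall>x\<in>interior (convex hull K). \<tau> x $ i = P i x)"
      and d: "integrable (lebesgue_on \<Omega>) d" "weak_div \<Omega> \<tau> d"
    interpret regular_mesh \<Omega> I n b T \<sigma> \<theta>
      by unfold_locales (use mesh in auto)
    let ?E = "out_edges \<Omega> \<beta> T"
    define S where "S e = inverse (diameter e) * edge_int e (\<lambda>x. (v x)\<^sup>2)" for e
    have vc: "continuous_on (closure \<Omega>) v"
      by (rule continuous_piecewise) (use vp poly2_continuous in blast)
    obtain V where V: "\<And>x. x \<in> \<Omega> \<Longrightarrow> \<bar>v x\<bar> \<le> V"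
    proof -
      have "bounded (v ` closure \<Omega>)"
        by (intro compact_imp_bounded compact_continuous_image vc compact_closure_Omega)
      then obtain V where "\<forall>y\<in>v ` closure \<Omega>. \<bar>y\<bar> \<le> V" by (auto simp: bounded_iff)
      then show ?thesis using closure_subset[of \<Omega>] by (intro that[of V]) blast
    qed
    have v\<Omega>: "continuous_on \<Omega> v" using vc closure_subset continuous_on_subset by blast
    have finE: "finite ?E"
    proof -
      have "?E \<subseteq> Pow (\<Union>T)" by (auto simp: out_edges_def edges_def)
      moreover have "finite (\<Union>T)" by (intro finite_Union finite_T finite_triangle)
      ultimately show ?thesis using finite_subset by (metis finite_Pow_iff)
    qed
    have edge: "card e = 2 \<and> e \<in> edges T \<and> (\<exists>K\<in>T. convex hull e \<subseteq> convex hull K)" if e: "e \<in> ?E" for e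
    proof -
      obtain K where "K \<in> T" "e \<subseteq> K" "card e = 2" using e by (auto simp: out_edges_def edges_def)
      moreover have "e \<in> edges T" using e by (simp add: out_edges_def)
      ultimately show ?thesis using hull_mono[of e K convex] by blast
    qed
    have S_nonneg: "0 \<le> S e" if "e \<in> ?E" for e
      unfolding S_def using edge[OF that] vc hull_subset_closure
      by (intro edge_mean_square_nonneg) (auto intro: continuous_on_subset)
    have S_sup: "(v x)\<^sup>2 \<le> c1 * S e" if e: "e \<in> ?E" and x: "x \<in> convex hull e" for e x
    proof -
      obtain K where K: "K \<in> T" "convex hull e \<subseteq> convex hull K" using edge[OF e] by blast
      obtain p where p: "poly2 m p" "\<forall>x\<in>convex hull K. v x = p x" using vp[OF K(1)] by blast
      show ?thesis unfolding S_def using edge[OF e] K(2) p(2) by (intro c1(2)[OF _ p(1) _ x]) auto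
    qed
    from \<tau>p have "\<forall>K\<in>T. \<exists>P. \<forall>i. line_poly m (P i) \<and> continuous_on UNIV (P i) \<and>
        (\<forall>x\<in>interior (convex hull K). \<tau> x $ i = P i x)" by blast
    then obtain P where P: "\<And>K i. K \<in> T \<Longrightarrow> line_poly m (P K i)" "\<And>K i. K \<in> T \<Longrightarrow> continuous_on UNIV (P K i)"
      "\<And>K i x. K \<in> T \<Longrightarrow> x \<in> interior (convex hull K) \<Longrightarrow> \<tau> x $ i = P K i x"
      unfolding bchoice_iff by blast
    have AE_int: "AE x in lebesgue_on \<Omega>. \<exists>K\<in>T. x \<in> interior (convex hull K)"
    proof -
      have "AE x in lebesgue. x \<in> \<Omega> \<longrightarrow> (\<exists>K\<in>T. x \<in> interior (convex hull K))"
        using AE_indicator_Omega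
      proof eventually_elim
        case (elim x)
        show ?case
        proof
          assume "x \<in> \<Omega>"
          then obtain K where "K \<in> T" "x \<in> convex hull K" using covers closure_subset by blast
          then show "\<exists>K\<in>T. x \<in> interior (convex hull K)" using elim by blast
        qed
      qed
      then show ?thesis by (simp add: AE_restrict_space_iff)
    qed
    have \<tau>_cont: "AE x in lebesgue_on \<Omega>. isCont (\<lambda>x. \<tau> x $ i) x" for i
      using AE_int
    proof eventually_elim
      case (elim x)
      then obtain K where K: "K \<in> T" "x \<in> interior (convex hull K)" by blast
      have "continuous_on (interior (convex hull K)) (P K i)"
        using continuous_on_subset[OF P(2)[OF K(1)] subset_UNIV] .
      then have "continuous_on (interior (convex hull K)) (\<lambda>x. \<tau> x $ i)"
        by (rule continuous_on_eq) (simp add: P(3)[OF K(1)])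
      then show ?case using K(2) by (simp add: continuous_on_eq_continuous_at)
    qed
    obtain B\<tau> where B\<tau>: "\<And>i. AE x in lebesgue_on \<Omega>. \<bar>\<tau> x $ i\<bar> \<le> B\<tau>"
    proof -
      have "\<exists>B. \<forall>x\<in>convex hull K. \<bar>P K i x\<bar> \<le> B" if K: "K \<in> T" for K i
      proof -
        have "bounded (P K i ` (convex hull K))"
          using P(2)[OF K] hull_compact[OF K] continuous_on_subset
          by (intro compact_imp_bounded compact_continuous_image) blast+
        then show ?thesis by (auto simp: bounded_iff)
      qed
      then obtain b where b: "\<And>K i x. K \<in> T \<Longrightarrow> x \<in> convex hull K \<Longrightarrow> \<bar>P K i x\<bar> \<le> b K i" by metis
      define B where "B = Max (insert 0 ((\<lambda>z. b (fst z) (snd z)) ` (T \<times> UNIV)))"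
      have bB: "b K i \<le> B" if "K \<in> T" for K i
        unfolding B_def using finite_T that by (intro Max_ge) (auto intro!: image_eqI[where x = "(K, i)"])
      show ?thesis
      proof (rule that[of B])
        show "AE x in lebesgue_on \<Omega>. \<bar>\<tau> x $ i\<bar> \<le> B" for i
          using AE_int
        proof eventually_elim
          case (elim x)
          then obtain K where K: "K \<in> T" "x \<in> interior (convex hull K)" by blast
          then have "\<bar>P K i x\<bar> \<le> b K i" using b interior_subset by blast
          then show ?case using P(3)[OF K] bB[OF K(1), of i] by simp
        qed
      qed
    qed
    define q where "q K x = (\<Sum>i\<in>UNIV. (P K i x)\<^sup>2)" for K x
    define Q where "Q K = (\<integral>y. indicator (convex hull K) y * q K y \<partial>lborel)" for K
    have q_cont: "continuous_on UNIV (q K)" if "K \<in> T" for K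
      unfolding q_def by (intro continuous_intros P(2) that)
    have q_nonneg: "0 \<le> q K x" for K x unfolding q_def by (simp add: sum_nonneg)
    have q_eq: "(norm (\<tau> x))\<^sup>2 = q K x" if "K \<in> T" "x \<in> interior (convex hull K)" for K x
      unfolding power2_norm_eq_inner inner_vec_def q_def
      by (simp add: P(3)[OF that, symmetric] power2_eq_square)
    have Q_nonneg: "0 \<le> Q K" for K
      unfolding Q_def by (intro Bochner_Integration.integral_nonneg) (simp add: q_nonneg)
    have iq: "integrable lborel (\<lambda>y. indicator (convex hull K) y * q K y)" if "K \<in> T" for K
      using borel_integrable_compact[OF hull_compact[OF that] continuous_on_subset[OF q_cont[OF that]]] by simp
    have hull_pos: "0 < measure lebesgue (convex hull K)" if K: "K \<in> T" for K
    proof -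
      obtain c r where r: "0 < r" "ball c r \<subseteq> convex hull K" using inscribed_ball[OF K] by metis
      have "0 < measure lebesgue (ball c r)" using r by (simp add: content_ball unit_ball_vol_2)
      also have "\<dots> \<le> measure lebesgue (convex hull K)"
        by (rule measure_mono_fmeasurable[OF r(2)]) (simp_all add: lmeasurable_compact hull_compact K)
      finally show ?thesis .
    qed
    have q_bound: "q K x \<le> C2 * Q K / measure lebesgue (convex hull K)" if K: "K \<in> T" and x: "x \<in> convex hull K" for K x
    proof -
      have "line_poly (2 * m) (q K)"
        unfolding q_def by (intro line_poly_sum line_poly_power P(1) K)
      from C2(2)[OF this q_cont[OF K] hull_compact[OF K] convex_convex_hull x]
      have "measure lebesgue (convex hull K) * q K x \<le> C2 * Q K"
        using compact_imp_closed[OF hull_compact[OF K]] q_nonneg by (simp add: Q_def)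
      then show ?thesis using hull_pos[OF K] by (simp add: field_simps)
    qed
    \<comment> \<open>All outflow edges touching \<open>K\<close> are collected, not only edges of
      \<open>K\<close>: a triangle may meet the frontier in a single vertex, where \<open>v\<close>
      is controlled by an edge of a neighbour.\<close>
    define mk where "mk K = c1 * (\<Sum>e\<in>{e\<in>?E. convex hull K \<inter> convex hull e \<noteq> {}}. S e)" for K
    have mk_nonneg: "0 \<le> mk K" for K
      unfolding mk_def using c1(1) S_nonneg by (intro mult_nonneg_nonneg sum_nonneg) auto
    have mk_bound: "(v x)\<^sup>2 \<le> mk K" if K: "K \<in> T" and x: "x \<in> convex hull K" "x \<in> frontier \<Omega>" for K x
    proof (cases "v x = 0")
      case False
      then obtain e where e: "e \<in> ?E" "x \<in> convex hull e"
        using outflow_edge[OF vc null v0 out x(2)] by blast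
      have "(v x)\<^sup>2 \<le> c1 * S e" by (rule S_sup[OF e])
      also have "S e \<le> (\<Sum>e\<in>{e\<in>?E. convex hull K \<inter> convex hull e \<noteq> {}}. S e)"
        by (rule member_le_sum) (use e x finE S_nonneg in auto)
      then have "c1 * S e \<le> mk K" unfolding mk_def using c1(1) by (rule mult_left_mono)
      finally show ?thesis .
    qed (simp add: mk_nonneg)
    \<comment> \<open>After exchanging the sums, each edge counts as often as triangles meet it, at
      most \<open>N\<close> times.\<close>
    have sum_mk: "(\<Sum>K\<in>T. mk K) \<le> c1 * N * (\<Sum>e\<in>?E. S e)"
    proof -
      have "(\<Sum>K\<in>T. \<Sum>e\<in>{e\<in>?E. convex hull K \<inter> convex hull e \<noteq> {}}. S e)
          = (\<Sum>K\<in>T. \<Sum>e\<in>?E. if convex hull K \<inter> convex hull e \<noteq> {} then S e else 0)"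
        using finE by (intro sum.cong refl sum.inter_filter) 
      also have "\<dots> = (\<Sum>e\<in>?E. \<Sum>K\<in>T. if convex hull K \<inter> convex hull e \<noteq> {} then S e else 0)"
        by (rule sum.swap)
      also have "\<dots> = (\<Sum>e\<in>?E. real (card {K\<in>T. convex hull K \<inter> convex hull e \<noteq> {}}) * S e)"
        using finite_T by (intro sum.cong refl) (simp flip: sum.inter_filter)
      also have "\<dots> \<le> (\<Sum>e\<in>?E. N * S e)"
        unfolding N_def using edge S_nonneg by (intro sum_mono mult_right_mono card_triangles_at_edge) auto
      finally have "c1 * (\<Sum>K\<in>T. \<Sum>e\<in>{e\<in>?E. convex hull K \<inter> convex hull e \<noteq> {}}. S e) \<le> c1 * (\<Sum>e\<in>?E. N * S e)"
        using c1(1) by (rule mult_left_mono)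
      then show ?thesis by (simp add: mk_def sum_distrib_left mult.assoc)
    qed
    have sum_Q: "(\<Sum>K\<in>T. Q K) = (\<integral>x. (norm (\<tau> x))\<^sup>2 \<partial>lebesgue_on \<Omega>)"
    proof -
      have leb: "(\<lambda>y. indicator (convex hull K) y * q K y) \<in> borel_measurable lborel" if "K \<in> T" for K
        using iq[OF that] by simp
      have "(\<integral>x. (norm (\<tau> x))\<^sup>2 \<partial>lebesgue_on \<Omega>) = (\<integral>x. indicator \<Omega> x *\<^sub>R (norm (\<tau> x))\<^sup>2 \<partial>lebesgue)"
        by (rule integral_restrict_space) simp
      also have "\<dots> = (\<integral>x. (\<Sum>K\<in>T. indicator (convex hull K) x * q K x) \<partial>lebesgue)"
      proof (rule integral_cong_AE)
        have "(\<lambda>x. (norm (\<tau> x))\<^sup>2) = (\<lambda>x. \<Sum>i\<in>UNIV. \<tau> x $ i * \<tau> x $ i)"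
          by (simp add: power2_norm_eq_inner inner_vec_def)
        then have "(\<lambda>x. (norm (\<tau> x))\<^sup>2) \<in> borel_measurable (lebesgue_on \<Omega>)"
          using \<tau>m by (auto intro!: borel_measurable_sum borel_measurable_times)
        then show "(\<lambda>x. indicator \<Omega> x *\<^sub>R (norm (\<tau> x))\<^sup>2) \<in> borel_measurable lebesgue"
          using borel_measurable_restrict_space_iff[of \<Omega> lebesgue "\<lambda>x. (norm (\<tau> x))\<^sup>2"] by simp
        show "(\<lambda>x. \<Sum>K\<in>T. indicator (convex hull K) x * q K x) \<in> borel_measurable lebesgue"
          by (intro borel_measurable_sum measurable_completion leb)
        show "AE x in lebesgue. indicator \<Omega> x *\<^sub>R (norm (\<tau> x))\<^sup>2 = (\<Sum>K\<in>T. indicator (convex hull K) x * q K x)"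
          using AE_indicator_Omega
        proof eventually_elim
          case (elim x)
          then have "indicator \<Omega> x *\<^sub>R (norm (\<tau> x))\<^sup>2 = (\<Sum>K\<in>T. indicator (convex hull K) x * (norm (\<tau> x))\<^sup>2)"
            by (simp add: sum_distrib_right)
          also have "\<dots> = (\<Sum>K\<in>T. indicator (convex hull K) x * q K x)"
            using elim q_eq by (intro sum.cong) (auto simp: indicator_def)
          finally show ?case .
        qed
      qed
      also have "\<dots> = (\<integral>x. (\<Sum>K\<in>T. indicator (convex hull K) x * q K x) \<partial>lborel)"
        by (intro integral_completion borel_measurable_sum leb)
      also have "\<dots> = (\<Sum>K\<in>T. Q K)"
        unfolding Q_def by (intro Bochner_Integration.integral_sum iq)
      finally show ?thesis by simp
    qed
    let ?\<Phi> = "\<bar>\<integral>x. (\<Sum>i\<in>UNIV. g i x * \<tau> x $ i) + d x * v x \<partial>lebesgue_on \<Omega>\<bar>"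
    have bound: "?\<Phi> \<le> M * (\<Sum>K\<in>T. \<kappa> * Q K + W * (mk K + e))" if e: "0 < e" for e
    proof -
      have "\<forall>K\<in>T. \<exists>\<delta>>0. \<forall>x\<in>convex hull K. x \<in> strip \<delta> \<longrightarrow> (v x)\<^sup>2 \<le> mk K + e"
        using near_frontier_bound[OF _ vc e] mk_bound by blast
      then obtain dk where dk: "\<And>K. K \<in> T \<Longrightarrow> 0 < dk K"
        "\<And>K x. K \<in> T \<Longrightarrow> x \<in> convex hull K \<Longrightarrow> x \<in> strip (dk K) \<Longrightarrow> (v x)\<^sup>2 \<le> mk K + e"
        unfolding bchoice_iff by blast
      \<comment> \<open>Divided by 3 because the strips in the flux bound have width
        \<open>3 * \<delta>\<close>.\<close>
      define \<delta>0 where "\<delta>0 = Min (insert 1 (dk ` T)) / 3"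
      have \<delta>0: "0 < \<delta>0" using dk finite_T by (simp add: \<delta>0_def)
      have \<delta>0_le: "3 * \<delta>0 \<le> dk K" if "K \<in> T" for K using that finite_T by (simp add: \<delta>0_def)
      have "\<forall>K\<in>T. \<exists>r. 0 < r \<and> (\<exists>c. ball c r \<subseteq> convex hull K) \<and> diameter K \<le> 2 * \<sigma> * r"
        using inscribed_ball by metis
      then obtain r where r: "\<And>K. K \<in> T \<Longrightarrow> 0 < r K" "\<And>K. K \<in> T \<Longrightarrow> \<exists>c. ball c (r K) \<subseteq> convex hull K"
        "\<And>K. K \<in> T \<Longrightarrow> diameter K \<le> 2 * \<sigma> * r K"
        unfolding bchoice_iff by blast
      define a where "a K = \<kappa> * r K / (3 * (C2 + 1))" for K
      have a: "0 < a K" if "K \<in> T" for K using r(1)[OF that] \<kappa> C2 by (simp add: a_def)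
      define bk where "bk K = a K / 2 * (C2 * Q K / measure lebesgue (convex hull K)) + (mk K + e) / (2 * a K)" for K
      have bk: "0 \<le> bk K" if "K \<in> T" for K
        using a[OF that] C2 Q_nonneg mk_nonneg[of K] e by (simp add: bk_def)
      have strip_int: "(\<integral>x. indicator (strip (3 * \<delta>)) x * (\<bar>v x\<bar> * norm (\<tau> x)) \<partial>lebesgue_on \<Omega>)
          \<le> (\<Sum>K\<in>T. \<kappa> * Q K + W * (mk K + e)) * \<delta>" if \<delta>: "0 < \<delta>" "\<delta> < \<delta>0" for \<delta>
      proof -
        have KS: "convex hull K \<inter> strip (3 * \<delta>) \<in> lmeasurable" if "K \<in> T" for K
          by (intro fmeasurable_Int_fmeasurable lmeasurable_compact hull_compact that) simp
        have iKS: "integrable lebesgue (indicator (convex hull K \<inter> strip (3 * \<delta>)) :: pt \<Rightarrow> real)" if "K \<in> T" for K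
          using KS[OF that] by (intro integrable_real_indicator) (auto simp: fmeasurable_def)
        have "(\<integral>x. indicator (strip (3 * \<delta>)) x * (\<bar>v x\<bar> * norm (\<tau> x)) \<partial>lebesgue_on \<Omega>)
           = (\<integral>x. indicator \<Omega> x *\<^sub>R (indicator (strip (3 * \<delta>)) x * (\<bar>v x\<bar> * norm (\<tau> x))) \<partial>lebesgue)"
          by (rule integral_restrict_space) simp
        also have "\<dots> \<le> (\<integral>x. (\<Sum>K\<in>T. indicator (convex hull K \<inter> strip (3 * \<delta>)) x * bk K) \<partial>lebesgue)"
        proof (rule integral_mono_AE')
          show "integrable lebesgue (\<lambda>x. \<Sum>K\<in>T. indicator (convex hull K \<inter> strip (3 * \<delta>)) x * bk K)"
            by (intro Bochner_Integration.integrable_sum integrable_mult_left iKS)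
          show "AE x in lebesgue. 0 \<le> (\<Sum>K\<in>T. indicator (convex hull K \<inter> strip (3 * \<delta>)) x * bk K)"
            using bk by (intro AE_I2 sum_nonneg mult_nonneg_nonneg) auto
          show "AE x in lebesgue. indicator \<Omega> x *\<^sub>R (indicator (strip (3 * \<delta>)) x * (\<bar>v x\<bar> * norm (\<tau> x)))
              \<le> (\<Sum>K\<in>T. indicator (convex hull K \<inter> strip (3 * \<delta>)) x * bk K)"
            using AE_indicator_Omega
          proof eventually_elim
            case (elim x)
            then have "indicator \<Omega> x *\<^sub>R (indicator (strip (3 * \<delta>)) x * (\<bar>v x\<bar> * norm (\<tau> x)))
               = (\<Sum>K\<in>T. indicator (convex hull K \<inter> strip (3 * \<delta>)) x * (\<bar>v x\<bar> * norm (\<tau> x)))"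
              by (simp add: sum_distrib_right indicator_inter_arith mult.assoc)
            also have "\<dots> \<le> (\<Sum>K\<in>T. indicator (convex hull K \<inter> strip (3 * \<delta>)) x * bk K)"
            proof (rule sum_mono)
              fix K assume K: "K \<in> T"
              show "indicator (convex hull K \<inter> strip (3 * \<delta>)) x * (\<bar>v x\<bar> * norm (\<tau> x))
                 \<le> indicator (convex hull K \<inter> strip (3 * \<delta>)) x * bk K"
              proof (cases "x \<in> convex hull K \<inter> strip (3 * \<delta>)")
                case True
                then have xi: "x \<in> interior (convex hull K)" using elim K by blast
                have "x \<in> strip (dk K)"
                  using True \<delta>0_le[OF K] \<delta> by (force simp: strip_def)
                then have vb: "(v x)\<^sup>2 \<le> mk K + e" using dk(2)[OF K] True by blast
                have tb: "(norm (\<tau> x))\<^sup>2 \<le> C2 * Q K / measure lebesgue (convex hull K)"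
                  using q_eq[OF K xi] q_bound[OF K] True by simp
                have "0 \<le> (a K * norm (\<tau> x) - \<bar>v x\<bar>)\<^sup>2" by simp
                then have "2 * a K * (\<bar>v x\<bar> * norm (\<tau> x)) \<le> (a K)\<^sup>2 * (norm (\<tau> x))\<^sup>2 + (v x)\<^sup>2"
                  by (simp add: power2_diff power_mult_distrib ac_simps)
                then have "2 * a K * (\<bar>v x\<bar> * norm (\<tau> x)) / (2 * a K) \<le> ((a K)\<^sup>2 * (norm (\<tau> x))\<^sup>2 + (v x)\<^sup>2) / (2 * a K)"
                  using a[OF K] by (intro divide_right_mono) auto
                then have "\<bar>v x\<bar> * norm (\<tau> x) \<le> a K / 2 * (norm (\<tau> x))\<^sup>2 + (v x)\<^sup>2 / (2 * a K)"
                  using a[OF K] by (simp add: add_divide_distrib power2_eq_square)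
                also have "\<dots> \<le> bk K"
                  unfolding bk_def using a[OF K] vb tb
                  by (intro add_mono mult_left_mono divide_right_mono) auto
                finally show ?thesis using True by simp
              qed simp
            qed
            finally show ?case .
          qed
        qed
        also have "\<dots> = (\<Sum>K\<in>T. measure lebesgue (convex hull K \<inter> strip (3 * \<delta>)) * bk K)"
          by (subst Bochner_Integration.integral_sum) (auto intro!: integrable_mult_left iKS)
        also have "\<dots> \<le> (\<Sum>K\<in>T. (\<kappa> * Q K + W * (mk K + e)) * \<delta>)"
        proof (rule sum_mono)
          fix K assume K: "K \<in> T"
          obtain c where c: "ball c (r K) \<subseteq> convex hull K" using r(2)[OF K] by blast
          let ?k = "measure lebesgue (convex hull K)"
          have "measure lebesgue (convex hull K \<inter> strip (3 * \<delta>)) \<le> 2 * (3 * \<delta>) / r K * ?k"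
            by (rule measure_strip[OF hull_compact[OF K] convex_convex_hull _ c r(1)[OF K]])
              (use gap_nonneg hull_subset_closure[OF K] \<delta> in auto)
          then have "measure lebesgue (convex hull K \<inter> strip (3 * \<delta>)) * bk K \<le> 2 * (3 * \<delta>) / r K * ?k * bk K"
            using bk[OF K] by (rule mult_right_mono)
          also have "\<dots> = \<delta> * (bk K * (6 / r K * ?k))" by simp
          also have "\<dots> \<le> \<delta> * (\<kappa> * Q K + W * (mk K + e))"
            unfolding bk_def a_def W_def
            using \<delta> \<kappa> r(1)[OF K] C2(1) Q_nonneg mk_nonneg[of K] e hull_pos[OF K] measure_hull_le[OF K]
              diameter_pos[OF K] r(3)[OF K]
            by (intro mult_left_mono young_local[where D = "diameter K"]) auto
          finally show "measure lebesgue (convex hull K \<inter> strip (3 * \<delta>)) * bk K \<le> (\<kappa> * Q K + W * (mk K + e)) * \<delta>"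
            by (simp add: mult.commute)
        qed
        finally show ?thesis by (simp add: sum_distrib_right)
      qed
      show ?thesis
        by (rule flux[OF v\<Omega> V g \<tau>m B\<tau> \<tau>_cont d \<delta>0 strip_int])
    qed
    have "?\<Phi> \<le> M * (\<Sum>K\<in>T. \<kappa> * Q K + W * mk K)"
    proof (rule field_le_epsilon)
      fix e :: real assume e: "0 < e"
      \<comment> \<open>The slack per triangle adds up to \<open>w\<close> times itself. It depends
        on the number of triangles, so it must be removed on the fixed mesh before the bound becomes
        uniform; taking \<open>e / (w + 1)\<close> does so.\<close>
      define w where "w = M * W * real (card T)"
      have w: "0 \<le> w" using M W by (simp add: w_def)
      have "?\<Phi> \<le> M * (\<Sum>K\<in>T. \<kappa> * Q K + W * (mk K + e / (w + 1)))"
        using e w by (intro bound) simp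
      also have "\<dots> = M * (\<Sum>K\<in>T. \<kappa> * Q K + W * mk K) + e * (w / (w + 1))"
        by (simp add: distrib_left sum.distrib w_def)
      also have "e * (w / (w + 1)) \<le> e * 1" using e w by (intro mult_left_mono) auto
      finally show "?\<Phi> \<le> M * (\<Sum>K\<in>T. \<kappa> * Q K + W * mk K) + e" by simp
    qed
    also have "\<dots> = M * \<kappa> * (\<Sum>K\<in>T. Q K) + M * W * (\<Sum>K\<in>T. mk K)"
      by (simp add: sum.distrib sum_distrib_left distrib_left mult.assoc)
    also have "\<dots> \<le> 1 / 8 * (\<Sum>K\<in>T. Q K) + M * W * (c1 * N * (\<Sum>e\<in>?E. S e))"
      using \<kappa>(2) sum_mk M W Q_nonneg
      by (intro add_mono mult_right_mono mult_left_mono) (auto intro: sum_nonneg)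
    finally show "?\<Phi> \<le> (1 / 8) * (\<integral>x. (norm (\<tau> x))\<^sup>2 \<partial>lebesgue_on \<Omega>) +
        M * W * c1 * N * (\<Sum>e\<in>?E. inverse (diameter e) * edge_int e (\<lambda>x. (v x)\<^sup>2))"
      by (simp add: sum_Q S_def mult.assoc)
  qed
qed

section \<open>Stability\<close>

lemma L2_D:
  assumes "L2 \<Omega> f"
  shows "f \<in> borel_measurable (lebesgue_on \<Omega>)" "integrable (lebesgue_on \<Omega>) (\<lambda>x. (f x)\<^sup>2)"
  using assms by (auto simp: L2_def)

lemma L2_mult_integrable:
  assumes f: "L2 \<Omega> f" and g: "L2 \<Omega> g"
  shows "integrable (lebesgue_on \<Omega>) (\<lambda>x. f x * g x)"
proof (rule Bochner_Integration.integrable_bound)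
  show "integrable (lebesgue_on \<Omega>) (\<lambda>x. (f x)\<^sup>2 + (g x)\<^sup>2)"
    by (intro Bochner_Integration.integrable_add L2_D f g)
  show "(\<lambda>x. f x * g x) \<in> borel_measurable (lebesgue_on \<Omega>)"
    by (intro borel_measurable_times L2_D f g)
  have "\<bar>f x * g x\<bar> \<le> (f x)\<^sup>2 + (g x)\<^sup>2" for x
  proof -
    have "2 * \<bar>f x\<bar> * \<bar>g x\<bar> \<le> (f x)\<^sup>2 + (g x)\<^sup>2"
      using sum_squares_bound[of "\<bar>f x\<bar>" "\<bar>g x\<bar>"] by simp
    moreover have "0 \<le> \<bar>f x\<bar> * \<bar>g x\<bar>" by simp
    ultimately show ?thesis by (simp only: abs_mult)
  qed
  then show "AE x in lebesgue_on \<Omega>. norm (f x * g x) \<le> norm ((f x)\<^sup>2 + (g x)\<^sup>2)"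
    by (intro AE_I2) simp
qed

lemma L2_add:
  assumes f: "L2 \<Omega> f" and g: "L2 \<Omega> g"
  shows "L2 \<Omega> (\<lambda>x. f x + g x)"
proof -
  have "integrable (lebesgue_on \<Omega>) (\<lambda>x. (f x)\<^sup>2 + (g x)\<^sup>2 + 2 * (f x * g x))"
    by (intro Bochner_Integration.integrable_add integrable_mult_right L2_mult_integrable L2_D f g)
  then show ?thesis
    using L2_D(1)[OF f] L2_D(1)[OF g] unfolding L2_def power2_sum
    by (auto intro: borel_measurable_add simp: mult.assoc)
qed

lemma L2_bounded_mult:
  assumes f: "f \<in> borel_measurable (lebesgue_on \<Omega>)" "AE x in lebesgue_on \<Omega>. \<bar>f x\<bar> \<le> B" and g: "L2 \<Omega> g"
  shows "L2 \<Omega> (\<lambda>x. f x * g x)"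
proof -
  have "integrable (lebesgue_on \<Omega>) (\<lambda>x. (g x)\<^sup>2 * (f x)\<^sup>2)"
  proof (rule integrable_mult_bounded[OF L2_D(2)[OF g], where B = "B\<^sup>2"])
    show "(\<lambda>x. (f x)\<^sup>2) \<in> borel_measurable (lebesgue_on \<Omega>)" by (rule borel_measurable_power[OF f(1)])
    show "AE x in lebesgue_on \<Omega>. (g x)\<^sup>2 \<noteq> 0 \<longrightarrow> \<bar>(f x)\<^sup>2\<bar> \<le> B\<^sup>2"
      using f(2) by eventually_elim (simp add: abs_le_square_iff[symmetric])
  qed
  then show ?thesis
    using f(1) L2_D(1)[OF g] unfolding L2_def power_mult_distrib
    by (auto intro: borel_measurable_times simp: mult.commute)
qed

lemma L2_integrable:
  assumes "bounded \<Omega>" "\<Omega> \<in> sets lebesgue" "L2 \<Omega> f"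
  shows "integrable (lebesgue_on \<Omega>) f"
proof -
  have "integrable (lebesgue_on \<Omega>) (\<lambda>x. 1 :: real)"
    by (rule integrable_lebesgue_on_bounded[OF assms(1,2), where B = 1]) auto
  then have "L2 \<Omega> (\<lambda>x. 1)" by (simp add: L2_def)
  from L2_mult_integrable[OF assms(3) this] show ?thesis by simp
qed

lemma L2_bounded:
  assumes "bounded \<Omega>" "\<Omega> \<in> sets lebesgue" "f \<in> borel_measurable (lebesgue_on \<Omega>)"
    "AE x in lebesgue_on \<Omega>. \<bar>f x\<bar> \<le> B"
  shows "L2 \<Omega> f"
  unfolding L2_def
proof (intro conjI integrable_lebesgue_on_bounded[OF assms(1,2), where B = "B\<^sup>2"])
  show "AE x in lebesgue_on \<Omega>. \<bar>(f x)\<^sup>2\<bar> \<le> B\<^sup>2"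
    using assms(4) by eventually_elim (simp add: abs_le_square_iff[symmetric])
qed (use assms(3) borel_measurable_power in auto)

lemma L2_inner_integrable:
  assumes "\<And>i. L2 \<Omega> (\<lambda>x. F x $ i)" "\<And>i. L2 \<Omega> (\<lambda>x. G x $ i)"
  shows "integrable (lebesgue_on \<Omega>) (\<lambda>x. F x \<bullet> (G x :: pt))"
  unfolding inner_vec_def inner_real_def
  by (intro Bochner_Integration.integrable_sum L2_mult_integrable assms)

lemma wgrad_props:
  assumes "H1 \<Omega> v"
  shows "L2 \<Omega> (\<lambda>x. wgrad \<Omega> v x $ i)" "weak_partial \<Omega> v i (\<lambda>x. wgrad \<Omega> v x $ i)"
proof -
  have "\<exists>g. L2 \<Omega> g \<and> weak_partial \<Omega> v i g" using assms by (simp add: H1_def)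
  from someI_ex[OF this] show "L2 \<Omega> (\<lambda>x. wgrad \<Omega> v x $ i)" "weak_partial \<Omega> v i (\<lambda>x. wgrad \<Omega> v x $ i)"
    by (simp_all add: wgrad_def)
qed

lemma wdiv_props:
  assumes "\<exists>g. L2 \<Omega> g \<and> weak_div \<Omega> \<tau> g"
  shows "L2 \<Omega> (wdiv \<Omega> \<tau>)" "weak_div \<Omega> \<tau> (wdiv \<Omega> \<tau>)"
  using someI_ex[OF assms] by (simp_all add: wdiv_def)

text \<open>\<open>wdiv\<close> is defined by choice and carries no information until a
  square-integrable weak divergence is known to exist; the sum of the diagonal weak partial
  derivatives is one.\<close>

lemma W1inf_weak_div:
  assumes \<Omega>: "bounded \<Omega>" "\<Omega> \<in> sets lebesgue" and \<beta>: "W1inf_field \<Omega> \<beta>"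
  shows "\<exists>g. L2 \<Omega> g \<and> weak_div \<Omega> \<beta> g"
proof -
  have "\<forall>i. \<exists>g. Linf \<Omega> g \<and> weak_partial \<Omega> (\<lambda>x. \<beta> x $ i) i g" using \<beta> by (simp add: W1inf_field_def)
  then obtain g where g: "\<And>i. Linf \<Omega> (g i)" "\<And>i. weak_partial \<Omega> (\<lambda>x. \<beta> x $ i) i (g i)" by metis
  have \<beta>i: "Linf \<Omega> (\<lambda>x. \<beta> x $ i)" for i using \<beta> by (simp add: W1inf_field_def)
  have int: "integrable (lebesgue_on \<Omega>) (\<lambda>x. f x * h x)" if f: "Linf \<Omega> f" and h: "smooth h" for f h
  proof -
    obtain B where B: "AE x in lebesgue_on \<Omega>. \<bar>f x\<bar> \<le> B" using f by (auto simp: Linf_def)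
    have fm: "f \<in> borel_measurable (lebesgue_on \<Omega>)" using f by (simp add: Linf_def)
    obtain a where a: "\<Omega> \<subseteq> cbox (- a) a" using bounded_subset_cbox_symmetric[OF \<Omega>(1)] by blast
    obtain C where C: "0 \<le> C" "\<And>x. x \<in> cbox (-a) a \<Longrightarrow> \<bar>h x\<bar> \<le> C"
      using bounded_on_cbox_obtain[OF smooth_continuous[OF h]] by blast
    show ?thesis
    proof (rule integrable_lebesgue_on_bounded[OF \<Omega>])
      show "(\<lambda>x. f x * h x) \<in> borel_measurable (lebesgue_on \<Omega>)"
        by (intro borel_measurable_times fm borel_measurable_lebesgue_onI smooth_borel h)
      show "AE x in lebesgue_on \<Omega>. \<bar>f x * h x\<bar> \<le> B * C"
        using B AE_space
      proof eventually_elim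
        case (elim x)
        then have "\<bar>h x\<bar> \<le> C" using a C by auto
        then show ?case unfolding abs_mult using elim C(1) by (intro mult_mono) auto
      qed
    qed
  qed
  have "L2 \<Omega> (g i)" for i
    using g(1)[of i] L2_bounded[OF \<Omega>] by (auto simp: Linf_def)
  then have "L2 \<Omega> (\<lambda>x. \<Sum>i\<in>UNIV. g i x)" unfolding sum_2 by (intro L2_add)
  moreover have "weak_div \<Omega> \<beta> (\<lambda>x. \<Sum>i\<in>UNIV. g i x)"
    unfolding weak_div_def
  proof (intro allI impI)
    fix \<phi> assume \<phi>: "test_fn \<Omega> \<phi>"
    have sm: "smooth \<phi>" by (rule test_fn_smooth[OF \<phi>])
    have "(\<integral>x. \<beta> x \<bullet> grad2 \<phi> x \<partial>lebesgue_on \<Omega>) = (\<integral>x. (\<Sum>i\<in>UNIV. \<beta> x $ i * pderiv2 i \<phi> x) \<partial>lebesgue_on \<Omega>)"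
      by (simp add: inner_vec_def grad2_def)
    also have "\<dots> = (\<Sum>i\<in>UNIV. \<integral>x. \<beta> x $ i * pderiv2 i \<phi> x \<partial>lebesgue_on \<Omega>)"
      by (intro Bochner_Integration.integral_sum int \<beta>i smooth_pderiv2 sm)
    also have "\<dots> = (\<Sum>i\<in>UNIV. - (\<integral>x. g i x * \<phi> x \<partial>lebesgue_on \<Omega>))"
      using g(2) \<phi> by (intro sum.cong refl) (simp add: weak_partial_def)
    also have "\<dots> = - (\<integral>x. (\<Sum>i\<in>UNIV. g i x * \<phi> x) \<partial>lebesgue_on \<Omega>)"
      by (subst Bochner_Integration.integral_sum) (intro int g sm, simp add: sum_negf)
    finally show "(\<integral>x. \<beta> x \<bullet> grad2 \<phi> x \<partial>lebesgue_on \<Omega>) = - (\<integral>x. (\<Sum>i\<in>UNIV. g i x) * \<phi> x \<partial>lebesgue_on \<Omega>)"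
      by (simp add: sum_distrib_right)
  qed
  ultimately show ?thesis by blast
qed

text \<open>The term \<open>q x *\<^sub>R x\<close> raises the degree by one. \<open>Suc k\<close>
  is also the degree of the Lagrange space, so a single bound serves \<open>\<tau>\<close> and
  \<open>v\<close> in the flux estimate.\<close>

lemma RT_space_components:
  assumes "\<tau> \<in> RT_space \<Omega> T k" "K \<in> T"
  shows "\<exists>P. \<forall>i. line_poly (Suc k) (P i) \<and> continuous_on UNIV (P i) \<and>
    (\<forall>x\<in>interior (convex hull K). \<tau> x $ i = P i x)"
proof -
  obtain p1 p2 q where p: "poly2 k p1" "poly2 k p2" "poly2 k q"
    "\<forall>x\<in>interior (convex hull K). \<tau> x = vector [p1 x, p2 x] + q x *\<^sub>R x"
    using assms unfolding RT_space_def by blast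
  define p where "p i = (if i = 1 then p1 else p2)" for i :: 2
  have pi: "poly2 k (p i)" for i using p by (simp add: p_def)
  have "vector [p1 x, p2 x] $ i = p i x" for x i
    using exhaust_2[of i] by (auto simp: p_def)
  then have "\<tau> x $ i = p i x + q x * x $ i" if "x \<in> interior (convex hull K)" for x i
    using p(4) that by simp
  moreover have "line_poly (Suc k) (\<lambda>x. p i x + q x * x $ i)" for i
    using line_poly_mult[OF poly2_line_poly[OF p(3)] line_poly_component[of i]] 
    by (intro line_poly_add line_poly_le[OF poly2_line_poly[OF pi]]) auto
  moreover have "continuous_on UNIV (\<lambda>x. p i x + q x * x $ i)" for i
    by (intro continuous_intros poly2_continuous[OF pi] poly2_continuous[OF p(3)])
  ultimately show ?thesis by (intro exI[of _ "\<lambda>i x. p i x + q x * x $ i"]) blast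
qed

text \<open>The energy argument before integration. With r and q the two residuals, add s (g . r) to
  q v, where s is the root of \<epsilon>: this yields s^2 |g|^2 + (c - D/2) v^2 plus the flux
  density s (g . \<tau> + d v) plus the convection density (2 v (g . \<beta>) + D v^2)/2. Young's
  inequality spends 1/4 of the gradient term on r and half of the coercive term on q.\<close>

lemma energy_pointwise:
  fixes g \<tau> \<beta> :: pt and \<epsilon> \<alpha> c d D v :: real
  assumes \<epsilon>: "0 \<le> \<epsilon>" and \<alpha>: "0 < \<alpha>" and c: "\<alpha> \<le> c - D / 2"
  shows "3 / 4 * (norm (sqrt \<epsilon> *\<^sub>R g))\<^sup>2 + \<alpha> / 2 * v\<^sup>2 \<le>
    (sqrt \<epsilon> * d + \<beta> \<bullet> g + c * v)\<^sup>2 / (2 * \<alpha>) + (norm (\<tau> + sqrt \<epsilon> *\<^sub>R g))\<^sup>2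
    - sqrt \<epsilon> * (g \<bullet> \<tau> + d * v) - (2 * v * (g \<bullet> \<beta>) + D * v\<^sup>2) / 2"
proof -
  define s where "s = sqrt \<epsilon>"
  define r where "r = \<tau> + s *\<^sub>R g"
  define q where "q = s * d + \<beta> \<bullet> g + c * v"
  have "0 \<le> (norm (r - (1 / 2 * s) *\<^sub>R g))\<^sup>2" by simp
  then have 1: "s * (g \<bullet> r) \<le> (norm r)\<^sup>2 + (norm (s *\<^sub>R g))\<^sup>2 / 4"
    by (simp add: power2_norm_eq_inner inner_diff_left inner_diff_right inner_commute power2_eq_square[of s] field_simps)
  have "0 \<le> (q - \<alpha> * v)\<^sup>2" by simp
  then have "2 * \<alpha> * (q * v) \<le> q\<^sup>2 + \<alpha>\<^sup>2 * v\<^sup>2" by (simp add: power2_diff power_mult_distrib ac_simps)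
  then have "2 * \<alpha> * (q * v) / (2 * \<alpha>) \<le> (q\<^sup>2 + \<alpha>\<^sup>2 * v\<^sup>2) / (2 * \<alpha>)"
    using \<alpha> by (intro divide_right_mono) auto
  then have 2: "q * v \<le> q\<^sup>2 / (2 * \<alpha>) + \<alpha> / 2 * v\<^sup>2"
    using \<alpha> by (simp add: add_divide_distrib power2_eq_square)
  have 3: "\<alpha> * v\<^sup>2 \<le> (c - D / 2) * v\<^sup>2" using c by (intro mult_right_mono) auto
  have g\<tau>: "s * (g \<bullet> \<tau>) = s * (g \<bullet> r) - (norm (s *\<^sub>R g))\<^sup>2"
    by (simp add: r_def inner_add_right power2_norm_eq_inner power2_eq_square[of s] algebra_simps)
  have qv: "q * v = s * d * v + v * (g \<bullet> \<beta>) + c * v\<^sup>2"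
    by (simp add: q_def power2_eq_square inner_commute algebra_simps)
  have "3 / 4 * (norm (s *\<^sub>R g))\<^sup>2 + \<alpha> / 2 * v\<^sup>2 \<le> q\<^sup>2 / (2 * \<alpha>) + (norm r)\<^sup>2
    - s * (g \<bullet> \<tau> + d * v) - (2 * v * (g \<bullet> \<beta>) + D * v\<^sup>2) / 2"
  proof -
    \<comment> \<open>With the nonlinear terms replaced by variables, the combination of the two
      Young inequalities and coercivity is linear arithmetic.\<close>
    have lin: "3 / 4 * x + a / 2 \<le> Q + R - (t + u) - (p + w)"
      if "y \<le> R + x / 4" "z \<le> Q + a / 2" "a \<le> e - w" "t = y - x" "z = u + p + e"
      for x y z a Q R t u p w e :: real
      using that by simp
    have "(2 * v * (g \<bullet> \<beta>) + D * v\<^sup>2) / 2 = v * (g \<bullet> \<beta>) + D / 2 * v\<^sup>2" by (simp add: field_simps)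
    moreover have "s * (g \<bullet> \<tau> + d * v) = s * (g \<bullet> \<tau>) + s * d * v" by (simp add: algebra_simps)
    moreover have "(c - D / 2) * v\<^sup>2 = c * v\<^sup>2 - D / 2 * v\<^sup>2" by (rule left_diff_distrib)
    moreover have "\<alpha> / 2 * v\<^sup>2 = \<alpha> * v\<^sup>2 / 2" by simp
    ultimately show ?thesis using lin[OF 1 _ _ g\<tau> qv] 2 3 by metis
  qed
  then show ?thesis by (simp add: s_def r_def q_def)
qed

text \<open>Both cases rest on this estimate for \<open>M1\<close>, whose edge sum carries no power
  of \<epsilon>. \<open>C\<close> is fixed before \<epsilon> and the mesh.\<close>

lemma (in polygon) stability:
  assumes \<beta>_W: "W1inf_field \<Omega> \<beta>" and \<beta>_cont: "continuous_on (closure \<Omega>) \<beta>"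
    and c_meas: "c \<in> borel_measurable (lebesgue_on \<Omega>)"
    and c_bound: "AE x in lebesgue_on \<Omega>. \<bar>c x\<bar> \<le> \<gamma>" and \<alpha>: "0 < \<alpha>"
    and coercive: "AE x in lebesgue_on \<Omega>. \<alpha> \<le> c x - wdiv \<Omega> \<beta> x / 2"
    and null: "\<And>a b. a \<noteq> b \<Longrightarrow> closed_segment a b \<subseteq> frontier \<Omega> \<Longrightarrow>
        {t \<in> {0..1}. a + t *\<^sub>R (b - a) \<notin> Gamma_plus \<Omega> \<beta> \<union> Gamma_minus \<Omega> \<beta>} \<in> null_sets lborel"
  obtains C where "0 \<le> C"
    "\<And>\<epsilon> T \<tau> v. \<lbrakk>0 < \<epsilon>; \<epsilon> \<le> 1; mesh \<Omega> T; shape_regular \<sigma> T; quasi_uniform \<theta> T;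
      outflow_compatible \<Omega> \<beta> T; (\<tau>, v) \<in> Uh \<Omega> \<beta> T k\<rbrakk> \<Longrightarrow>
      M1 \<Omega> \<epsilon> \<tau> v \<le> C * (G1 \<Omega> \<beta> c \<epsilon> \<tau> v (\<lambda>_. 0) +
        (\<Sum>e\<in>out_edges \<Omega> \<beta> T. inverse (diameter e) * edge_int e (\<lambda>x. (v x)\<^sup>2)))"
proof -
  obtain F where F: "0 \<le> F" and flux:
    "\<And>T \<tau> v g d. \<lbrakk>mesh \<Omega> T; shape_regular \<sigma> T; quasi_uniform \<theta> T; outflow_compatible \<Omega> \<beta> T;
      \<And>K. K \<in> T \<Longrightarrow> \<exists>p. poly2 (Suc k) p \<and> (\<forall>x\<in>convex hull K. v x = p x);
      \<And>x. x \<in> Gamma_minus \<Omega> \<beta> \<Longrightarrow> v x = 0;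
      \<And>i. integrable (lebesgue_on \<Omega>) (g i); \<And>i. weak_partial \<Omega> v i (g i);
      \<And>i. (\<lambda>x. \<tau> x $ i) \<in> borel_measurable (lebesgue_on \<Omega>);
      \<And>K. K \<in> T \<Longrightarrow> \<exists>P. \<forall>i. line_poly (Suc k) (P i) \<and> continuous_on UNIV (P i) \<and>
        (\<forall>x\<in>interior (convex hull K). \<tau> x $ i = P i x);
      integrable (lebesgue_on \<Omega>) d; weak_div \<Omega> \<tau> d\<rbrakk> \<Longrightarrow>
      \<bar>\<integral>x. (\<Sum>i\<in>UNIV. g i x * \<tau> x $ i) + d x * v x \<partial>lebesgue_on \<Omega>\<bar> \<le>
        (1 / 8) * (\<integral>x. (norm (\<tau> x))\<^sup>2 \<partial>lebesgue_on \<Omega>) +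
        F * (\<Sum>e\<in>out_edges \<Omega> \<beta> T. inverse (diameter e) * edge_int e (\<lambda>x. (v x)\<^sup>2))"
    by (rule ex_flux_estimate[OF null, where m = "Suc k" and \<sigma> = \<sigma> and \<theta> = \<theta>]) blast+
  note \<Omega> = bounded_Omega Omega_sets(2)
  have \<beta>i: "(\<lambda>x. \<beta> x $ i) \<in> borel_measurable (lebesgue_on \<Omega>)" for i
    using \<beta>_W by (simp add: W1inf_field_def Linf_def)
  have "\<exists>B. AE x in lebesgue_on \<Omega>. \<bar>\<beta> x $ i\<bar> \<le> B" for i
    using \<beta>_W by (simp add: W1inf_field_def Linf_def)
  then obtain B0 where B0: "\<And>i. AE x in lebesgue_on \<Omega>. \<bar>\<beta> x $ i\<bar> \<le> B0 i" by metis
  define B where "B = max (B0 1) (B0 2)"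
  have \<beta>B: "AE x in lebesgue_on \<Omega>. \<bar>\<beta> x $ i\<bar> \<le> B" for i
    using B0[of i] by eventually_elim (use exhaust_2[of i] in \<open>auto simp: B_def\<close>)
  have "isCont (\<lambda>x. \<beta> x $ i) x" if "x \<in> \<Omega>" for x i
  proof -
    have "continuous_on \<Omega> (\<lambda>x. \<beta> x $ i)"
      by (intro continuous_intros continuous_on_subset[OF \<beta>_cont closure_subset])
    then show ?thesis using that open_Omega by (simp add: continuous_on_eq_continuous_at)
  qed
  then have \<beta>C: "AE x in lebesgue_on \<Omega>. isCont (\<lambda>x. \<beta> x $ i) x" for i by (intro AE_I2) simp
  define D where "D = wdiv \<Omega> \<beta>"
  have D: "L2 \<Omega> D" "weak_div \<Omega> \<beta> D"
    unfolding D_def by (rule wdiv_props[OF W1inf_weak_div[OF \<Omega> \<beta>_W]])+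
  \<comment> \<open>\<open>A\<close> dominates the coefficients 1/\<alpha>, 5/2 and 2 F found below.
    In \<open>C\<close>, the 2 and two of the 3 come from bounding \<tau> by the first residual and
    the gradient, the third from the gradient itself, and 1/\<alpha> from \<open>v\<close>.\<close>
  define A where "A = 1 / \<alpha> + 3 + 2 * F"
  define C where "C = 2 + (3 + 1 / \<alpha>) * A"
  have A: "0 \<le> A" using \<alpha> F by (simp add: A_def)
  show ?thesis
  proof (rule that[of C])
    show "0 \<le> C" using \<alpha> A by (simp add: C_def)
    fix \<epsilon> :: real and T \<tau> v
    assume \<epsilon>: "0 < \<epsilon>" "\<epsilon> \<le> 1" and reg: "mesh \<Omega> T" "shape_regular \<sigma> T" "quasi_uniform \<theta> T"
      and out: "outflow_compatible \<Omega> \<beta> T" and U: "(\<tau>, v) \<in> Uh \<Omega> \<beta> T k"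
    interpret polygon_mesh \<Omega> I n b T by unfold_locales (rule reg(1))
    define g where "g = wgrad \<Omega> v"
    define d where "d = wdiv \<Omega> \<tau>"
    define S where "S = (\<Sum>e\<in>out_edges \<Omega> \<beta> T. inverse (diameter e) * edge_int e (\<lambda>x. (v x)\<^sup>2))"
    have H1: "H1 \<Omega> v" and Hd: "Hdiv \<Omega> \<tau>" and RT: "\<tau> \<in> RT_space \<Omega> T k"
      and v0: "\<And>x. x \<in> Gamma_minus \<Omega> \<beta> \<Longrightarrow> v x = 0"
      and vp: "\<And>K. K \<in> T \<Longrightarrow> \<exists>p. poly2 (Suc k) p \<and> (\<forall>x\<in>convex hull K. v x = p x)"
      using U by (auto simp: Uh_def Lagrange_space_def)
    have g: "L2 \<Omega> (\<lambda>x. g x $ i)" "weak_partial \<Omega> v i (\<lambda>x. g x $ i)" for i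
      unfolding g_def by (rule wgrad_props[OF H1])+
    have d: "L2 \<Omega> d" "weak_div \<Omega> \<tau> d"
      unfolding d_def using Hd by (auto intro!: wdiv_props simp: Hdiv_def)
    have \<tau>: "L2 \<Omega> (\<lambda>x. \<tau> x $ i)" for i using Hd by (simp add: Hdiv_def)
    have v: "L2 \<Omega> v" using H1 by (simp add: H1_def)
    have vc: "continuous_on (closure \<Omega>) v"
      by (rule continuous_piecewise) (use vp poly2_continuous in blast)
    obtain V where V: "\<And>x. x \<in> \<Omega> \<Longrightarrow> \<bar>v x\<bar> \<le> V"
    proof -
      have "bounded (v ` closure \<Omega>)"
        by (intro compact_imp_bounded compact_continuous_image vc compact_closure_Omega)
      then obtain V where "\<forall>y\<in>v ` closure \<Omega>. \<bar>y\<bar> \<le> V" by (auto simp: bounded_iff)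
      then show ?thesis using closure_subset[of \<Omega>] by (intro that[of V]) blast
    qed
    have v\<Omega>: "continuous_on \<Omega> v" using vc closure_subset continuous_on_subset by blast
    let ?\<Phi> = "\<integral>x. g x \<bullet> \<tau> x + d x * v x \<partial>lebesgue_on \<Omega>"
    let ?\<Psi> = "\<integral>x. 2 * v x * (g x \<bullet> \<beta> x) + D x * (v x)\<^sup>2 \<partial>lebesgue_on \<Omega>"
    have \<Phi>: "\<bar>?\<Phi>\<bar> \<le> 1 / 8 * (\<integral>x. (norm (\<tau> x))\<^sup>2 \<partial>lebesgue_on \<Omega>) + F * S"
      using flux[OF reg out vp v0 L2_integrable[OF \<Omega> g(1)] g(2) L2_D(1)[OF \<tau>] RT_space_components[OF RT] L2_integrable[OF \<Omega> d(1)] d(2)]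
      by (simp add: S_def inner_vec_def)
    have \<Psi>: "0 \<le> ?\<Psi>"
      using convection_nonneg[OF v\<Omega> V L2_integrable[OF \<Omega> g(1)] g(2) \<beta>i \<beta>B \<beta>C L2_integrable[OF \<Omega> D(1)] D(2)
        outflow_sign[OF \<beta>_cont vc null v0] nonempty] by (simp add: inner_vec_def)
    define r where "r x = \<tau> x + sqrt \<epsilon> *\<^sub>R g x" for x
    define q where "q x = sqrt \<epsilon> * d x + \<beta> x \<bullet> g x + c x * v x" for x
    have const: "L2 \<Omega> (\<lambda>x. a * f x)" if "L2 \<Omega> f" for a f
      by (rule L2_bounded_mult[where B = "\<bar>a\<bar>"]) (use that in auto)
    have sg: "L2 \<Omega> (\<lambda>x. (sqrt \<epsilon> *\<^sub>R g x) $ i)" for i using const[OF g(1)] by simp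
    have r: "L2 \<Omega> (\<lambda>x. r x $ i)" for i using L2_add[OF \<tau>[of i] sg[of i]] by (simp add: r_def)
    have \<beta>g: "L2 \<Omega> (\<lambda>x. \<beta> x \<bullet> g x)"
      unfolding inner_vec_def inner_real_def sum_2 by (intro L2_add L2_bounded_mult[OF \<beta>i \<beta>B] g)
    have q: "L2 \<Omega> q"
      unfolding q_def[abs_def] by (intro L2_add const d \<beta>g L2_bounded_mult[OF c_meas c_bound] v)
    have norm_int: "integrable (lebesgue_on \<Omega>) (\<lambda>x. (norm (f x))\<^sup>2)" if "\<And>i. L2 \<Omega> (\<lambda>x. f x $ i)" for f :: "pt \<Rightarrow> pt"
      unfolding power2_norm_eq_inner by (intro L2_inner_integrable that)
    have i\<Phi>: "integrable (lebesgue_on \<Omega>) (\<lambda>x. g x \<bullet> \<tau> x + d x * v x)"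
      by (intro Bochner_Integration.integrable_add L2_inner_integrable L2_mult_integrable g \<tau> d v)
    have i\<Psi>: "integrable (lebesgue_on \<Omega>) (\<lambda>x. 2 * v x * (g x \<bullet> \<beta> x) + D x * (v x)\<^sup>2)"
    proof -
      have "L2 \<Omega> (\<lambda>x. v x * D x)"
        by (rule L2_bounded_mult[OF L2_D(1)[OF v] _ D(1), where B = V]) (use V in auto)
      then have "integrable (lebesgue_on \<Omega>) (\<lambda>x. 2 * (v x * (\<beta> x \<bullet> g x)) + v x * (v x * D x))"
        by (intro Bochner_Integration.integrable_add integrable_mult_right L2_mult_integrable v \<beta>g)
      then show ?thesis by (simp add: inner_commute power2_eq_square ac_simps)
    qed
    define X where "X = (\<integral>x. (norm (sqrt \<epsilon> *\<^sub>R g x))\<^sup>2 \<partial>lebesgue_on \<Omega>)"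
    define Y where "Y = (\<integral>x. (v x)\<^sup>2 \<partial>lebesgue_on \<Omega>)"
    define Z where "Z = (\<integral>x. (norm (\<tau> x))\<^sup>2 \<partial>lebesgue_on \<Omega>)"
    define R1 where "R1 = (\<integral>x. (norm (r x))\<^sup>2 \<partial>lebesgue_on \<Omega>)"
    define R2 where "R2 = (\<integral>x. (q x)\<^sup>2 \<partial>lebesgue_on \<Omega>)"
    note ints = norm_int[OF sg] L2_D(2)[OF v] norm_int[OF \<tau>] norm_int[OF r] L2_D(2)[OF q] i\<Phi> i\<Psi>
    have "(\<integral>x. 3 / 4 * (norm (sqrt \<epsilon> *\<^sub>R g x))\<^sup>2 + \<alpha> / 2 * (v x)\<^sup>2 \<partial>lebesgue_on \<Omega>) \<le>
      (\<integral>x. (q x)\<^sup>2 / (2 * \<alpha>) + (norm (r x))\<^sup>2 - sqrt \<epsilon> * (g x \<bullet> \<tau> x + d x * v x)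
        - (2 * v x * (g x \<bullet> \<beta> x) + D x * (v x)\<^sup>2) / 2 \<partial>lebesgue_on \<Omega>)"
    proof (rule integral_mono_AE)
      show "AE x in lebesgue_on \<Omega>. 3 / 4 * (norm (sqrt \<epsilon> *\<^sub>R g x))\<^sup>2 + \<alpha> / 2 * (v x)\<^sup>2 \<le>
        (q x)\<^sup>2 / (2 * \<alpha>) + (norm (r x))\<^sup>2 - sqrt \<epsilon> * (g x \<bullet> \<tau> x + d x * v x)
        - (2 * v x * (g x \<bullet> \<beta> x) + D x * (v x)\<^sup>2) / 2"
        using coercive
      proof eventually_elim
        case (elim x)
        show ?case
          using energy_pointwise[OF less_imp_le[OF \<epsilon>(1)] \<alpha> elim, of "g x" "v x" "d x" "\<beta> x" "\<tau> x"]
          unfolding r_def q_def D_def .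
      qed
    qed (intro Bochner_Integration.integrable_add Bochner_Integration.integrable_diff integrable_mult_right integrable_divide ints)+
    then have main: "3 / 4 * X + \<alpha> / 2 * Y \<le> R2 / (2 * \<alpha>) + R1 - sqrt \<epsilon> * ?\<Phi> - ?\<Psi> / 2"
      using ints by (simp add: X_def Y_def R1_def R2_def)
    have Z: "Z \<le> 2 * R1 + 2 * X"
    proof -
      have "Z \<le> (\<integral>x. 2 * (norm (r x))\<^sup>2 + 2 * (norm (sqrt \<epsilon> *\<^sub>R g x))\<^sup>2 \<partial>lebesgue_on \<Omega>)"
        unfolding Z_def
      proof (rule integral_mono)
        fix x
        have "\<tau> x = r x - sqrt \<epsilon> *\<^sub>R g x" by (simp add: r_def)
        moreover have "(norm (y - z))\<^sup>2 \<le> 2 * (norm y)\<^sup>2 + 2 * (norm z)\<^sup>2" for y z :: pt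
        proof -
          have "0 \<le> (norm (y + z))\<^sup>2" by simp
          then show ?thesis
            by (simp add: power2_norm_eq_inner inner_diff_left inner_diff_right inner_add_left inner_add_right inner_commute)
        qed
        ultimately show "(norm (\<tau> x))\<^sup>2 \<le> 2 * (norm (r x))\<^sup>2 + 2 * (norm (sqrt \<epsilon> *\<^sub>R g x))\<^sup>2"
          by (simp only:)
      qed (intro Bochner_Integration.integrable_add integrable_mult_right ints)+
      also have "\<dots> = 2 * R1 + 2 * X" using ints by (simp add: R1_def X_def)
      finally show ?thesis .
    qed
    have pos: "0 \<le> X" "0 \<le> Y" "0 \<le> R1" "0 \<le> R2" by (simp_all add: X_def Y_def R1_def R2_def)
    have S: "0 \<le> S"
      unfolding S_def
    proof (rule sum_nonneg)
      fix e assume "e \<in> out_edges \<Omega> \<beta> T"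
      then obtain K where K: "K \<in> T" "e \<subseteq> K" "card e = 2" by (auto simp: out_edges_def edges_def)
      have "convex hull e \<subseteq> closure \<Omega>" using hull_mono[OF K(2), of convex] hull_subset_closure[OF K(1)] by blast
      then show "0 \<le> inverse (diameter e) * edge_int e (\<lambda>x. (v x)\<^sup>2)"
        by (intro edge_mean_square_nonneg K continuous_on_subset[OF vc])
    qed
    \<comment> \<open>Here \<epsilon> \<le> 1 makes the estimate uniform in \<epsilon>.\<close>
    have "- (sqrt \<epsilon> * ?\<Phi>) \<le> sqrt \<epsilon> * \<bar>?\<Phi>\<bar>" using \<epsilon> by (simp add: abs_if)
    also have "\<dots> \<le> 1 * \<bar>?\<Phi>\<bar>" using \<epsilon> by (intro mult_right_mono) auto
    finally have "- (sqrt \<epsilon> * ?\<Phi>) \<le> 1 / 8 * Z + F * S" using \<Phi> by (simp add: Z_def)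
    \<comment> \<open>Z/8 is at most R1/4 + X/4, which leaves X/2 of the 3 X/4 on the left and makes
      the coefficient of \<open>R1\<close> equal to 5/4.\<close>
    then have half: "X / 2 + \<alpha> / 2 * Y \<le> R2 / (2 * \<alpha>) + 5 / 4 * R1 + F * S"
      using main Z \<Psi> by simp
    have "x + y \<le> a + 5 / 2 * b + 2 * f" if "x / 2 + y / 2 \<le> a / 2 + 5 / 4 * b + f" for x y a b f :: real
      using that by simp
    from this[of X "\<alpha> * Y" "1 / \<alpha> * R2" R1 "F * S"] half
    have "X + \<alpha> * Y \<le> 1 / \<alpha> * R2 + 5 / 2 * R1 + 2 * F * S" by (simp add: mult.assoc)
    also have "\<dots> \<le> A * R2 + A * R1 + A * S"
      using \<alpha> F pos S by (intro add_mono mult_right_mono) (auto simp: A_def)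
    finally have XY: "X + \<alpha> * Y \<le> A * (R1 + R2 + S)" by (simp add: algebra_simps)
    have "0 \<le> \<alpha> * Y" using pos \<alpha> by simp
    then have X: "X \<le> A * (R1 + R2 + S)" using XY by linarith
    have "\<alpha> * Y \<le> A * (R1 + R2 + S)" using XY pos by linarith
    then have Y: "Y \<le> 1 / \<alpha> * (A * (R1 + R2 + S))" using \<alpha> by (simp add: field_simps)
    have "Z + Y + X \<le> 2 * R1 + 3 * X + Y" using Z by linarith
    also have "\<dots> \<le> 2 * (R1 + R2 + S) + 3 * (A * (R1 + R2 + S)) + 1 / \<alpha> * (A * (R1 + R2 + S))"
      using X Y pos S by (intro add_mono) auto
    also have "\<dots> = C * (R1 + R2 + S)" by (simp only: C_def distrib_right mult.assoc)
    finally show "M1 \<Omega> \<epsilon> \<tau> v \<le> C * (G1 \<Omega> \<beta> c \<epsilon> \<tau> v (\<lambda>_. 0) +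
        (\<Sum>e\<in>out_edges \<Omega> \<beta> T. inverse (diameter e) * edge_int e (\<lambda>x. (v x)\<^sup>2)))"
      by (simp add: M1_def G1_def S_def[symmetric] X_def Y_def Z_def R1_def R2_def r_def q_def g_def d_def)
  qed
qed

text \<open>The edge terms occur on both sides, so adding them to \<open>M1\<close> costs just 1 in
  the constant. For i = 2 they are 1/\<epsilon> times the unweighted sum, and as that sum is
  nonnegative and 1/\<epsilon> \<ge> 1, the unweighted bound is the stronger one.\<close>

theorem theorem4p1:
  fixes \<Omega> :: "(real^2) set" and \<beta> :: "real^2 \<Rightarrow> real^2" and c :: "real^2 \<Rightarrow> real"
    and \<gamma> \<alpha>\<^sub>0 \<sigma> \<theta> :: real and k :: nat
  assumes polygon: "convex_polygon \<Omega>"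
    and beta_W1inf: "W1inf_field \<Omega> \<beta>"
    and beta_cont: "continuous_on (closure \<Omega>) \<beta>"
    and c_meas: "c \<in> borel_measurable (lebesgue_on \<Omega>)"
    and c_bound: "AE x in lebesgue_on \<Omega>. \<bar>c x\<bar> \<le> \<gamma>"
    and alpha_pos: "\<alpha>\<^sub>0 > 0"
    and coercive: "AE x in lebesgue_on \<Omega>. c x - wdiv \<Omega> \<beta> x / 2 \<ge> \<alpha>\<^sub>0"
    and char_null: "\<forall>a b. a \<noteq> b \<and> closed_segment a b \<subseteq> frontier \<Omega> \<longrightarrow>
        {t \<in> {0..1}. a + t *\<^sub>R (b - a) \<notin> Gamma_plus \<Omega> \<beta> \<union> Gamma_minus \<Omega> \<beta>} \<in> null_sets lborel"
  shows "(\<exists>C2>0. \<forall>\<epsilon> T \<tau> v. 0 < \<epsilon> \<and> \<epsilon> \<le> 1 \<and> mesh \<Omega> T \<and> shape_regular \<sigma> T \<and>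
            quasi_uniform \<theta> T \<and> outflow_compatible \<Omega> \<beta> T \<and> (\<tau>, v) \<in> Uh \<Omega> \<beta> T k \<longrightarrow>
            M2h \<Omega> \<beta> \<epsilon> T \<tau> v \<le> C2 * G2h \<Omega> \<beta> c \<epsilon> T \<tau> v (\<lambda>_. 0)) \<and>
         (\<exists>C3>0. \<forall>\<epsilon> T \<tau> v. 0 < \<epsilon> \<and> \<epsilon> \<le> 1 \<and> mesh \<Omega> T \<and> shape_regular \<sigma> T \<and>
            quasi_uniform \<theta> T \<and> outflow_compatible \<Omega> \<beta> T \<and> (\<tau>, v) \<in> Uh \<Omega> \<beta> T k \<longrightarrow>
            M3h \<Omega> \<beta> \<epsilon> T \<tau> v \<le> C3 * G3h \<Omega> \<beta> c \<epsilon> T \<tau> v (\<lambda>_. 0))"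
proof -
  obtain I :: "pt set set" and n b where "polygon \<Omega> I n b"
    using convex_polygon_imp_polygon[OF polygon] by blast
  then interpret polygon \<Omega> I n b .
  have null: "{t \<in> {0..1}. a + t *\<^sub>R (b - a) \<notin> Gamma_plus \<Omega> \<beta> \<union> Gamma_minus \<Omega> \<beta>} \<in> null_sets lborel"
    if "a \<noteq> b" "closed_segment a b \<subseteq> frontier \<Omega>" for a b
    using char_null that by blast
  obtain C where C: "0 \<le> C" and stable:
    "\<And>\<epsilon> T \<tau> v. \<lbrakk>0 < \<epsilon>; \<epsilon> \<le> 1; mesh \<Omega> T; shape_regular \<sigma> T; quasi_uniform \<theta> T;
      outflow_compatible \<Omega> \<beta> T; (\<tau>, v) \<in> Uh \<Omega> \<beta> T k\<rbrakk> \<Longrightarrow>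
      M1 \<Omega> \<epsilon> \<tau> v \<le> C * (G1 \<Omega> \<beta> c \<epsilon> \<tau> v (\<lambda>_. 0) +
        (\<Sum>e\<in>out_edges \<Omega> \<beta> T. inverse (diameter e) * edge_int e (\<lambda>x. (v x)\<^sup>2)))"
    by (rule stability[OF beta_W1inf beta_cont c_meas c_bound alpha_pos coercive null, where \<sigma> = \<sigma> and \<theta> = \<theta> and k = k]) blast+
  have G1_nonneg: "0 \<le> G1 \<Omega> \<beta> c \<epsilon> \<tau> v f" for \<epsilon> \<tau> v f
    by (simp add: G1_def)
  have scaled: "inverse (diameter e) * edge_int e (\<lambda>x. (inverse (sqrt \<epsilon>) * v x)\<^sup>2)
      = inverse \<epsilon> * (inverse (diameter e) * edge_int e (\<lambda>x. (v x)\<^sup>2))" if "0 < \<epsilon>" for \<epsilon> e v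
    using that by (simp add: edge_int_def Let_def power_mult_distrib power_inverse)
  have nonneg: "0 \<le> (\<Sum>e\<in>out_edges \<Omega> \<beta> T. inverse (diameter e) * edge_int e (\<lambda>x. (v x)\<^sup>2))"
    if "mesh \<Omega> T" "(\<tau>, v) \<in> Uh \<Omega> \<beta> T k" for T \<tau> v
  proof (rule sum_nonneg)
    interpret polygon_mesh \<Omega> I n b T by unfold_locales (rule that(1))
    have "continuous_on (closure \<Omega>) v"
    proof (rule continuous_piecewise)
      fix K assume "K \<in> T"
      then have "\<exists>p. poly2 (k + 1) p \<and> (\<forall>x\<in>convex hull K. v x = p x)"
        using that(2) by (auto simp: Uh_def Lagrange_space_def)
      then show "\<exists>p. continuous_on UNIV p \<and> (\<forall>x\<in>convex hull K. v x = p x)"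
        using poly2_continuous by blast
    qed
    moreover fix e assume "e \<in> out_edges \<Omega> \<beta> T"
    then obtain K where K: "K \<in> T" "e \<subseteq> K" "card e = 2" by (auto simp: out_edges_def edges_def)
    moreover have "convex hull e \<subseteq> closure \<Omega>"
      using hull_mono[OF K(2), of convex] hull_subset_closure[OF K(1)] by blast
    ultimately show "0 \<le> inverse (diameter e) * edge_int e (\<lambda>x. (v x)\<^sup>2)"
      by (intro edge_mean_square_nonneg) (auto intro: continuous_on_subset)
  qed
  \<comment> \<open>\<open>s\<close> is the unweighted edge sum of \<open>stability\<close>, and
    \<open>s'\<close> the edge sum of the functional at hand, with or without 1/\<epsilon>.\<close>
  have add: "m + s' \<le> (C + 1) * (g + s')" if "m \<le> C * (g + s)" "0 \<le> g" "s \<le> s'" for m g s s' :: real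
  proof -
    have "C * (g + s) \<le> C * (g + s')" using C that by (intro mult_left_mono) auto
    then show ?thesis using that by (simp add: algebra_simps)
  qed
  have "M2h \<Omega> \<beta> \<epsilon> T \<tau> v \<le> (C + 1) * G2h \<Omega> \<beta> c \<epsilon> T \<tau> v (\<lambda>_. 0)"
    if "0 < \<epsilon>" "\<epsilon> \<le> 1" "mesh \<Omega> T" "shape_regular \<sigma> T" "quasi_uniform \<theta> T"
      "outflow_compatible \<Omega> \<beta> T" "(\<tau>, v) \<in> Uh \<Omega> \<beta> T k" for \<epsilon> T \<tau> v
  proof -
    let ?S = "\<Sum>e\<in>out_edges \<Omega> \<beta> T. inverse (diameter e) * edge_int e (\<lambda>x. (v x)\<^sup>2)"
    have "1 * ?S \<le> inverse \<epsilon> * ?S"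
      using that(1,2) nonneg[OF that(3,7)] by (intro mult_right_mono) (auto simp: one_le_inverse)
    then show ?thesis
      unfolding M2h_def G2h_def scaled[OF that(1)] sum_distrib_left[symmetric]
      by (intro add[OF stable[OF that]] G1_nonneg) simp
  qed
  moreover have "M3h \<Omega> \<beta> \<epsilon> T \<tau> v \<le> (C + 1) * G3h \<Omega> \<beta> c \<epsilon> T \<tau> v (\<lambda>_. 0)"
    if "0 < \<epsilon>" "\<epsilon> \<le> 1" "mesh \<Omega> T" "shape_regular \<sigma> T" "quasi_uniform \<theta> T"
      "outflow_compatible \<Omega> \<beta> T" "(\<tau>, v) \<in> Uh \<Omega> \<beta> T k" for \<epsilon> T \<tau> v
    unfolding M3h_def G3h_def by (intro add[OF stable[OF that]] G1_nonneg) simp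
  moreover have "0 < C + 1" using C by simp
  ultimately show ?thesis by blast
qed

end
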